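(* Let $k$ be an algebraically closed field of characteristic $p>0$, let $q=p^e$ with $e>0$ be fixed, and let $n\geq 1$. There is a bijection between the set of projective equivalence classes of non-degenerate Frobenius forms of degree $q+1$ in $n$ variables over $k$ and the set of partitions of $n$. Moreover, exactly one of these equivalence classes defines an isolated singularity, namely the class represented by the diagonal form $x_1^{q+1}+x_2^{q+1}+\cdots+x_n^{q+1}$.
   Context: A Frobenius form of degree $q+1$ in $n$ variables is a homogeneous polynomial of degree $q+1$ in $k[x_1,\dots,x_n]$ lying in the ideal $\langle x_1^q,\dots,x_n^q\rangle$; equivalently, a polynomial of the form $\sum_{i=1}^n x_i^{q}L_i$ with $L_i$ linear forms. A form $f\in k[x_1,\dots,x_n]$ is non-degenerate if it cannot be written as a polynomial in fewer than $n$ variables after any invertible linear change of coordinates. Two forms in $k[x_1,\dots,x_n]$ are projectively equivalent if one is taken to the other by an invertible linear change of the coordinates $x_1,\dots,x_n$. A form defines an isolated singularity if the singular locus of the affine hypersurface it defines in $\mathbb A^n_k$ (the common zero locus of the form and all its partial derivatives) is the origin only. *)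

theory Defs
  imports
    "HOL-Library.Poly_Mapping"
    "HOL-Library.Multiset"
    "HOL-Computational_Algebra.Polynomial"
    "Jordan_Normal_Form.Matrix"
begin

text \<open>
  A monomial is its exponent function, so the sum of two monomials is their product; the
  convolution product of \<^theory>\<open>HOL-Library.Poly_Mapping\<close> is then the product of polynomials.
  The variables \<open>x\<^sub>1, \<dots>, x\<^sub>n\<close> are numbered \<open>0, \<dots>, n - 1\<close>, in line with the
  indexing of vectors and matrices.
\<close>

type_synonym 'a mpoly = "(nat \<Rightarrow>\<^sub>0 nat) \<Rightarrow>\<^sub>0 'a"

definition mvar :: "nat \<Rightarrow> 'a::comm_ring_1 mpoly" where
  "mvar i = Poly_Mapping.single (Poly_Mapping.single i 1) 1"

definition mconst :: "'a \<Rightarrow> 'a::comm_ring_1 mpoly" where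
  "mconst c = Poly_Mapping.single 0 c"

definition mvars :: "'a::comm_ring_1 mpoly \<Rightarrow> nat set" where
  "mvars f = (\<Union>m\<in>Poly_Mapping.keys f. Poly_Mapping.keys m)"

definition mdegree :: "(nat \<Rightarrow>\<^sub>0 nat) \<Rightarrow> nat" where
  "mdegree m = (\<Sum>i\<in>Poly_Mapping.keys m. Poly_Mapping.lookup m i)"

definition mpolys :: "nat \<Rightarrow> 'a::comm_ring_1 mpoly set" where
  "mpolys n = {f. mvars f \<subseteq> {..<n}}"

text \<open>The zero polynomial is a form of every degree.\<close>

definition forms :: "nat \<Rightarrow> nat \<Rightarrow> 'a::comm_ring_1 mpoly set" where
  "forms n d = {f \<in> mpolys n. \<forall>m\<in>Poly_Mapping.keys f. mdegree m = d}"

definition meval :: "'a::comm_ring_1 vec \<Rightarrow> 'a mpoly \<Rightarrow> 'a" where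
  "meval v f = (\<Sum>m\<in>Poly_Mapping.keys f. Poly_Mapping.lookup f m *
     (\<Prod>i\<in>Poly_Mapping.keys m. (v $ i) ^ Poly_Mapping.lookup m i))"

definition msubst :: "(nat \<Rightarrow> 'a::comm_ring_1 mpoly) \<Rightarrow> 'a mpoly \<Rightarrow> 'a mpoly" where
  "msubst \<sigma> f = (\<Sum>m\<in>Poly_Mapping.keys f. mconst (Poly_Mapping.lookup f m) *
     (\<Prod>i\<in>Poly_Mapping.keys m. \<sigma> i ^ Poly_Mapping.lookup m i))"

text \<open>
  The difference of exponents is truncated, which is harmless: if \<open>x\<^sub>i\<close> does not occur in the
  monomial \<open>m\<close>, the coefficient vanishes.
\<close>

definition mderiv :: "nat \<Rightarrow> 'a::comm_ring_1 mpoly \<Rightarrow> 'a mpoly" where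
  "mderiv i f = (\<Sum>m\<in>Poly_Mapping.keys f.
     Poly_Mapping.single (m - Poly_Mapping.single i 1)
       (of_nat (Poly_Mapping.lookup m i) * Poly_Mapping.lookup f m))"

definition lin_change :: "nat \<Rightarrow> 'a::comm_ring_1 mat \<Rightarrow> 'a mpoly \<Rightarrow> 'a mpoly" where
  "lin_change n A = msubst (\<lambda>i. \<Sum>j<n. mconst (A $$ (i, j)) * mvar j)"

definition GL_mat :: "nat \<Rightarrow> 'a::comm_ring_1 mat set" where
  "GL_mat n = {A \<in> carrier_mat n n. invertible_mat A}"

definition proj_equiv :: "nat \<Rightarrow> nat \<Rightarrow> ('a::comm_ring_1 mpoly \<times> 'a mpoly) set" where
  "proj_equiv n d =
     {(f, g). f \<in> forms n d \<and> g \<in> forms n d \<and> (\<exists>A\<in>GL_mat n. g = lin_change n A f)}"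

definition nondegenerate :: "nat \<Rightarrow> 'a::comm_ring_1 mpoly \<Rightarrow> bool" where
  "nondegenerate n f \<longleftrightarrow> \<not> (\<exists>A\<in>GL_mat n. card (mvars (lin_change n A f)) < n)"

definition frobenius_ideal :: "nat \<Rightarrow> nat \<Rightarrow> 'a::comm_ring_1 mpoly set" where
  "frobenius_ideal n q =
     {\<Sum>i<n. h i * mvar i ^ q | h. \<forall>i<n. h i \<in> mpolys n}"

definition frobenius_forms :: "nat \<Rightarrow> nat \<Rightarrow> 'a::comm_ring_1 mpoly set" where
  "frobenius_forms n q = forms n (q + 1) \<inter> frobenius_ideal n q"

definition nondeg_frobenius_forms :: "nat \<Rightarrow> nat \<Rightarrow> 'a::comm_ring_1 mpoly set" where
  "nondeg_frobenius_forms n q = {f \<in> frobenius_forms n q. nondegenerate n f}"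

definition frobenius_classes :: "nat \<Rightarrow> nat \<Rightarrow> 'a::comm_ring_1 mpoly set set" where
  "frobenius_classes n q = nondeg_frobenius_forms n q // proj_equiv n (q + 1)"

definition diagonal_form :: "nat \<Rightarrow> nat \<Rightarrow> 'a::comm_ring_1 mpoly" where
  "diagonal_form n d = (\<Sum>i<n. mvar i ^ d)"

definition singular_locus :: "nat \<Rightarrow> 'a::comm_ring_1 mpoly \<Rightarrow> 'a vec set" where
  "singular_locus n f =
     {v \<in> carrier_vec n. meval v f = 0 \<and> (\<forall>i<n. meval v (mderiv i f) = 0)}"

definition isolated_singularity :: "nat \<Rightarrow> 'a::comm_ring_1 mpoly \<Rightarrow> bool" where
  "isolated_singularity n f \<longleftrightarrow> singular_locus n f = {0\<^sub>v n}"

definition integer_partitions :: "nat \<Rightarrow> nat multiset set" where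
  "integer_partitions n = {P. 0 \<notin># P \<and> sum_mset P = n}"

end

theory Submission
  imports
    Defs
    "HOL-Library.Function_Algebras"
    "HOL-Combinatorics.Permutations"
    "HOL-Computational_Algebra.Primes"
    "Jordan_Normal_Form.Determinant"
begin

text \<open>
  A Frobenius form is \<open>f = \<Sum> M\<^sub>i\<^sub>j x\<^sub>i\<^sup>q x\<^sub>j\<close> for a unique matrix \<open>M\<close>, and since raising to the power \<open>q\<close>
  is additive, a change of coordinates by \<open>A\<close> replaces \<open>M\<close> by the matrix
  \<open>(A\<^sup>[\<^sup>q\<^sup>])\<^sup>T M A\<close>, where \<open>A\<^sup>[\<^sup>q\<^sup>]\<close> has the \<open>q\<close>-th powers of the entries of \<open>A\<close>. So the theorem
  classifies pairings \<open>B x y = \<Sum> M\<^sub>i\<^sub>j x\<^sub>i\<^sup>q y\<^sub>j\<close> on \<open>V = k\<^sup>n\<close>, which are linear on the right and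
  \<open>q\<close>-semilinear on the left, up to a change of basis.

  The normal form is a basis that is cut into chains \<open>v\<^sub>1, \<dots>, v\<^sub>l\<close> and single vectors (loops), where
  \<open>B\<close> takes the value \<open>1\<close> on consecutive members of a chain and on a loop paired with itself, and the
  value \<open>0\<close> on all other pairs of basis vectors. The chains of length \<open>1\<close> span the intersection of the two
  radicals and correspond to variables that can be eliminated; hence \<open>f\<close> is non-degenerate iff all chains have
  length at least \<open>2\<close>. The chain lengths together with a part \<open>1\<close> for each loop then form a partition
  of \<open>n\<close>, and every partition of \<open>n\<close> arises.

  Existence (\<open>normal_basis_exists\<close>) goes by induction on the dimension. If the right radical
  \<open>R\<close> of \<open>B\<close> vanishes, \<open>B\<close> has an orthonormal basis (\<open>orthonormal_basis\<close>). This is Lang's theorem for the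
  general linear group in disguise: the equation \<open>B y (\<phi> x) = (B x y)\<^sup>q\<close> defines a
  \<open>q\<^sup>2\<close>-semilinear injection \<open>\<phi>\<close>, over an algebraically closed field the fixed vectors of such
  a map span the space (\<open>semilinear_fixed_span\<close>), and on fixed vectors \<open>B\<close> is a Hermitian form, so that
  orthogonal vectors can be split off one at a time. If \<open>R \<noteq> 0\<close>, pass to the smaller space
  \<open>R\<^sup>\<bottom> / R\<close> and take a normal basis there; going back (\<open>normal_basis_lift\<close>) prolongs
  each chain at its front by two vectors and creates new chains of length \<open>2\<close> and \<open>1\<close>.

  Uniqueness (\<open>chain_type_unique\<close>) comes from the iterated orthogonal spaces \<open>V\<close>, \<open>V\<^sup>\<bottom>\<close>,
  \<open>V\<^sup>\<bottom>\<^sup>\<bottom>\<close>, and so on. They do not depend on a basis, a normal basis contains a basis of each of them, and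
  the number of chains of length at least \<open>j\<close> can be read off from their dimensions.

  Finally \<open>q = 0\<close> in \<open>k\<close>, so \<open>\<partial>f/\<partial>x\<^sub>j = \<Sum>\<^sub>i M\<^sub>i\<^sub>j x\<^sub>i\<^sup>q\<close>, and Euler's
  identity makes \<open>f\<close> vanish wherever its partial derivatives do. Hence the singular locus
  is the left radical of \<open>B\<close>. It is zero iff there are no chains at all, that is, iff \<open>B\<close> has an orthonormal
  basis and \<open>f\<close> is equivalent to the diagonal form.
\<close>

section \<open>Bases relative to a subspace\<close>

locale linear_space = vector_space scale
  for scale :: "'a::field \<Rightarrow> 'b::ab_group_add \<Rightarrow> 'b" (infixr "*s" 75)
begin

definition indep_mod :: "'b set \<Rightarrow> 'i set \<Rightarrow> ('i \<Rightarrow> 'b) \<Rightarrow> bool" where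
  "indep_mod X J c \<longleftrightarrow> (\<forall>\<alpha>. (\<Sum>j\<in>J. \<alpha> j *s c j) \<in> X \<longrightarrow> (\<forall>j\<in>J. \<alpha> j = 0))"

text \<open>
  Bases are indexed families, so that a basis can carry a combinatorial structure on its index set, and they are
  taken relative to a subspace \<open>X\<close> in place of working in the quotient by \<open>X\<close>.
\<close>

definition rel_basis :: "'b set \<Rightarrow> 'i set \<Rightarrow> ('i \<Rightarrow> 'b) \<Rightarrow> 'b set \<Rightarrow> bool" where
  "rel_basis X J c S \<longleftrightarrow> finite J \<and> c ` J \<subseteq> S \<and> indep_mod X J c \<and>
     (\<forall>x\<in>S. \<exists>\<alpha>. x - (\<Sum>j\<in>J. \<alpha> j *s c j) \<in> X)"

abbreviation fam_basis :: "'i set \<Rightarrow> ('i \<Rightarrow> 'b) \<Rightarrow> 'b set \<Rightarrow> bool" where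
  "fam_basis \<equiv> rel_basis {0}"

text \<open>
  In this form finite dimensionality visibly passes to subsets.
\<close>

definition fin_dim :: "'b set \<Rightarrow> bool" where
  "fin_dim S \<longleftrightarrow> (\<exists>F. finite F \<and> S \<subseteq> span F)"

lemma indep_modD: "indep_mod X J c \<Longrightarrow> (\<Sum>j\<in>J. \<alpha> j *s c j) \<in> X \<Longrightarrow> j \<in> J \<Longrightarrow> \<alpha> j = 0"
  by (auto simp: indep_mod_def)

lemma rel_basisD:
  assumes "rel_basis X J c S"
  shows "finite J" "j \<in> J \<Longrightarrow> c j \<in> S" "indep_mod X J c"
  using assms by (auto simp: rel_basis_def)

lemma rel_basis_expand:
  assumes "rel_basis X J c S" "x \<in> S"
  obtains \<alpha> where "x - (\<Sum>j\<in>J. \<alpha> j *s c j) \<in> X"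
  using assms unfolding rel_basis_def by blast

lemma fam_basis_expand:
  assumes "fam_basis J c S" "x \<in> S"
  obtains \<alpha> where "x = (\<Sum>j\<in>J. \<alpha> j *s c j)"
  using rel_basis_expand[OF assms] by auto

lemma fin_dim_subset: "fin_dim S \<Longrightarrow> T \<subseteq> S \<Longrightarrow> fin_dim T"
  unfolding fin_dim_def by blast

text \<open>
  A basis of \<open>S / X\<close> and a basis of \<open>X / Y\<close> combine to a basis of \<open>S / Y\<close>. Together with the next two
  lemmas this replaces dimension counts when bases are glued and adjusted.
\<close>

lemma rel_basis_trans:
  assumes c: "rel_basis X J c S" and b: "rel_basis Y I b X"
    and X: "subspace X" "X \<subseteq> S" and Y: "subspace Y" "Y \<subseteq> X"
  shows "rel_basis Y (J <+> I) (case_sum c b) S"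
proof -
  have fin: "finite J" "finite I" using c b by (auto simp: rel_basis_def)
  have split: "(\<Sum>k\<in>J <+> I. \<alpha> k *s case_sum c b k)
      = (\<Sum>j\<in>J. \<alpha> (Inl j) *s c j) + (\<Sum>i\<in>I. \<alpha> (Inr i) *s b i)" for \<alpha>
    using fin by (simp add: sum.Plus)
  have inX: "(\<Sum>i\<in>I. \<alpha> i *s b i) \<in> X" for \<alpha>
    using rel_basisD(2)[OF b] by (intro subspace_sum[OF X(1)] subspace_scale[OF X(1)])
  have ind: "indep_mod Y (J <+> I) (case_sum c b)"
    unfolding indep_mod_def
  proof (intro allI impI)
    fix \<alpha> assume *: "(\<Sum>k\<in>J <+> I. \<alpha> k *s case_sum c b k) \<in> Y"
    then have "(\<Sum>j\<in>J. \<alpha> (Inl j) *s c j) + (\<Sum>i\<in>I. \<alpha> (Inr i) *s b i) \<in> X"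
      using Y(2) unfolding split by blast
    then have "(\<Sum>j\<in>J. \<alpha> (Inl j) *s c j) \<in> X"
      using subspace_diff[OF X(1) _ inX[of "\<lambda>i. \<alpha> (Inr i)"]] by fastforce
    then have J0: "\<alpha> (Inl j) = 0" if "j \<in> J" for j
      using indep_modD[OF rel_basisD(3)[OF c], of "\<lambda>j. \<alpha> (Inl j)"] that by blast
    then have "(\<Sum>i\<in>I. \<alpha> (Inr i) *s b i) \<in> Y"
      using * unfolding split by simp
    then have "\<alpha> (Inr i) = 0" if "i \<in> I" for i
      using indep_modD[OF rel_basisD(3)[OF b], of "\<lambda>i. \<alpha> (Inr i)"] that by blast
    with J0 show "\<forall>k\<in>J <+> I. \<alpha> k = 0" by auto
  qed
  have "\<exists>\<alpha>. x - (\<Sum>k\<in>J <+> I. \<alpha> k *s case_sum c b k) \<in> Y" if x: "x \<in> S" for x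
  proof -
    obtain \<alpha> where \<alpha>: "x - (\<Sum>j\<in>J. \<alpha> j *s c j) \<in> X"
      using rel_basis_expand[OF c x] by blast
    obtain \<beta> where \<beta>: "x - (\<Sum>j\<in>J. \<alpha> j *s c j) - (\<Sum>i\<in>I. \<beta> i *s b i) \<in> Y"
      using rel_basis_expand[OF b \<alpha>] by blast
    show ?thesis
      by (rule exI[of _ "case_sum \<alpha> \<beta>"]) (use \<beta> in \<open>simp add: split diff_diff_eq\<close>)
  qed
  then show ?thesis
    using fin ind rel_basisD(2)[OF c] rel_basisD(2)[OF b] X(2)
    by (auto simp: rel_basis_def)
qed

lemma rel_basis_reindex:
  assumes "rel_basis X J c S" "bij_betw h I J"
  shows "rel_basis X I (c \<circ> h) S"
proof -
  have inj: "inj_on h I" and im: "h ` I = J" using assms(2) by (auto simp: bij_betw_def)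
  have s: "(\<Sum>i\<in>I. \<alpha> (h i) *s c (h i)) = (\<Sum>j\<in>J. \<alpha> j *s c j)" for \<alpha>
    using sum.reindex_bij_betw[OF assms(2), of "\<lambda>j. \<alpha> j *s c j"] by simp
  have "indep_mod X I (c \<circ> h)"
    unfolding indep_mod_def
  proof (intro allI impI ballI)
    fix \<alpha> i assume *: "(\<Sum>i\<in>I. \<alpha> i *s (c \<circ> h) i) \<in> X" and i: "i \<in> I"
    define \<beta> where "\<beta> j = \<alpha> (the_inv_into I h j)" for j
    have \<beta>: "\<beta> (h i) = \<alpha> i" if "i \<in> I" for i
      using that inj by (simp add: \<beta>_def the_inv_into_f_f)
    have "(\<Sum>j\<in>J. \<beta> j *s c j) \<in> X"
      using * \<beta> by (simp add: s[symmetric] cong: sum.cong)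
    then have "\<beta> (h i) = 0"
      using indep_modD[OF rel_basisD(3)[OF assms(1)]] i im by blast
    then show "\<alpha> i = 0" using \<beta> i by simp
  qed
  moreover have "\<exists>\<alpha>. x - (\<Sum>j\<in>I. \<alpha> j *s (c \<circ> h) j) \<in> X" if x: "x \<in> S" for x
  proof -
    obtain \<alpha> where "x - (\<Sum>j\<in>J. \<alpha> j *s c j) \<in> X"
      using rel_basis_expand[OF assms(1) x] by blast
    then have "x - (\<Sum>j\<in>I. \<alpha> (h j) *s (c \<circ> h) j) \<in> X" by (simp add: s)
    then show ?thesis by (rule exI[of _ "\<lambda>j. \<alpha> (h j)"])
  qed
  moreover have "finite I" using assms bij_betw_finite rel_basisD(1) by blast
  moreover have "(c \<circ> h) ` I \<subseteq> S"
    using im rel_basisD(2)[OF assms(1)] by auto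
  ultimately show ?thesis unfolding rel_basis_def by blast
qed

text \<open>
  The members of a basis of \<open>S / X\<close> are representatives of cosets and may be replaced by other representatives.
\<close>

lemma rel_basis_shift:
  assumes c: "rel_basis X J c S" and X: "subspace X" and S: "subspace S" "X \<subseteq> S"
    and d: "\<And>j. j \<in> J \<Longrightarrow> c j - c' j \<in> X"
  shows "rel_basis X J c' S"
proof -
  have e: "(\<Sum>j\<in>J. \<alpha> j *s c j) - (\<Sum>j\<in>J. \<alpha> j *s c' j) \<in> X" for \<alpha>
    unfolding sum_subtractf[symmetric] scale_right_diff_distrib[symmetric]
    using d by (intro subspace_sum[OF X] subspace_scale[OF X])
  have "indep_mod X J c'"
    unfolding indep_mod_def
  proof (intro allI impI)
    fix \<alpha> assume "(\<Sum>j\<in>J. \<alpha> j *s c' j) \<in> X"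
    then have "(\<Sum>j\<in>J. \<alpha> j *s c j) \<in> X"
      using subspace_add[OF X e[of \<alpha>]] by fastforce
    then show "\<forall>j\<in>J. \<alpha> j = 0"
      using indep_modD[OF rel_basisD(3)[OF c]] by blast
  qed
  moreover have "\<exists>\<alpha>. x - (\<Sum>j\<in>J. \<alpha> j *s c' j) \<in> X" if x: "x \<in> S" for x
  proof -
    obtain \<alpha> where "x - (\<Sum>j\<in>J. \<alpha> j *s c j) \<in> X"
      using rel_basis_expand[OF c x] by blast
    then have "x - (\<Sum>j\<in>J. \<alpha> j *s c' j) \<in> X"
      using subspace_add[OF X _ e[of \<alpha>]] by fastforce
    then show ?thesis by blast
  qed
  moreover have "c' j \<in> S" if j: "j \<in> J" for j
  proof -
    have "c j - (c j - c' j) \<in> S"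
      using d[OF j] S rel_basisD(2)[OF c j] by (blast intro: subspace_diff)
    then show ?thesis by simp
  qed
  ultimately show ?thesis using rel_basisD(1)[OF c] unfolding rel_basis_def by blast
qed

lemma indep_mod_set:
  assumes fin: "finite J" and c: "indep_mod {0} J c"
  shows "inj_on c J" "independent (c ` J)"
proof -
  have ind: "\<alpha> j = 0" if "(\<Sum>j\<in>J. \<alpha> j *s c j) = 0" "j \<in> J" for \<alpha> j
    using indep_modD[OF c, of \<alpha> j] that by simp
  show inj: "inj_on c J"
  proof (rule inj_onI, rule ccontr)
    fix i j assume ij: "i \<in> J" "j \<in> J" "c i = c j" "i \<noteq> j"
    define \<alpha> :: "_ \<Rightarrow> 'a" where "\<alpha> k = (if k = i then 1 else if k = j then -1 else 0)" for k
    have "(\<Sum>k\<in>J. \<alpha> k *s c k) = (\<Sum>k\<in>{i,j}. \<alpha> k *s c k)"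
      using ij fin by (intro sum.mono_neutral_right) (auto simp: \<alpha>_def)
    also have "\<dots> = 0" using ij by (simp add: \<alpha>_def)
    finally have "\<alpha> i = 0" using ind ij by blast
    then show False by (simp add: \<alpha>_def)
  qed
  show "independent (c ` J)"
  proof (rule independent_if_scalars_zero)
    fix f x assume *: "(\<Sum>x\<in>c ` J. f x *s x) = 0" "x \<in> c ` J"
    then have "(\<Sum>j\<in>J. f (c j) *s c j) = 0" using inj by (simp add: sum.reindex)
    then show "f x = 0" using ind[of "\<lambda>j. f (c j)"] * by auto
  qed (use fin in simp)
qed

lemma span_family:
  assumes "finite J" "inj_on c J" "x \<in> span (c ` J)"
  obtains \<alpha> where "x = (\<Sum>j\<in>J. \<alpha> j *s c j)"
proof -
  obtain u where "x = (\<Sum>v\<in>c ` J. u v *s v)"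
    using assms(1,3) by (auto simp: span_finite)
  then have "x = (\<Sum>j\<in>J. u (c j) *s c j)" using assms(2) by (simp add: sum.reindex)
  then show ?thesis by (rule that[of "\<lambda>j. u (c j)"])
qed

lemma sum_in_span: "(\<Sum>j\<in>J. \<alpha> j *s c j) \<in> span (c ` J)"
  by (intro span_sum span_scale span_base imageI)

lemma fam_basisI:
  assumes "finite J" "indep_mod {0} J c"
  shows "fam_basis J c (span (c ` J))"
  unfolding rel_basis_def
proof (intro conjI ballI)
  show "c ` J \<subseteq> span (c ` J)" by (rule span_superset)
  fix x assume "x \<in> span (c ` J)"
  then obtain \<alpha> where "x = (\<Sum>j\<in>J. \<alpha> j *s c j)"
    using span_family[OF assms(1) indep_mod_set(1)[OF assms]] by blast
  then show "\<exists>\<alpha>. x - (\<Sum>j\<in>J. \<alpha> j *s c j) \<in> {0}" by (auto intro!: exI[of _ \<alpha>])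
qed (use assms in auto)

lemma fam_basis_span:
  assumes "fam_basis J c S" "subspace S"
  shows "span (c ` J) = S"
proof (rule span_subspace)
  show "c ` J \<subseteq> S" using rel_basisD(2)[OF assms(1)] by auto
  show "S \<subseteq> span (c ` J)"
  proof
    fix x assume "x \<in> S"
    then obtain \<alpha> where "x = (\<Sum>j\<in>J. \<alpha> j *s c j)"
      using fam_basis_expand[OF assms(1)] by blast
    then show "x \<in> span (c ` J)" by (simp add: sum_in_span)
  qed
qed (rule assms)

lemma fam_basis_card:
  assumes "fam_basis J c S" "subspace S"
  shows "card J = dim S"
  using fam_basis_span[OF assms] indep_mod_set[OF rel_basisD(1,3)[OF assms(1)]]
  by (metis card_image dim_span_eq_card_independent)

text \<open>
  If the family did not span \<open>S\<close>, a further vector would give an independent family longer than a basis.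
\<close>

lemma fam_basis_of_card:
  assumes b: "fam_basis I b S" and S: "subspace S"
    and c: "finite J" "c ` J \<subseteq> S" "indep_mod {0} J c" and card: "card I \<le> card J"
  shows "fam_basis J c S"
proof -
  note cJ = indep_mod_set[OF c(1,3)]
  note bI = indep_mod_set[OF rel_basisD(1,3)[OF b]]
  have "S \<subseteq> span (c ` J)"
  proof (rule ccontr)
    assume "\<not> S \<subseteq> span (c ` J)"
    then obtain x where x: "x \<in> S" "x \<notin> span (c ` J)" by blast
    have "independent (insert x (c ` J))" using x cJ by (simp add: independent_insertI)
    moreover have "insert x (c ` J) \<subseteq> span (b ` I)" using x c fam_basis_span[OF b S] by simp
    ultimately have "card (insert x (c ` J)) \<le> card (b ` I)"
      using independent_span_bound[of "b ` I"] rel_basisD(1)[OF b] by blast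
    moreover have "x \<notin> c ` J" using x span_base by blast
    ultimately show False using cJ(1) bI(1) c(1) card by (simp add: card_image)
  qed
  then have "span (c ` J) = S" using c(2) S by (intro span_subspace)
  then show ?thesis using fam_basisI[OF c(1,3)] by simp
qed

text \<open>
  A basis of \<open>X\<close> is extended inside \<open>X \<union> Y\<close>; the vectors that are added form a basis of \<open>S / X\<close>. That they can
  be chosen in a prescribed set \<open>Y\<close> is what the lift of a normal basis needs.
\<close>

lemma rel_basis_exists:
  assumes S: "subspace S" "fin_dim S" and X: "subspace X" "X \<subseteq> S"
    and Y: "Y \<subseteq> S" "S \<subseteq> span (X \<union> Y)"
  obtains J where "J \<subseteq> Y" "rel_basis X J id S"
proof -
  obtain A where A: "A \<subseteq> X" "independent A" "X \<subseteq> span A"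
    using maximal_independent_subset by blast
  obtain B where B: "A \<subseteq> B" "B \<subseteq> A \<union> Y" "independent B" "A \<union> Y \<subseteq> span B"
    using maximal_independent_subset_extend[of A "A \<union> Y"] A by blast
  have spA: "span A = X" using A X by (intro span_subspace)
  have "X \<union> Y \<subseteq> span B" using B A(3) span_mono[OF B(1)] by blast
  then have SB: "S \<subseteq> span B" using Y(2) span_minimal[of "X \<union> Y" "span B"] by auto
  have "B \<subseteq> S" using B(2) A(1) X(2) Y(1) by blast
  then have finB: "finite B"
    using independent_span_bound[OF _ B(3)] S(2) unfolding fin_dim_def by blast
  define J where "J = B - A"
  have "J \<subseteq> Y" using B(2) by (auto simp: J_def)
  moreover have "rel_basis X J id S"
    unfolding rel_basis_def
  proof (intro conjI ballI)
    show "finite J" using finB by (simp add: J_def)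
    show "id ` J \<subseteq> S" using \<open>B \<subseteq> S\<close> by (auto simp: J_def)
    have finA: "finite A" using finB B(1) finite_subset by blast
    have decomp: "(\<Sum>v\<in>B. u v *s v) = (\<Sum>v\<in>J. u v *s v) + (\<Sum>v\<in>A. u v *s v)" for u
      using sum.subset_diff[OF B(1) finB] by (simp add: J_def)
    show "indep_mod X J id"
      unfolding indep_mod_def
    proof (intro allI impI ballI)
      fix \<alpha> j assume "(\<Sum>j\<in>J. \<alpha> j *s id j) \<in> X" and j: "j \<in> J"
      then have "(\<Sum>j\<in>J. \<alpha> j *s j) \<in> span A" using spA by simp
      then obtain u where u: "(\<Sum>j\<in>J. \<alpha> j *s j) = (\<Sum>v\<in>A. u v *s v)"
        using finA by (auto simp: span_finite)
      define w where "w v = (if v \<in> A then - u v else \<alpha> v)" for v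
      have "(\<Sum>v\<in>J. w v *s v) = (\<Sum>v\<in>J. \<alpha> v *s v)"
        by (intro sum.cong) (auto simp: w_def J_def)
      moreover have "(\<Sum>v\<in>A. w v *s v) = - (\<Sum>v\<in>A. u v *s v)"
        by (simp add: w_def sum_negf[symmetric])
      ultimately have "(\<Sum>v\<in>B. w v *s v) = 0"
        using u by (simp add: decomp)
      then have "w j = 0"
        using B(3) finB j unfolding independent_explicit_finite_subsets J_def by blast
      then show "\<alpha> j = 0" using j by (simp add: w_def J_def)
    qed
    fix x assume "x \<in> S"
    then obtain u where "x = (\<Sum>v\<in>B. u v *s v)" using SB finB by (auto simp: span_finite)
    then have "x - (\<Sum>v\<in>J. u v *s id v) = (\<Sum>v\<in>A. u v *s v)"
      by (simp add: decomp)
    moreover have "\<dots> \<in> X" using A(1) by (intro subspace_sum subspace_scale X) auto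
    ultimately show "\<exists>\<alpha>. x - (\<Sum>v\<in>J. \<alpha> v *s id v) \<in> X" by metis
  qed
  ultimately show ?thesis using that by blast
qed

lemma rel_basis_extend:
  assumes S: "subspace S" "fin_dim S" and X: "subspace X" "X \<subseteq> S"
    and c: "finite I" "indep_mod X I c" "c ` I \<subseteq> S"
    and Y: "Y \<subseteq> S" "S \<subseteq> span (X \<union> c ` I \<union> Y)"
  obtains J where "J \<subseteq> Y" "rel_basis X (J <+> I) (case_sum id c) S"
proof -
  define X' where "X' = {x + (\<Sum>i\<in>I. \<alpha> i *s c i) | x \<alpha>. x \<in> X}"
  have X'I: "x \<in> X \<Longrightarrow> x + (\<Sum>i\<in>I. \<alpha> i *s c i) \<in> X'" for x \<alpha> unfolding X'_def by blast
  have XX': "X \<subseteq> X'" using X'I[of _ "\<lambda>_. 0"] by auto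
  have cX': "c i \<in> X'" if "i \<in> I" for i
  proof -
    have "(\<Sum>k\<in>I. (if k = i then 1 else 0) *s c k) = (\<Sum>k\<in>I. if k = i then c k else 0)"
      by (intro sum.cong) auto
    also have "\<dots> = c i" using that c(1) by simp
    finally show ?thesis using X'I[OF subspace_0[OF X(1)], of "\<lambda>k. if k = i then 1 else 0"] by simp
  qed
  have sX': "subspace X'"
  proof (rule subspaceI)
    show "0 \<in> X'" using XX' subspace_0[OF X(1)] by blast
    fix x y assume "x \<in> X'" "y \<in> X'"
    then obtain u v \<alpha> \<beta> where "x = u + (\<Sum>i\<in>I. \<alpha> i *s c i)" "y = v + (\<Sum>i\<in>I. \<beta> i *s c i)"
      and uv: "u \<in> X" "v \<in> X" unfolding X'_def by blast
    then have "x + y = (u + v) + (\<Sum>i\<in>I. (\<alpha> i + \<beta> i) *s c i)"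
      by (simp add: scale_left_distrib sum.distrib algebra_simps)
    then show "x + y \<in> X'" using X'I subspace_add[OF X(1) uv] by simp
  next
    fix a x assume "x \<in> X'"
    then obtain u \<alpha> where "x = u + (\<Sum>i\<in>I. \<alpha> i *s c i)" "u \<in> X" unfolding X'_def by blast
    moreover from this have "a *s x = a *s u + (\<Sum>i\<in>I. (a * \<alpha> i) *s c i)"
      by (simp add: scale_right_distrib scale_sum_right)
    ultimately show "a *s x \<in> X'" using X'I subspace_scale[OF X(1)] by simp
  qed
  have X'S: "X' \<subseteq> S"
    unfolding X'_def using X(2) c(3)
    by (auto intro!: subspace_add[OF S(1)] subspace_sum[OF S(1)] subspace_scale[OF S(1)])
  have "span (X \<union> c ` I \<union> Y) \<subseteq> span (X' \<union> Y)"
    using XX' cX' by (intro span_mono) auto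
  then obtain J where J: "J \<subseteq> Y" "rel_basis X' J id S"
    using rel_basis_exists[OF S sX' X'S Y(1)] Y(2) by blast
  have "rel_basis X I c X'"
    unfolding rel_basis_def
  proof (intro conjI ballI)
    fix x assume "x \<in> X'"
    then obtain u \<alpha> where "x = u + (\<Sum>i\<in>I. \<alpha> i *s c i)" "u \<in> X" unfolding X'_def by blast
    then show "\<exists>\<alpha>. x - (\<Sum>i\<in>I. \<alpha> i *s c i) \<in> X" by (intro exI[of _ \<alpha>]) simp
  qed (use c cX' in auto)
  then show ?thesis
    using that J rel_basis_trans[OF J(2) _ sX' X'S X(1) XX'] by blast
qed

text \<open>
  Linear functionals that are independent on \<open>S\<close> have a dual family in \<open>S\<close>, without any assumption on the
  dimension of \<open>S\<close>: by independence some vector separates a new functional from the old ones,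
  and subtracting multiples corrects this vector and the old dual family.
\<close>

lemma dual_family:
  assumes "finite J" and S: "subspace S"
    and add: "\<And>j x y. x \<in> S \<Longrightarrow> y \<in> S \<Longrightarrow> f j (x + y) = f j x + f j y"
    and scale: "\<And>j a x. x \<in> S \<Longrightarrow> f j (a *s x) = a * f j x"
    and ind: "\<And>\<alpha>. (\<forall>x\<in>S. (\<Sum>j\<in>J. \<alpha> j * f j x) = 0) \<Longrightarrow> \<forall>j\<in>J. \<alpha> j = 0"
  shows "\<exists>x. \<forall>i\<in>J. x i \<in> S \<and> (\<forall>j\<in>J. f j (x i) = of_bool (i = j))"
  using assms(1) ind
proof (induction J rule: finite_induct)
  case empty
  then show ?case by simp
next
  case (insert k J)
  have diff: "f j (x - y) = f j x - f j y" if "x \<in> S" "y \<in> S" for j x y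
  proof -
    have "f j (x + (-1) *s y) = f j x + (-1) * f j y"
      using that add scale subspace_scale[OF S] by presburger
    then show ?thesis by (simp add: scale_minus_left)
  qed
  have f0: "f j 0 = 0" for j using scale[OF subspace_0[OF S], of j 0] by simp
  have fsum: "f j (sum g A) = (\<Sum>a\<in>A. f j (g a))" if "\<And>a. a \<in> A \<Longrightarrow> g a \<in> S" for j g A
    using that
  proof (induction A rule: infinite_finite_induct)
    case (insert a A)
    then have "sum g A \<in> S" by (intro subspace_sum[OF S]) auto
    then show ?case using insert by (simp add: add)
  qed (auto simp: f0)
  have "\<forall>j\<in>J. \<alpha> j = 0" if "\<forall>x\<in>S. (\<Sum>j\<in>J. \<alpha> j * f j x) = 0" for \<alpha>
  proof -
    define \<beta> where "\<beta> j = (if j = k then 0 else \<alpha> j)" for j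
    have "(\<Sum>j\<in>insert k J. \<beta> j * f j x) = (\<Sum>j\<in>J. \<alpha> j * f j x)" for x
      using insert.hyps by (auto simp: \<beta>_def intro!: sum.cong)
    then have "\<forall>j\<in>insert k J. \<beta> j = 0" using that by (intro insert.prems) simp
    then show ?thesis using insert.hyps by (auto simp: \<beta>_def split: if_splits)
  qed
  then obtain x where x: "\<And>i. i \<in> J \<Longrightarrow> x i \<in> S"
    "\<And>i j. i \<in> J \<Longrightarrow> j \<in> J \<Longrightarrow> f j (x i) = of_bool (i = j)"
    using insert.IH by blast
  define \<alpha> where "\<alpha> j = (if j = k then 1 else - f k (x j))" for j
  have "\<not> (\<forall>y\<in>S. (\<Sum>j\<in>insert k J. \<alpha> j * f j y) = 0)"
    using insert.prems[of \<alpha>] by (auto simp: \<alpha>_def)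
  then obtain y where y: "y \<in> S" "(\<Sum>j\<in>insert k J. \<alpha> j * f j y) \<noteq> 0" by blast
  have "(\<Sum>j\<in>insert k J. \<alpha> j * f j y) = f k y + (\<Sum>j\<in>J. - f k (x j) * f j y)"
    using insert.hyps by (auto simp: \<alpha>_def intro!: sum.cong)
  then have ny: "f k y - (\<Sum>j\<in>J. f j y * f k (x j)) \<noteq> 0"
    using y(2) by (simp add: sum_negf mult.commute)
  define z where "z = y - (\<Sum>j\<in>J. f j y *s x j)"
  have sS: "(\<Sum>j\<in>J. f j y *s x j) \<in> S"
    using x by (intro subspace_sum[OF S] subspace_scale[OF S])
  have zS: "z \<in> S" unfolding z_def using y sS by (intro subspace_diff[OF S])
  have fz: "f i z = f i y - (\<Sum>j\<in>J. f j y * f i (x j))" for i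
    unfolding z_def using y(1) sS x(1)
    by (simp add: diff fsum scale subspace_scale[OF S])
  have fz0: "f i z = 0" if "i \<in> J" for i
  proof -
    have "(\<Sum>j\<in>J. f j y * f i (x j)) = (\<Sum>j\<in>J. if j = i then f j y else 0)"
      using x(2) that by (intro sum.cong) auto
    then show ?thesis using that insert.hyps by (simp add: fz)
  qed
  have fzk: "f k z \<noteq> 0" using ny by (simp add: fz)
  define w where "w = (1 / f k z) *s z"
  have w: "w \<in> S" "f k w = 1" "\<And>i. i \<in> J \<Longrightarrow> f i w = 0"
    using zS fz0 fzk by (auto simp: w_def scale subspace_scale[OF S])
  define x' where "x' i = (if i = k then w else x i - f k (x i) *s w)" for i
  have "x' i \<in> S \<and> (\<forall>j\<in>insert k J. f j (x' i) = of_bool (i = j))" if "i \<in> insert k J" for i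
    using that w x insert.hyps
    by (auto simp: x'_def diff scale subspace_scale[OF S] intro!: subspace_diff[OF S])
  then show ?case by blast
qed

lemma fam_basis_exists:
  assumes "subspace S" "fin_dim S"
  obtains J where "J \<subseteq> S" "fam_basis J id S"
proof -
  have "S \<subseteq> span ({0} \<union> S)" using span_superset by blast
  then show ?thesis
    using rel_basis_exists[of S "{0}" S] assms subspace_0 that by auto
qed

text \<open>
  Applied to the iterates of a map, this is the minimal relation of a cyclic subspace: some \<open>w m\<close> depends, modulo \<open>U\<close>, on
  the earlier members, which are independent modulo \<open>U\<close>.
\<close>

lemma iterate_relation:
  assumes U: "subspace U" "fin_dim S" "U \<subseteq> S" and w: "\<And>i. w i \<in> S" "w (0::nat) \<notin> U"
  obtains m c where "m > 0" "w m - (\<Sum>i<m. c i *s w i) \<in> U" "indep_mod U {..<m} w"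
proof -
  define P where "P m \<longleftrightarrow> (\<exists>c. w m - (\<Sum>i<m. c i *s w i) \<in> U)" for m
  have indep: "indep_mod U {..<m} w" if "\<And>k. k < m \<Longrightarrow> \<not> P k" for m
    using that
  proof (induction m)
    case 0
    then show ?case by (simp add: indep_mod_def)
  next
    case (Suc m)
    show ?case
      unfolding indep_mod_def
    proof (intro allI impI)
      fix \<alpha> assume *: "(\<Sum>j<Suc m. \<alpha> j *s w j) \<in> U"
      have "\<alpha> m = 0"
      proof (rule ccontr)
        assume nz: "\<alpha> m \<noteq> 0"
        have "(1 / \<alpha> m) *s (\<Sum>j<Suc m. \<alpha> j *s w j) \<in> U"
          using * by (rule subspace_scale[OF U(1)])
        also have "(1 / \<alpha> m) *s (\<Sum>j<Suc m. \<alpha> j *s w j) = w m - (\<Sum>j<m. (- \<alpha> j / \<alpha> m) *s w j)"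
          using nz by (simp add: scale_right_distrib scale_sum_right sum_negf scale_minus_left)
        finally have "P m" unfolding P_def by (intro exI[of _ "\<lambda>j. - \<alpha> j / \<alpha> m"])
        then show False using Suc.prems by blast
      qed
      moreover from this have "(\<Sum>j<m. \<alpha> j *s w j) \<in> U" using * by simp
      then have "\<forall>j\<in>{..<m}. \<alpha> j = 0"
        using indep_modD[OF Suc.IH] Suc.prems by auto
      ultimately show "\<forall>j\<in>{..<Suc m}. \<alpha> j = 0" by (auto simp: less_Suc_eq)
    qed
  qed
  have "\<exists>m. P m"
  proof (rule ccontr)
    assume "\<nexists>m. P m"
    then have ind: "indep_mod {0} {..<m} w" for m
      using indep[of m] subspace_0[OF U(1)] unfolding indep_mod_def by auto
    obtain F where F: "finite F" "S \<subseteq> span F" using U(2) by (auto simp: fin_dim_def)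
    note i = indep_mod_set[OF finite_lessThan ind[of "Suc (card F)"]]
    have "w ` {..<Suc (card F)} \<subseteq> span F" using F w by auto
    then have "card (w ` {..<Suc (card F)}) \<le> card F"
      using independent_span_bound[OF F(1) i(2)] by blast
    then show False using i(1) by (simp add: card_image)
  qed
  then obtain m where m: "P m" "\<And>k. k < m \<Longrightarrow> \<not> P k" by (metis LeastI_ex not_less_Least)
  have "m \<noteq> 0" using m(1) w(2) by (auto simp: P_def intro!: Nat.gr0I)
  then show ?thesis using that m indep[OF m(2)] unfolding P_def by blast
qed

end

section \<open>Semilinear maps over an algebraically closed field\<close>

text \<open>
  The vector \<open>x = \<Sum>\<^sub>i t\<^sub>i \<phi>\<^sup>i w\<close> in a cyclic subspace with the relation \<open>\<phi>\<^sup>m w = \<Sum>\<^sub>i c\<^sub>i \<phi>\<^sup>i w\<close> is fixed by the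
  \<open>Q\<close>-semilinear map \<open>\<phi>\<close> if its coefficients solve this system. Eliminating all unknowns but the last one,
  \<open>X = t (m - 1)\<close>, leaves the additive equation \<open>X = \<Sum>\<^sub>j a\<^sub>j X ^ (Q ^ (m - j))\<close> with
  \<open>a\<^sub>j = c\<^sub>j ^ (Q ^ (m - 1 - j))\<close>. Dividing by \<open>X\<close> gives a polynomial
  with constant term \<open>-1\<close>, which is not constant as some \<open>c\<^sub>k\<close> is nonzero; its root is a nonzero solution.
\<close>

lemma additive_poly_root:
  fixes c :: "nat \<Rightarrow> 'a::alg_closed_field"
  assumes Q: "Q > (1::nat)" and m: "m > 0" and c: "c k \<noteq> 0" "k < m"
    and add: "\<And>a b::'a. (a + b) ^ Q = a ^ Q + b ^ Q"
  obtains t where "t (m - 1) \<noteq> 0" "t 0 = c 0 * t (m - 1) ^ Q"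
    "\<And>i. Suc i < m \<Longrightarrow> t (Suc i) = t i ^ Q + c (Suc i) * t (m - 1) ^ Q"
proof -
  have Qpos: "Q > 0" using Q by simp
  define d where "d i j = c j ^ (Q ^ (i - j))" for i j :: nat
  define g where "g = (\<Sum>j<m. monom (d (m - 1) j) (Q ^ (m - j) - 1)) - 1"
  have Qe: "Q ^ (m - j) > 1" if "j < m" for j
    using Q that by (intro one_less_power) auto
  have inj: "j = k" if "j < m" "Q ^ (m - j) - 1 = Q ^ (m - k) - 1" for j
  proof -
    have "Q ^ (m - j) = Q ^ (m - k)" using that Qe[of j] Qe[of k] c(2) by linarith
    then have "m - j = m - k" using Q by (simp add: power_inject_exp)
    then show ?thesis using that c(2) by simp
  qed
  have "coeff g (Q ^ (m - k) - 1)
      = (\<Sum>j<m. if Q ^ (m - j) - 1 = Q ^ (m - k) - 1 then d (m - 1) j else 0)"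
    using Qe[OF c(2)] by (simp add: g_def coeff_sum coeff_1 del: One_nat_def)
  also have "\<dots> = (\<Sum>j<m. if j = k then d (m - 1) j else 0)"
    using inj by (intro sum.cong if_cong refl) auto
  also have "\<dots> = d (m - 1) k" using c(2) by simp
  finally have nz: "coeff g (Q ^ (m - k) - 1) \<noteq> 0" using c(1) by (simp add: d_def)
  then have "degree g \<ge> Q ^ (m - k) - 1" by (rule le_degree)
  then have "degree g > 0" using Qe[OF c(2)] by linarith
  then obtain X where X: "poly g X = 0" using alg_closed_imp_poly_has_root by blast
  have X1: "(\<Sum>j<m. d (m - 1) j * X ^ (Q ^ (m - j) - 1)) = 1"
    using X by (simp add: g_def poly_sum poly_monom)
  have X0: "X \<noteq> 0"
  proof
    assume "X = 0"
    then have "(\<Sum>j<m. d (m - 1) j * X ^ (Q ^ (m - j) - 1)) = 0"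
    proof (intro sum.neutral ballI)
      fix j assume "j \<in> {..<m}"
      then have "Q ^ (m - j) - 1 > 0" using Qe[of j] by simp
      then show "d (m - 1) j * X ^ (Q ^ (m - j) - 1) = 0"
        using \<open>X = 0\<close> by (simp only: zero_power mult_zero_right)
    qed
    then show False using X1 by simp
  qed
  define t where "t i = (\<Sum>j\<le>i. d i j * X ^ (Q ^ (Suc i - j)))" for i
  have pw: "(\<Sum>i\<in>I. f i :: 'a) ^ Q = (\<Sum>i\<in>I. f i ^ Q)" for I :: "nat set" and f
    by (induction I rule: infinite_finite_induct) (use Qpos in \<open>auto simp: add\<close>)
  have top: "t (m - 1) = X"
  proof -
    have "t (m - 1) = (\<Sum>j<m. d (m - 1) j * X ^ (Q ^ (m - j)))"
      using m unfolding t_def by (intro sum.cong) auto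
    also have "\<dots> = (\<Sum>j<m. X * (d (m - 1) j * X ^ (Q ^ (m - j) - 1)))"
    proof (intro sum.cong refl)
      fix j assume "j \<in> {..<m}"
      then have "X ^ (Q ^ (m - j)) = X * X ^ (Q ^ (m - j) - 1)"
        using Qe[of j] by (metis One_nat_def Suc_lessD lessThan_iff power_minus_mult mult.commute)
      then show "d (m - 1) j * X ^ (Q ^ (m - j)) = X * (d (m - 1) j * X ^ (Q ^ (m - j) - 1))"
        by simp
    qed
    also have "\<dots> = X" using X1 by (simp add: sum_distrib_left[symmetric])
    finally show ?thesis .
  qed
  have step: "t (Suc i) = t i ^ Q + c (Suc i) * X ^ Q" for i
  proof -
    have "t i ^ Q = (\<Sum>j\<le>i. d (Suc i) j * X ^ (Q ^ (Suc (Suc i) - j)))"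
      unfolding t_def pw
    proof (intro sum.cong refl)
      fix j assume j: "j \<in> {..i}"
      then have "Suc i - j = Suc (i - j)" "Suc (Suc i) - j = Suc (Suc i - j)" by auto
      then show "(d i j * X ^ Q ^ (Suc i - j)) ^ Q = d (Suc i) j * X ^ Q ^ (Suc (Suc i) - j)"
        by (simp add: d_def power_mult_distrib power_mult[symmetric] mult.commute)
    qed
    then show ?thesis by (simp add: t_def d_def)
  qed
  show ?thesis
    by (rule that[of t]) (use X0 top step in \<open>auto simp: t_def d_def\<close>)
qed

locale alg_closed_linear_space = linear_space scale
  for scale :: "'a::alg_closed_field \<Rightarrow> 'b::ab_group_add \<Rightarrow> 'b" (infixr "*s" 75)
begin

text \<open>
  Let \<open>U\<close> be the span of the fixed vectors and suppose that \<open>w \<notin> U\<close>. The cyclic subspace generated by \<open>w\<close>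
  contains a vector \<open>x \<notin> U\<close> that is fixed modulo \<open>U\<close>. On \<open>U\<close> itself the map \<open>u \<mapsto> u - \<phi> u\<close> is surjective, because in
  coordinates with respect to fixed vectors it reads \<open>b \<mapsto> b - b\<^sup>Q\<close>. So \<open>x\<close> can be corrected by an element of \<open>U\<close> to a
  fixed vector outside \<open>U\<close>, a contradiction.
\<close>

lemma semilinear_fixed_span:
  fixes \<phi> :: "'b \<Rightarrow> 'b" and Q :: nat
  assumes S: "subspace S" "fin_dim S"
    and Q: "Q > 1" "\<And>a b::'a. (a + b) ^ Q = a ^ Q + b ^ Q"
    and phi: "\<And>x. x \<in> S \<Longrightarrow> \<phi> x \<in> S"
      "\<And>x y. x \<in> S \<Longrightarrow> y \<in> S \<Longrightarrow> \<phi> (x + y) = \<phi> x + \<phi> y"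
      "\<And>a x. x \<in> S \<Longrightarrow> \<phi> (a *s x) = a ^ Q *s \<phi> x"
      "\<And>x. x \<in> S \<Longrightarrow> \<phi> x = 0 \<Longrightarrow> x = 0"
  shows "span {x \<in> S. \<phi> x = x} = S"
proof (rule ccontr)
  define F where "F = {x \<in> S. \<phi> x = x}"
  define U where "U = span F"
  have Qpos: "Q > 0" using Q by simp
  have FS: "F \<subseteq> S" by (auto simp: F_def)
  have U: "subspace U" "U \<subseteq> S"
    using span_minimal[OF FS S(1)] by (auto simp: U_def)
  assume "span {x \<in> S. \<phi> x = x} \<noteq> S"
  then obtain w0 where w0: "w0 \<in> S" "w0 \<notin> U" using U by (auto simp: U_def F_def)
  have phi0: "\<phi> 0 = 0"
    using phi(3)[OF subspace_0[OF S(1)], of 0] zero_power[OF Qpos, where 'a='a] by simp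
  have phi_sum: "\<phi> (\<Sum>i\<in>I. g i) = (\<Sum>i\<in>I. \<phi> (g i))" if "\<And>i. i \<in> I \<Longrightarrow> g i \<in> S"
    for g :: "'c \<Rightarrow> 'b" and I
    using that
  proof (induction I rule: infinite_finite_induct)
    case (insert a A)
    then have "sum g A \<in> S" by (intro subspace_sum[OF S(1)]) auto
    then show ?case using insert by (simp add: phi(2))
  qed (auto simp: phi0)
  have phi_diff: "\<phi> (x - y) = \<phi> x - \<phi> y" if "x \<in> S" "y \<in> S" for x y
    using phi(2)[of "x - y" y] that subspace_diff[OF S(1)] by simp
  have U_exp: "\<exists>A a. finite A \<and> A \<subseteq> F \<and> u = (\<Sum>v\<in>A. a v *s v)" if "u \<in> U" for u
    using that unfolding U_def span_explicit by blast
  have phiU: "\<phi> (\<Sum>v\<in>A. a v *s v) = (\<Sum>v\<in>A. a v ^ Q *s v)" if "A \<subseteq> F" for A a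
  proof -
    have "\<phi> (\<Sum>v\<in>A. a v *s v) = (\<Sum>v\<in>A. \<phi> (a v *s v))"
      using that FS by (intro phi_sum subspace_scale[OF S(1)]) auto
    also have "\<dots> = (\<Sum>v\<in>A. a v ^ Q *s v)"
      using that FS by (intro sum.cong) (auto simp: phi(3) F_def subset_iff)
    finally show ?thesis .
  qed
  have UI: "(\<Sum>v\<in>A. a v *s v) \<in> U" if "A \<subseteq> F" for A a
    using that unfolding U_def by (intro span_sum span_scale span_base) auto
  have surjU: "\<exists>u'\<in>U. \<phi> u' = u" if u: "u \<in> U" for u
  proof -
    obtain A a where A: "finite A" "A \<subseteq> F" "u = (\<Sum>v\<in>A. a v *s v)" using U_exp[OF u] by blast
    have "\<exists>b. \<forall>v. b v ^ Q = a v" using nth_root_exists[OF Qpos] by (intro choice) blast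
    then obtain b where b: "\<And>v. b v ^ Q = a v" by blast
    show ?thesis using phiU[OF A(2), of b] UI[OF A(2), of b] A(3) b by auto
  qed
  have langU: "\<exists>u'\<in>U. u' - \<phi> u' = u" if u: "u \<in> U" for u
  proof -
    obtain A a where A: "finite A" "A \<subseteq> F" "u = (\<Sum>v\<in>A. a v *s v)" using U_exp[OF u] by blast
    have "\<exists>b. b - b ^ Q = a v" for v
    proof -
      define p where "p = [:- a v, 1:] - monom 1 Q"
      have "coeff p Q \<noteq> 0" using Q(1) by (cases Q) (auto simp: p_def coeff_pCons split: nat.splits)
      then have "degree p \<ge> Q" by (rule le_degree)
      then have "degree p > 0" using Qpos by linarith
      then obtain b where "poly p b = 0" using alg_closed_imp_poly_has_root by blast
      then have "b - a v = b ^ Q" by (simp add: p_def poly_monom)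
      then have "b - b ^ Q = a v" by (simp add: algebra_simps)
      then show ?thesis by blast
    qed
    then obtain b where b: "\<And>v. b v - b v ^ Q = a v" by metis
    have "(\<Sum>v\<in>A. b v *s v) - \<phi> (\<Sum>v\<in>A. b v *s v) = u"
      using A(3) b by (simp add: phiU[OF A(2)] sum_subtractf[symmetric] scale_left_diff_distrib[symmetric])
    then show ?thesis using UI[OF A(2)] by blast
  qed
  define w where "w i = (\<phi> ^^ i) w0" for i
  have w: "w i \<in> S" "\<phi> (w i) = w (Suc i)" "w 0 \<notin> U" for i
  proof -
    show "w i \<in> S" by (induction i) (auto simp: w_def w0 phi(1))
  qed (use w0 in \<open>auto simp: w_def\<close>)
  obtain m c where mc: "m > 0" "w m - (\<Sum>i<m. c i *s w i) \<in> U" "indep_mod U {..<m} w"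
    using iterate_relation[OF U(1) S(2) U(2), of w] w by blast
  \<comment> \<open>Otherwise \<open>w m\<close> lies in \<open>U\<close>, which \<open>\<phi>\<close> maps onto itself, and injectivity puts \<open>w (m - 1)\<close> into \<open>U\<close>.\<close>
  have "\<exists>k<m. c k \<noteq> 0"
  proof (rule ccontr)
    assume "\<not> (\<exists>k<m. c k \<noteq> 0)"
    then have "w m \<in> U" using mc(2) by simp
    then obtain u where u: "u \<in> U" "\<phi> u = \<phi> (w (m - 1))"
      using surjU w(2)[of "m - 1"] mc(1) by auto
    then have "\<phi> (u - w (m - 1)) = 0" using w(1) U(2) by (subst phi_diff) auto
    then have "u = w (m - 1)" using phi(4)[of "u - w (m - 1)"] u w(1) U(2) subspace_diff[OF S(1)] by auto
    then have "w (m - 1) \<in> U" using u by simp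
    moreover have "(\<Sum>i<m. of_bool (i = m - 1) *s w i) = (\<Sum>i<m. if i = m - 1 then w i else 0)"
      by (intro sum.cong) auto
    moreover have "\<dots> = w (m - 1)" using mc(1) by simp
    ultimately have "(\<Sum>i<m. of_bool (i = m - 1) *s w i) \<in> U" by simp
    from indep_modD[OF mc(3) this, of "m - 1"] show False using mc(1) by simp
  qed
  then obtain k where k: "c k \<noteq> 0" "k < m" by blast
  obtain t where t: "t (m - 1) \<noteq> 0" "t 0 = c 0 * t (m - 1) ^ Q"
    "\<And>i. Suc i < m \<Longrightarrow> t (Suc i) = t i ^ Q + c (Suc i) * t (m - 1) ^ Q"
    using additive_poly_root[where c=c and Q=Q and m=m and k=k] Q mc(1) k by blast
  define x where "x = (\<Sum>i<m. t i *s w i)"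
  have xS: "x \<in> S" unfolding x_def using w by (intro subspace_sum[OF S(1)] subspace_scale[OF S(1)])
  have xU: "x \<notin> U"
    using indep_modD[OF mc(3), of t "m - 1"] t(1) mc(1) by (auto simp: x_def)
  have "\<phi> x - x \<in> U"
  proof -
    obtain m' where m': "m = Suc m'" using mc(1) by (cases m) auto
    have "\<phi> x = (\<Sum>i<m. t i ^ Q *s w (Suc i))"
      unfolding x_def using w by (subst phi_sum) (auto simp: subspace_scale[OF S(1)] phi(3))
    also have "\<dots> = (\<Sum>i<m'. t i ^ Q *s w (Suc i)) + t m' ^ Q *s w m" by (simp add: m')
    finally have 1: "\<phi> x = (\<Sum>i<m'. t i ^ Q *s w (Suc i)) + t m' ^ Q *s w m" .
    have "x = t 0 *s w 0 + (\<Sum>i<m'. t (Suc i) *s w (Suc i))"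
      unfolding x_def m' by (rule sum.lessThan_Suc_shift)
    also have "(\<Sum>i<m'. t (Suc i) *s w (Suc i))
        = (\<Sum>i<m'. t i ^ Q *s w (Suc i)) + t m' ^ Q *s (\<Sum>i<m'. c (Suc i) *s w (Suc i))"
      using t(3) by (simp add: m' scale_left_distrib sum.distrib scale_sum_right mult.commute)
    finally have 2: "x = (\<Sum>i<m'. t i ^ Q *s w (Suc i))
        + t m' ^ Q *s (c 0 *s w 0 + (\<Sum>i<m'. c (Suc i) *s w (Suc i)))"
      using t(2) by (simp add: m' scale_right_distrib mult.commute)
    have 3: "c 0 *s w 0 + (\<Sum>i<m'. c (Suc i) *s w (Suc i)) = (\<Sum>i<m. c i *s w i)"
      unfolding m' by (rule sum.lessThan_Suc_shift[symmetric])
    have "\<phi> x - x = t m' ^ Q *s (w m - (\<Sum>i<m. c i *s w i))"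
      unfolding 1 by (subst 2) (simp add: 3 scale_right_diff_distrib)
    then show ?thesis using subspace_scale[OF U(1) mc(2)] by simp
  qed
  then obtain u where u: "u \<in> U" "u - \<phi> u = \<phi> x - x" using langU by blast
  have "\<phi> (x + u) = x + u"
    using u xS U(2) phi(2)[of x u] by (auto simp: algebra_simps)
  moreover have "x + u \<in> S" using xS u U(2) subspace_add[OF S(1)] by blast
  ultimately have "x + u \<in> U" unfolding U_def F_def by (intro span_base) simp
  then have "x \<in> U" using subspace_diff[OF U(1) _ u(1)] by fastforce
  then show False using xU by blast
qed

end

section \<open>Pairings that are Frobenius-semilinear on the left\<close>

locale frobenius_pairing = alg_closed_linear_space scale
  for scale :: "'a::alg_closed_field \<Rightarrow> 'b::ab_group_add \<Rightarrow> 'b" (infixr "*s" 75) +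
  fixes B :: "'b \<Rightarrow> 'b \<Rightarrow> 'a" and q :: nat
  assumes B_add_left: "B (x + y) z = B x z + B y z"
    and B_add_right: "B x (y + z) = B x y + B x z"
    and B_scale_left: "B (a *s x) y = a ^ q * B x y"
    and B_scale_right: "B x (a *s y) = a * B x y"
    and frob_add: "(a + b :: 'a) ^ q = a ^ q + b ^ q"
    and q_gt_1: "q > 1"
begin

lemma q_pos: "q > 0" using q_gt_1 by simp

lemma frob_sum: "(\<Sum>i\<in>I. f i :: 'a) ^ q = (\<Sum>i\<in>I. f i ^ q)"
  by (induction I rule: infinite_finite_induct) (use q_pos in \<open>auto simp: frob_add\<close>)

lemma frob_minus: "(- a :: 'a) ^ q = - (a ^ q)"
proof -
  have "(- a) ^ q + a ^ q = (- a + a) ^ q" by (rule frob_add[symmetric])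
  then show ?thesis using q_pos by (simp add: eq_neg_iff_add_eq_0)
qed

lemma frob_diff: "(a - b :: 'a) ^ q = a ^ q - b ^ q"
  using frob_add[of a "- b"] by (simp add: frob_minus)

lemma frob_inj: "(a :: 'a) ^ q = b ^ q \<Longrightarrow> a = b"
  using frob_diff[of a b] q_pos by simp

text \<open>
  Passing to \<open>q\<close>-th roots turns the semilinear functions \<open>x \<mapsto> B x y\<close> into linear ones.
\<close>

definition froot :: "'a \<Rightarrow> 'a" where
  "froot a = (SOME b. b ^ q = a)"

lemma froot_power [simp]: "froot a ^ q = a"
  unfolding froot_def using nth_root_exists[OF q_pos, of a] by (rule someI_ex)

lemma froot_of_power [simp]: "froot (a ^ q) = a"
  by (rule frob_inj) simp

lemma froot_add: "froot (a + b) = froot a + froot b"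
  by (rule frob_inj) (simp add: frob_add)

lemma froot_mult: "froot (a * b) = froot a * froot b"
  by (rule frob_inj) (simp add: power_mult_distrib)

lemma froot_0 [simp]: "froot 0 = 0" and froot_1 [simp]: "froot 1 = 1"
  using froot_of_power[of 0] froot_of_power[of 1] zero_power[OF q_pos, where 'a='a] by simp_all

lemma froot_of_bool [simp]: "froot (of_bool P) = of_bool P"
  by (cases P) auto

lemma B_0_left [simp]: "B 0 y = 0" and B_0_right [simp]: "B x 0 = 0"
  using B_scale_left[of 0 0 y] B_scale_right[of x 0 0] zero_power[OF q_pos, where 'a='a] by simp_all

lemma B_minus_left: "B (- x) y = - B x y"
  using minus_unique[of "B x y" "B (- x) y"] B_add_left[of x "- x" y] by simp

lemma B_minus_right: "B x (- y) = - B x y"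
  using minus_unique[of "B x y" "B x (- y)"] B_add_right[of x y "- y"] by simp

lemma B_diff_left: "B (x - y) z = B x z - B y z"
  using B_add_left[of x "- y" z] by (simp add: B_minus_left)

lemma B_diff_right: "B x (y - z) = B x y - B x z"
  using B_add_right[of x y "- z"] by (simp add: B_minus_right)

lemma B_sum_left: "B (\<Sum>i\<in>I. f i) y = (\<Sum>i\<in>I. B (f i) y)"
  by (induction I rule: infinite_finite_induct) (auto simp: B_add_left)

lemma B_sum_right: "B x (\<Sum>i\<in>I. f i) = (\<Sum>i\<in>I. B x (f i))"
  by (induction I rule: infinite_finite_induct) (auto simp: B_add_right)

lemmas B_simps = B_add_left B_add_right B_scale_left B_scale_right B_diff_left B_diff_right
  B_minus_left B_minus_right B_sum_left B_sum_right

text \<open>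
  The radical is taken within a subspace, because \<open>S\<close> varies in the inductions below while \<open>B\<close> is fixed.
\<close>

definition right_rad :: "'b set \<Rightarrow> 'b set" where
  "right_rad S = {y \<in> S. \<forall>x\<in>S. B x y = 0}"

text \<open>
  The vectors of \<open>U\<close> stand on the left of the pairing. As \<open>B\<close> is not symmetric, \<open>perp S (perp S U)\<close> need not contain \<open>U\<close>.
\<close>

definition perp :: "'b set \<Rightarrow> 'b set \<Rightarrow> 'b set" where
  "perp S U = {y \<in> S. \<forall>x\<in>U. B x y = 0}"

lemma right_rad_eq: "right_rad S = perp S S"
  by (simp add: right_rad_def perp_def)

lemma subspace_perp: "subspace S \<Longrightarrow> subspace (perp S U)"
  unfolding perp_def
  by (intro subspaceI) (auto simp: B_simps subspace_0 subspace_add subspace_scale)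

lemma subspace_left_kernel: "subspace S \<Longrightarrow> subspace {x\<in>S. \<forall>y\<in>U. B x y = 0}"
  using q_pos by (intro subspaceI) (auto simp: B_simps subspace_0 subspace_add subspace_scale)

lemma left_dual:
  assumes J: "finite J" and T: "subspace T"
    and ind: "\<And>\<alpha>. (\<forall>x\<in>T. B x (\<Sum>j\<in>J. \<alpha> j *s b j) = 0) \<Longrightarrow> \<forall>j\<in>J. \<alpha> j = 0"
  obtains x where "\<And>i. i \<in> J \<Longrightarrow> x i \<in> T"
    and "\<And>i j. i \<in> J \<Longrightarrow> j \<in> J \<Longrightarrow> B (x i) (b j) = of_bool (i = j)"
proof -
  have "\<exists>x. \<forall>i\<in>J. x i \<in> T \<and> (\<forall>j\<in>J. froot (B (x i) (b j)) = of_bool (i = j))"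
  proof (rule dual_family[OF J T])
    fix \<alpha> assume *: "\<forall>x\<in>T. (\<Sum>j\<in>J. \<alpha> j * froot (B x (b j))) = 0"
    have "B x (\<Sum>j\<in>J. \<alpha> j ^ q *s b j) = 0" if "x \<in> T" for x
    proof -
      have "B x (\<Sum>j\<in>J. \<alpha> j ^ q *s b j) = (\<Sum>j\<in>J. \<alpha> j * froot (B x (b j))) ^ q"
        by (simp add: B_simps frob_sum power_mult_distrib)
      then show ?thesis using * that q_pos by simp
    qed
    then have "\<forall>j\<in>J. \<alpha> j ^ q = 0" using ind[of "\<lambda>j. \<alpha> j ^ q"] by simp
    then show "\<forall>j\<in>J. \<alpha> j = 0" by simp
  qed (simp_all add: B_add_left B_scale_left froot_add froot_mult)
  then obtain x where x: "\<forall>i\<in>J. x i \<in> T \<and> (\<forall>j\<in>J. froot (B (x i) (b j)) = of_bool (i = j))"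
    by blast
  have "B (x i) (b j) = of_bool (i = j)" if "i \<in> J" "j \<in> J" for i j
  proof -
    have "froot (B (x i) (b j)) = froot (of_bool (i = j))" using x that by simp
    then show ?thesis using froot_power by metis
  qed
  then show ?thesis using x that by blast
qed

text \<open>
  The dual family of a basis is independent, hence a basis as well by counting. This is how the absence of a right radical
  rules out a left radical and lets \<open>B\<close> represent all semilinear functionals.
\<close>

lemma dual_basis:
  assumes S: "subspace S" "fin_dim S" and nd: "right_rad S = {0}"
  obtains J x where "fam_basis J id S" "fam_basis J x S"
    "\<And>i j. i \<in> J \<Longrightarrow> j \<in> J \<Longrightarrow> B (x i) j = of_bool (i = j)"
proof -
  obtain J where J: "J \<subseteq> S" "fam_basis J id S" using fam_basis_exists[OF S] by blast
  note fin = rel_basisD(1)[OF J(2)]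
  have "\<forall>j\<in>J. \<alpha> j = 0" if "\<forall>x\<in>S. B x (\<Sum>j\<in>J. \<alpha> j *s id j) = 0" for \<alpha>
  proof -
    have "(\<Sum>j\<in>J. \<alpha> j *s id j) \<in> S"
      using J(1) by (intro subspace_sum subspace_scale S(1)) auto
    then have "(\<Sum>j\<in>J. \<alpha> j *s id j) \<in> {0}"
      using that nd unfolding right_rad_def by blast
    then show ?thesis using indep_modD[OF rel_basisD(3)[OF J(2)]] by blast
  qed
  then obtain x where x: "\<And>i. i \<in> J \<Longrightarrow> x i \<in> S"
    "\<And>i j. i \<in> J \<Longrightarrow> j \<in> J \<Longrightarrow> B (x i) j = of_bool (i = j)"
    using left_dual[OF fin S(1), of id] by auto
  have "indep_mod {0} J x"
    unfolding indep_mod_def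
  proof (intro allI impI ballI)
    fix \<alpha> j assume *: "(\<Sum>i\<in>J. \<alpha> i *s x i) \<in> {0}" and j: "j \<in> J"
    have "B (\<Sum>i\<in>J. \<alpha> i *s x i) j = (\<Sum>i\<in>J. if i = j then \<alpha> i ^ q else 0)"
      unfolding B_sum_left B_scale_left using x(2) j by (intro sum.cong) auto
    then have "B (\<Sum>i\<in>J. \<alpha> i *s x i) j = \<alpha> j ^ q" using j fin by simp
    then show "\<alpha> j = 0" using * by simp
  qed
  then have "fam_basis J x S"
    using fam_basis_of_card[OF J(2) S(1) fin, of x] x(1) by blast
  then show ?thesis using that J(2) x(2) by blast
qed

lemma left_nondegenerate:
  assumes S: "subspace S" "fin_dim S" and nd: "right_rad S = {0}"
    and y: "y \<in> S" "\<forall>z\<in>S. B y z = 0"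
  shows "y = 0"
proof -
  obtain J x where J: "fam_basis J id S" and x: "fam_basis J x S"
    "\<And>i j. i \<in> J \<Longrightarrow> j \<in> J \<Longrightarrow> B (x i) j = of_bool (i = j)"
    using dual_basis[OF S nd] by blast
  obtain \<alpha> where \<alpha>: "y = (\<Sum>i\<in>J. \<alpha> i *s x i)" using fam_basis_expand[OF x(1) y(1)] by blast
  have "\<alpha> j = 0" if j: "j \<in> J" for j
  proof -
    have "B y j = (\<Sum>i\<in>J. if i = j then \<alpha> i ^ q else 0)"
      unfolding \<alpha> B_sum_left B_scale_left using x(2) j by (intro sum.cong) auto
    then show ?thesis using y(2) rel_basisD(2)[OF J j] j rel_basisD(1)[OF J] by simp
  qed
  then show ?thesis by (simp add: \<alpha>)
qed

lemma represent_functional: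
  assumes S: "subspace S" "fin_dim S" and nd: "right_rad S = {0}"
    and g: "\<And>x y. x \<in> S \<Longrightarrow> y \<in> S \<Longrightarrow> g (x + y) = g x + g y"
      "\<And>a x. x \<in> S \<Longrightarrow> g (a *s x) = a ^ q * g x"
  shows "\<exists>!z. z \<in> S \<and> (\<forall>y\<in>S. B y z = g y)"
proof -
  obtain J x where J: "fam_basis J id S" and xb: "fam_basis J x S"
    and xJ: "\<And>i j. i \<in> J \<Longrightarrow> j \<in> J \<Longrightarrow> B (x i) j = of_bool (i = j)"
    using dual_basis[OF S nd] by blast
  note fin = rel_basisD(1)[OF J]
  define z where "z = (\<Sum>j\<in>J. g (x j) *s j)"
  have zS: "z \<in> S"
    unfolding z_def using rel_basisD(2)[OF J] by (intro subspace_sum subspace_scale S(1)) auto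
  have xz: "B (x i) z = g (x i)" if "i \<in> J" for i
  proof -
    have "B (x i) z = (\<Sum>j\<in>J. if j = i then g (x j) else 0)"
      unfolding z_def B_sum_right B_scale_right using xJ that by (intro sum.cong) auto
    then show ?thesis using that fin by simp
  qed
  have g0: "g 0 = 0"
    using g(2)[OF subspace_0[OF S(1)], of 0] zero_power[OF q_pos, where 'a='a] by simp
  have gsum: "g (\<Sum>i\<in>A. \<alpha> i *s x i) = (\<Sum>i\<in>A. \<alpha> i ^ q * g (x i))" if "A \<subseteq> J" for A \<alpha>
    using finite_subset[OF that fin] that
  proof (induction A rule: finite_induct)
    case (insert a A)
    then have "(\<Sum>i\<in>A. \<alpha> i *s x i) \<in> S" "\<alpha> a *s x a \<in> S" "x a \<in> S"
      using rel_basisD(2)[OF xb] by (auto intro!: subspace_sum subspace_scale S(1))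
    then show ?case using insert by (simp add: g)
  qed (simp add: g0)
  have zg: "B y z = g y" if y: "y \<in> S" for y
  proof -
    obtain \<alpha> where "y = (\<Sum>i\<in>J. \<alpha> i *s x i)" using fam_basis_expand[OF xb y] by blast
    then show ?thesis by (simp add: gsum B_sum_left B_scale_left xz)
  qed
  show "\<exists>!z. z \<in> S \<and> (\<forall>y\<in>S. B y z = g y)"
  proof (rule ex1I[of _ z])
    fix z' assume z': "z' \<in> S \<and> (\<forall>y\<in>S. B y z' = g y)"
    then have "z' - z \<in> right_rad S"
      using zS zg subspace_diff[OF S(1)] by (auto simp: right_rad_def B_diff_right)
    then show "z' = z" using nd by simp
  qed (use zS zg in blast)
qed

section \<open>Orthonormal bases of nondegenerate pairings\<close>

text \<open>
  For a vector \<open>v\<close> fixed by the map \<open>\<phi>\<close> with \<open>B y (\<phi> x) = (B x y)\<^sup>q\<close> the two orthogonal complements of \<open>v\<close> agree,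
  since \<open>B y v = (B v y)\<^sup>q\<close>. The fixed vectors span \<open>S\<close>, so not all of them can be isotropic: two isotropic
  fixed vectors \<open>u\<close>, \<open>v\<close> with \<open>B u v \<noteq> 0\<close> would have a fixed combination \<open>u + a v\<close> that is not isotropic.
  A fixed vector with \<open>B v v \<noteq> 0\<close> is then rescaled by a root of order \<open>q + 1\<close>.
\<close>

lemma hermitian_vector:
  assumes S: "subspace S" "fin_dim S" and nd: "right_rad S = {0}" and nz: "S \<noteq> {0}"
  obtains v where "v \<in> S" "B v v = 1" "\<And>y. y \<in> S \<Longrightarrow> B y v = 0 \<longleftrightarrow> B v y = 0"
proof -
  have ex: "\<exists>!z. z \<in> S \<and> (\<forall>y\<in>S. B y z = B x y ^ q)" if "x \<in> S" for x
    by (rule represent_functional[OF S nd])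
      (simp_all add: B_add_right B_scale_right frob_add power_mult_distrib)
  define \<phi> where "\<phi> x = (THE z. z \<in> S \<and> (\<forall>y\<in>S. B y z = B x y ^ q))" for x
  have phi: "\<phi> x \<in> S" "\<And>y. y \<in> S \<Longrightarrow> B y (\<phi> x) = B x y ^ q" if "x \<in> S" for x
    using theI'[OF ex[OF that]] unfolding \<phi>_def by blast+
  have phi_eqI: "\<phi> x = z" if "x \<in> S" "z \<in> S" "\<And>y. y \<in> S \<Longrightarrow> B y z = B x y ^ q" for x z
    using ex[OF that(1)] phi[OF that(1)] that by blast
  define F where "F = {x \<in> S. \<phi> x = x}"
  have spanF: "span F = S"
    unfolding F_def
  proof (rule semilinear_fixed_span[OF S, where Q="q\<^sup>2"])
    show "q\<^sup>2 > 1" using one_less_power[OF q_gt_1 pos2] .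
    show "(a + b :: 'a) ^ q\<^sup>2 = a ^ q\<^sup>2 + b ^ q\<^sup>2" for a b
      by (simp add: power2_eq_square power_mult frob_add)
    show "\<phi> x \<in> S" if "x \<in> S" for x using phi that by blast
    show "\<phi> (x + y) = \<phi> x + \<phi> y" if "x \<in> S" "y \<in> S" for x y
      using that phi by (intro phi_eqI) (auto simp: B_simps frob_add subspace_add[OF S(1)])
    show "\<phi> (a *s x) = a ^ q\<^sup>2 *s \<phi> x" if "x \<in> S" for a x
      using that phi
      by (intro phi_eqI)
        (auto simp: B_simps subspace_scale[OF S(1)] power_mult_distrib power2_eq_square power_mult)
    show "x = 0" if "x \<in> S" "\<phi> x = 0" for x
    proof (rule left_nondegenerate[OF S nd that(1)])
      show "\<forall>y\<in>S. B x y = 0" using phi(2)[OF that(1)] that(2) q_pos by auto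
    qed
  qed
  have F: "v \<in> S" "\<And>y. y \<in> S \<Longrightarrow> B y v = B v y ^ q" if "v \<in> F" for v
    using that phi unfolding F_def by force+
  have "\<exists>v\<in>F. B v v \<noteq> 0"
  proof (rule ccontr)
    assume iso: "\<not> (\<exists>v\<in>F. B v v \<noteq> 0)"
    have iso2: "B u v = 0" if uv: "u \<in> F" "v \<in> F" for u v
    proof (rule ccontr)
      assume nz: "B u v \<noteq> 0"
      \<comment> \<open>A root \<open>s\<close> of \<open>X\<^sup>q + X - 1\<close> satisfies \<open>s + s\<^sup>q = 1\<close> and therefore \<open>s ^ (q ^ 2) = s\<close>, so with \<open>a = s / B u v\<close>
        the vector \<open>u + a v\<close> is again fixed and pairs with itself to \<open>s + s\<^sup>q\<close>.\<close>
      define p :: "'a poly" where "p = monom 1 q + [:-1, 1:]"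
      have "coeff p q \<noteq> 0" using q_gt_1 by (cases q) (auto simp: p_def coeff_pCons split: nat.splits)
      then have "degree p \<ge> q" by (rule le_degree)
      then have "degree p > 0" using q_pos by linarith
      then obtain s where s: "poly p s = 0" using alg_closed_imp_poly_has_root by blast
      then have s1: "s ^ q = 1 - s" by (simp add: p_def poly_monom algebra_simps)
      then have s2: "(s ^ q) ^ q = s" using frob_diff[of 1 s] by simp
      define a where "a = s / B u v"
      have b2: "(B u v ^ q) ^ q = B u v" using F(2)[OF uv(2) F(1)[OF uv(1)]] F(2)[OF uv(1) F(1)[OF uv(2)]] by simp
      have a2: "(a ^ q) ^ q = a" by (simp add: a_def power_divide b2 s2)
      have "\<phi> (u + a *s v) = u + a *s v"
      proof (rule phi_eqI)
        show S': "u + a *s v \<in> S" using F(1) uv by (intro subspace_add subspace_scale S(1))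
        then show "u + a *s v \<in> S" .
        fix y assume y: "y \<in> S"
        have "(a ^ q * B v y) ^ q = a * B v y ^ q" using a2 by (simp add: power_mult_distrib)
        then show "B y (u + a *s v) = B (u + a *s v) y ^ q"
          using F(2)[OF uv(1) y] F(2)[OF uv(2) y] by (simp add: B_simps frob_add)
      qed
      then have "u + a *s v \<in> F"
        using F(1) uv by (auto simp: F_def intro!: subspace_add subspace_scale S(1))
      then have "B (u + a *s v) (u + a *s v) = 0" using iso by blast
      moreover have "B u u = 0" "B v v = 0" using iso uv by auto
      ultimately have "a * B u v + a ^ q * B v u = 0" by (simp add: B_simps add.commute)
      moreover have "B v u = B u v ^ q" using F(2)[OF uv(1) F(1)[OF uv(2)]] by simp
      ultimately have "s + s ^ q = 0" using nz by (simp add: a_def power_divide)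
      then show False using s1 by simp
    qed
    have z: "B x v = 0" if x: "x \<in> span F" and v: "v \<in> F" for x v
      using x
    proof (induction rule: span_induct_alt)
      case (step c u w)
      then show ?case using v iso2 by (simp add: B_simps)
    qed simp
    have "v \<in> right_rad S" if "v \<in> F" for v
      using z[OF _ that] that F(1) by (simp add: right_rad_def spanF)
    then have "F \<subseteq> {0}" using nd by (simp add: subset_iff)
    then have "span F \<subseteq> {0}" using span_minimal[OF _ subspace_single_0] by blast
    then have "S \<subseteq> {0}" by (simp add: spanF)
    then show False using nz subspace_0[OF S(1)] by (metis empty_iff subset_singletonD)
  qed
  then obtain v where v: "v \<in> F" "B v v \<noteq> 0" by blast
  have "0 < q + 1" by simp
  from nth_root_exists[OF this, of "1 / B v v"] obtain t where t: "t ^ (q + 1) = 1 / B v v" ..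
  then have t0: "t \<noteq> 0" using v(2) by auto
  show ?thesis
  proof (rule that[of "t *s v"])
    show "t *s v \<in> S" using F(1) v by (intro subspace_scale S(1))
    have "B (t *s v) (t *s v) = t ^ (q + 1) * B v v" by (simp add: B_simps mult_ac)
    then show "B (t *s v) (t *s v) = 1" using t v by simp
    show "B y (t *s v) = 0 \<longleftrightarrow> B (t *s v) y = 0" if "y \<in> S" for y
      using F(2)[OF v(1) that] t0 q_pos by (simp add: B_simps)
  qed
qed

text \<open>
  The orthogonal complement of the vector just found is the same on both sides, so \<open>S\<close> is an orthogonal sum and the induction
  applies to the complement.
\<close>

lemma orthonormal_basis:
  assumes "subspace S" "fin_dim S" "right_rad S = {0}"
  shows "\<exists>m b. fam_basis {..<m::nat} b S \<and> (\<forall>i<m. \<forall>j<m. B (b i) (b j) = of_bool (i = j))"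
  using assms
proof (induction "dim S" arbitrary: S rule: less_induct)
  case less
  note S = less.prems
  show ?case
  proof (cases "S = {0}")
    case True
    then show ?thesis
      by (intro exI[of _ 0] exI[of _ "\<lambda>_. 0"]) (simp add: rel_basis_def indep_mod_def)
  next
    case False
    then obtain v where v: "v \<in> S" "B v v = 1" "\<And>y. y \<in> S \<Longrightarrow> B y v = 0 \<longleftrightarrow> B v y = 0"
      using hermitian_vector[OF S] by metis
    define T where "T = perp S {v}"
    have T: "subspace T" "T \<subseteq> S" unfolding T_def using subspace_perp[OF S(1), of "{v}"] by (auto simp: perp_def[of S "{v}"])
    have finT: "fin_dim T" using fin_dim_subset S(2) T(2) by blast
    have proj: "x - B v x *s v \<in> T" if "x \<in> S" for x
      using that v by (auto simp: T_def perp_def B_simps intro!: subspace_diff subspace_scale S(1))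
    have relT: "rel_basis T {()} (\<lambda>_. v) S"
      unfolding rel_basis_def
    proof (intro conjI ballI)
      show "indep_mod T {()} (\<lambda>_. v)"
        using v by (auto simp: indep_mod_def T_def perp_def B_simps)
      fix x assume "x \<in> S"
      then show "\<exists>\<alpha>. x - (\<Sum>j\<in>{()}. \<alpha> j *s v) \<in> T"
        using proj by (intro exI[of _ "\<lambda>_. B v x"]) simp
    qed (use v in auto)
    have rad: "right_rad T = {0}"
    proof -
      have "y = 0" if y: "y \<in> right_rad T" for y
      proof -
        have yS: "y \<in> S" and yv: "B v y = 0" and yT: "\<And>x. x \<in> T \<Longrightarrow> B x y = 0"
          using y T by (auto simp: right_rad_def T_def perp_def)
        have "B x y = 0" if "x \<in> S" for x
          using yT[OF proj[OF that]] yv by (simp add: B_simps)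
        then have "y \<in> right_rad S" using yS by (simp add: right_rad_def)
        then show ?thesis using S(3) by simp
      qed
      then show ?thesis using subspace_0[OF T(1)] by (auto simp: right_rad_def)
    qed
    obtain J where J: "fam_basis J id T" using fam_basis_exists[OF T(1) finT] by blast
    have "fam_basis ({()} <+> J) (case_sum (\<lambda>_. v) id) S"
      using rel_basis_trans[OF relT J T subspace_single_0] subspace_0[OF T(1)] by simp
    then have "dim S = card ({()} <+> J)" using fam_basis_card S(1) by metis
    then have "dim T < dim S"
      using fam_basis_card[OF J T(1)] rel_basisD(1)[OF J] by (simp add: card_Plus)
    then obtain m b where b: "fam_basis {..<m::nat} b T"
      "\<And>i j. i < m \<Longrightarrow> j < m \<Longrightarrow> B (b i) (b j) = of_bool (i = j)"
      using less.hyps[OF _ T(1) finT rad] by blast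
    have bT: "b i \<in> T" if "i < m" for i using rel_basisD(2)[OF b(1)] that by simp
    have base: "fam_basis ({()} <+> {..<m}) (case_sum (\<lambda>_. v) b) S"
      using rel_basis_trans[OF relT b(1) T subspace_single_0] subspace_0[OF T(1)] by simp
    define h where "h i = (if i = m then Inl () else Inr i)" for i
    have "bij_betw h {..<Suc m} ({()} <+> {..<m})"
      by (rule bij_betwI[where g="case_sum (\<lambda>_. m) id"]) (auto simp: h_def)
    from rel_basis_reindex[OF base this]
    have "fam_basis {..<Suc m} (case_sum (\<lambda>_. v) b \<circ> h) S" .
    moreover have "B ((case_sum (\<lambda>_. v) b \<circ> h) i) ((case_sum (\<lambda>_. v) b \<circ> h) j) = of_bool (i = j)"
      if "i < Suc m" "j < Suc m" for i j
    proof -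
      have "B v (b i) = 0" "B (b i) v = 0" if "i < m" for i
        using bT[OF that] v(3) by (auto simp: T_def perp_def)
      then show ?thesis using that v(2) b(2) by (auto simp: h_def)
    qed
    ultimately show ?thesis by blast
  qed
qed

end

section \<open>Existence of a basis made of chains and loops\<close>

text \<open>
  \<open>Inl (i, a)\<close> is position \<open>a\<close> of chain \<open>i\<close>, and \<open>Inr j\<close> is a loop. With these labels one relation, which does not depend on
  the number and the lengths of the chains, describes the Gram matrix of every normal form.
\<close>

type_synonym vertex = "(nat \<times> nat) + nat"

definition linked :: "vertex \<Rightarrow> vertex \<Rightarrow> bool" where
  "linked s t \<longleftrightarrow> (case s of Inl (i, a) \<Rightarrow> t = Inl (i, Suc a) | Inr j \<Rightarrow> t = Inr j)"

definition chain_graph :: "nat \<Rightarrow> (nat \<Rightarrow> nat) \<Rightarrow> nat \<Rightarrow> vertex set" where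
  "chain_graph N len m = (SIGMA i:{..<N}. {..<len i}) <+> {..<m}"

lemma chain_graph_simps [simp]:
  "Inl (i, a) \<in> chain_graph N len m \<longleftrightarrow> i < N \<and> a < len i"
  "Inr j \<in> chain_graph N len m \<longleftrightarrow> j < m"
  by (auto simp: chain_graph_def)

lemma chain_graph_cases:
  assumes "s \<in> chain_graph N len m"
  obtains i where "s = Inl (i, 0)" "i < N" "0 < len i"
  | i a where "s = Inl (i, Suc a)" "i < N" "Suc a < len i"
  | j where "s = Inr j" "j < m"
proof (cases s)
  case (Inl ia)
  then obtain i a where "s = Inl (i, a)" by (cases ia) auto
  then show ?thesis using assms that by (cases a) auto
qed (use assms that in auto)

lemma finite_chain_graph [simp]: "finite (chain_graph N len m)"
  by (simp add: chain_graph_def)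

lemma card_chain_graph: "card (chain_graph N len m) = (\<Sum>i<N. len i) + m"
  by (simp add: chain_graph_def card_Plus)

lemma bij_betw_append:
  assumes u: "bij_betw u {..<n} A" and v: "bij_betw v {..<k} C" and disj: "A \<inter> C = {}"
  shows "bij_betw (\<lambda>i. if i < n then u i else v (i - n)) {..<n + k :: nat} (A \<union> C)" (is "bij_betw ?f _ _")
proof -
  have "bij_betw ?f {..<n} A"
    using u by (subst bij_betw_cong[where g=u]) auto
  moreover have "bij_betw ?f {n..<n + k} C"
  proof -
    have "bij_betw (\<lambda>i. i - n) {n..<n + k} {..<k}"
      by (rule bij_betwI[where g="\<lambda>i. i + n"]) auto
    from bij_betw_trans[OF this v] show ?thesis
      by (subst bij_betw_cong[where g="v \<circ> (\<lambda>i. i - n)"]) auto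
  qed
  ultimately have "bij_betw ?f ({..<n} \<union> {n..<n + k}) (A \<union> C)"
    using disj by (rule bij_betw_combine)
  moreover have "{..<n} \<union> {n..<n + k} = {..<n + k}" by auto
  ultimately show ?thesis by metis
qed

context frobenius_pairing
begin

text \<open>
  Chains are nonempty, so that their number is determined; they run from the right radical, which contains their first
  members, to the left radical, which contains the last ones.
\<close>

definition normal_basis :: "nat \<Rightarrow> (nat \<Rightarrow> nat) \<Rightarrow> nat \<Rightarrow> (vertex \<Rightarrow> 'b) \<Rightarrow> 'b set \<Rightarrow> bool" where
  "normal_basis N len m b S \<longleftrightarrow> (\<forall>i<N. len i > 0) \<and> fam_basis (chain_graph N len m) b S \<and>
     (\<forall>s\<in>chain_graph N len m. \<forall>t\<in>chain_graph N len m. B (b s) (b t) = of_bool (linked s t))"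

text \<open>
  Let \<open>R\<close> be the right radical of \<open>S\<close> and \<open>D\<close> its right orthogonal space, so \<open>R \<subseteq> D \<subseteq> S\<close>, and \<open>M\<close> spans a complement of
  \<open>R\<close> in \<open>D\<close>. The left kernel of the pairing of \<open>R\<close> with \<open>S / D\<close> is the intersection \<open>L\<close> of both radicals, and the
  pairing of \<open>R / L\<close> with \<open>S / D\<close> is perfect. Choose vectors \<open>c\<^sub>i\<close> that form a basis of \<open>S / D\<close>, and
  \<open>r\<^sub>i \<in> R\<close> dual to them. The \<open>c\<^sub>i\<close> pair to zero with all basis vectors of the complement, except that the first
  ones hit the heads of its chains, one each. After everything but the \<open>r\<^sub>i\<close> has been made orthogonal to the
  \<open>c\<^sub>i\<close> on the left by subtracting multiples of the \<open>r\<^sub>i\<close>, the \<open>i\<close>-th chain is prolonged to \<open>r\<^sub>i\<close>, \<open>c\<^sub>i\<close>, head,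
  and so on; the remaining \<open>c\<^sub>i\<close> give chains \<open>r\<^sub>i\<close>, \<open>c\<^sub>i\<close>, and a basis of \<open>L\<close> gives chains of length one.
\<close>

lemma normal_basis_lift:
  assumes S: "subspace S" "fin_dim S"
    and M: "rel_basis (right_rad S) M id (perp S (right_rad S))"
    and W: "normal_basis N len m w (span M)"
  shows "\<exists>N' len' b. normal_basis N' len' m b S"
proof -
  define R where "R = right_rad S"
  define D where "D = perp S R"
  define I where "I = chain_graph N len m"
  have R: "subspace R" "R \<subseteq> S"
    using subspace_perp[OF S(1), of S] by (simp_all add: R_def right_rad_eq) (simp add: perp_def)
  have D: "subspace D" "D \<subseteq> S"
    using subspace_perp[OF S(1), of R] by (simp_all add: D_def) (simp add: perp_def)
  have SR: "B x y = 0" if "x \<in> S" "y \<in> R" for x y using that by (auto simp: R_def right_rad_def)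
  have RD: "B x y = 0" if "x \<in> R" "y \<in> D" for x y using that by (auto simp: D_def perp_def)
  have RsubD: "R \<subseteq> D" using R SR by (auto simp: D_def perp_def)
  have MR: "rel_basis R M id D" using M by (simp add: R_def D_def)
  have finI: "finite I" by (simp add: I_def)
  have len: "len i > 0" if "i < N" for i using W that by (simp add: normal_basis_def)
  have wW: "fam_basis I w (span M)" using W by (simp add: normal_basis_def I_def)
  have ww: "B (w s) (w t) = of_bool (linked s t)" if "s \<in> I" "t \<in> I" for s t
    using W that by (simp add: normal_basis_def I_def)
  have MD: "span M \<subseteq> D" using rel_basisD(2)[OF MR] by (intro span_minimal[OF _ D(1)]) auto
  have wD: "w s \<in> D" if "s \<in> I" for s using rel_basisD(2)[OF wW that] MD by blast
  have wR: "rel_basis R I w D"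
    unfolding rel_basis_def
  proof (intro conjI ballI)
    show "indep_mod R I w"
      unfolding indep_mod_def
    proof (intro allI impI)
      fix \<alpha> assume *: "(\<Sum>s\<in>I. \<alpha> s *s w s) \<in> R"
      have "(\<Sum>s\<in>I. \<alpha> s *s w s) \<in> span M"
        using rel_basisD(2)[OF wW] by (intro span_sum span_scale) auto
      then obtain \<beta> where \<beta>: "(\<Sum>s\<in>I. \<alpha> s *s w s) = (\<Sum>v\<in>M. \<beta> v *s v)"
        using rel_basisD(1)[OF MR] by (auto simp: span_finite)
      then have "\<beta> v = 0" if "v \<in> M" for v
        using indep_modD[OF rel_basisD(3)[OF MR], of \<beta>] * that by simp
      then have "(\<Sum>s\<in>I. \<alpha> s *s w s) \<in> {0}" by (simp add: \<beta>)
      then show "\<forall>s\<in>I. \<alpha> s = 0" using indep_modD[OF rel_basisD(3)[OF wW]] by blast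
    qed
    fix x assume "x \<in> D"
    then obtain \<beta> where \<beta>: "x - (\<Sum>v\<in>M. \<beta> v *s id v) \<in> R" using rel_basis_expand[OF MR] by blast
    have "(\<Sum>v\<in>M. \<beta> v *s id v) \<in> span M" by (intro span_sum span_scale span_base) simp
    then obtain \<alpha> where "(\<Sum>v\<in>M. \<beta> v *s id v) = (\<Sum>s\<in>I. \<alpha> s *s w s)"
      using fam_basis_expand[OF wW] by blast
    then show "\<exists>\<alpha>. x - (\<Sum>s\<in>I. \<alpha> s *s w s) \<in> R" using \<beta> by metis
  qed (use finI wD in auto)

  have "\<forall>s\<in>I. \<alpha> s = 0" if "\<forall>x\<in>S. B x (\<Sum>s\<in>I. \<alpha> s *s w s) = 0" for \<alpha>
  proof -
    have "(\<Sum>s\<in>I. \<alpha> s *s w s) \<in> S"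
      using wD D(2) by (intro subspace_sum subspace_scale S(1)) auto
    then have "(\<Sum>s\<in>I. \<alpha> s *s w s) \<in> R" using that by (simp add: R_def right_rad_def)
    then show ?thesis using indep_modD[OF rel_basisD(3)[OF wR]] by blast
  qed
  then obtain x where x: "\<And>s. s \<in> I \<Longrightarrow> x s \<in> S"
    "\<And>s t. s \<in> I \<Longrightarrow> t \<in> I \<Longrightarrow> B (x s) (w t) = of_bool (s = t)"
    using left_dual[OF finI S(1), of w] by blast
  define c0 where "c0 i = x (Inl (i, 0))" for i :: nat
  have head: "Inl (i, 0) \<in> I" if "i < N" for i using that len by (simp add: I_def)
  have c0S: "c0 i \<in> S" if "i < N" for i using x(1)[OF head[OF that]] by (simp add: c0_def)
  have c0w: "B (c0 i) (w t) = of_bool (t = Inl (i, 0))" if "i < N" "t \<in> I" for i t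
    using x(2)[OF head that(2)] that(1) by (auto simp: c0_def)
  \<comment> \<open>Nothing in \<open>D\<close> points to a head of a chain, which is why the \<open>c0 i\<close> are independent modulo \<open>D\<close>.\<close>
  have Dhead: "B d (w (Inl (j, 0))) = 0" if d: "d \<in> D" and j: "j < N" for d j
  proof -
    obtain \<alpha> where \<alpha>: "d - (\<Sum>s\<in>I. \<alpha> s *s w s) \<in> R"
      using rel_basis_expand[OF wR d] by blast
    have "B (w s) (w (Inl (j, 0))) = 0" if "s \<in> I" for s
      using ww[OF that head[OF j]] by (auto simp: linked_def split: sum.splits)
    then have "B (\<Sum>s\<in>I. \<alpha> s *s w s) (w (Inl (j, 0))) = 0" by (simp add: B_simps)
    moreover have "B (d - (\<Sum>s\<in>I. \<alpha> s *s w s)) (w (Inl (j, 0))) = 0"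
      using RD[OF \<alpha> wD[OF head[OF j]]] .
    ultimately show ?thesis by (simp add: B_diff_left)
  qed
  have c0ind: "indep_mod D {..<N} c0"
    unfolding indep_mod_def
  proof (intro allI impI ballI)
    fix \<alpha> j assume *: "(\<Sum>i<N. \<alpha> i *s c0 i) \<in> D" and j: "j \<in> {..<N}"
    have "B (\<Sum>i<N. \<alpha> i *s c0 i) (w (Inl (j, 0))) = (\<Sum>i<N. if i = j then \<alpha> i ^ q else 0)"
      unfolding B_sum_left B_scale_left using c0w head j by (intro sum.cong) auto
    also have "\<dots> = \<alpha> j ^ q" using j by simp
    finally show "\<alpha> j = 0" using Dhead[OF *, of j] j by simp
  qed
  \<comment> \<open>The remaining \<open>c\<^sub>i\<close> are to be taken from \<open>K\<close>. This is possible because \<open>K\<close>, \<open>D\<close> and the \<open>c0 i\<close> span \<open>S\<close>: the family \<open>p\<close>, which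
    assigns to a vertex its predecessor and to the head of chain \<open>i\<close> the vector \<open>c0 i\<close>, is dual to \<open>w\<close>.\<close>
  define K where "K = {x\<in>S. \<forall>t\<in>I. B x (w t) = 0}"
  define p where "p t = (case t of Inl (i, a) \<Rightarrow> (if a = 0 then c0 i else w (Inl (i, a - 1))) | Inr j \<Rightarrow> w (Inr j))"
    for t :: vertex
  have pw: "B (p s) (w t) = of_bool (s = t)" "p s \<in> D \<union> c0 ` {..<N}" if s: "s \<in> I" and t: "t \<in> I" for s t
  proof -
    show "B (p s) (w t) = of_bool (s = t)"
      using s unfolding I_def
    proof (cases s rule: chain_graph_cases)
      case (1 i)
      then show ?thesis using c0w[OF 1(2) t] by (auto simp: p_def)
    next
      case (2 i a)
      then have "Inl (i, a) \<in> I" by (simp add: I_def)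
      then show ?thesis using ww[OF _ t] 2 by (auto simp: p_def linked_def)
    next
      case (3 j)
      then show ?thesis using ww[OF s t] by (auto simp: p_def linked_def)
    qed
    show "p s \<in> D \<union> c0 ` {..<N}"
      using s unfolding I_def
    proof (cases s rule: chain_graph_cases)
      case (2 i a)
      then have "Inl (i, a) \<in> I" by (simp add: I_def)
      then show ?thesis using wD 2 by (simp add: p_def)
    qed (use wD[OF s] in \<open>auto simp: p_def\<close>)
  qed
  have Sspan: "S \<subseteq> span (D \<union> c0 ` {..<N} \<union> K)"
  proof
    fix x assume x: "x \<in> S"
    define u where "u = (\<Sum>s\<in>I. froot (B x (w s)) *s p s)"
    have DcS: "D \<union> c0 ` {..<N} \<subseteq> S" using D(2) c0S by auto
    have uS: "u \<in> S"
      unfolding u_def using pw(2) DcS by (intro subspace_sum subspace_scale S(1)) blast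
    have "B (x - u) (w t) = 0" if t: "t \<in> I" for t
    proof -
      have "B u (w t) = (\<Sum>s\<in>I. if s = t then B x (w s) else 0)"
        unfolding u_def B_sum_left B_scale_left using pw(1) t by (intro sum.cong) auto
      then show ?thesis using t finI by (simp add: B_diff_left)
    qed
    then have "x - u \<in> K" using x uS by (auto simp: K_def intro: subspace_diff[OF S(1)])
    then have "x - u \<in> span (D \<union> c0 ` {..<N} \<union> K)" by (intro span_base) blast
    moreover have "u \<in> span (D \<union> c0 ` {..<N} \<union> K)"
      unfolding u_def using pw(2) by (intro span_sum span_scale span_base) blast
    ultimately show "x \<in> span (D \<union> c0 ` {..<N} \<union> K)" using span_add by fastforce
  qed
  obtain J where J: "J \<subseteq> K" "rel_basis D (J <+> {..<N}) (case_sum id c0) S"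
    using rel_basis_extend[OF S D finite_lessThan c0ind _ _ Sspan] c0S by (auto simp: K_def)
  have finJ: "finite J" using rel_basisD(1)[OF J(2)] by (simp add: finite_Plus_iff)
  obtain e where e: "bij_betw e {..<card J} J"
    using finJ by (metis ex_bij_betw_nat_finite atLeast0LessThan)
  define d where "d = N + card J"
  define c where "c i = (if i < N then c0 i else e (i - N))" for i
  have cS: "rel_basis D {..<d} c S"
  proof -
    define h where "h i = (if i < N then Inr i else Inl (e (i - N)))" for i
    have "bij_betw (Inl \<circ> e) {..<card J} (Inl ` J :: ('b + nat) set)"
      by (rule bij_betw_trans[OF e inj_on_imp_bij_betw[OF inj_Inl]])
    moreover have "Inr ` {..<N} \<inter> Inl ` J = {}" by auto
    ultimately have "bij_betw (\<lambda>i. if i < N then Inr i else (Inl \<circ> e) (i - N))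
        {..<N + card J} (Inr ` {..<N} \<union> Inl ` J)"
      by (intro bij_betw_append inj_on_imp_bij_betw inj_Inr)
    then have "bij_betw h {..<N + card J} (Inr ` {..<N} \<union> Inl ` J)"
      unfolding h_def[abs_def] o_def .
    then have "bij_betw h {..<d} (J <+> {..<N})" by (simp add: d_def Plus_def Un_commute)
    moreover have "case_sum id c0 \<circ> h = c" by (auto simp: h_def c_def)
    ultimately show ?thesis using rel_basis_reindex[OF J(2)] by metis
  qed
  have cw: "B (c i) (w t) = of_bool (t = Inl (i, 0))" if "i < d" "t \<in> I" for i t
  proof (cases "i < N")
    case True
    then show ?thesis using c0w[OF True that(2)] by (simp add: c_def)
  next
    case False
    then have "e (i - N) \<in> J" using that(1) e by (auto simp: d_def bij_betw_def)
    then have "B (c i) (w t) = 0" using J(1) that(2) False by (auto simp: K_def c_def)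
    moreover have "t \<noteq> Inl (i, 0)" using False that(2) by (auto simp: I_def)
    ultimately show ?thesis by simp
  qed
  have cin: "c i \<in> S" if "i < d" for i using rel_basisD(2)[OF cS] that by simp

  have cind: "\<forall>j\<in>{..<d}. \<alpha> j = 0" if "\<forall>x\<in>R. B x (\<Sum>i<d. \<alpha> i *s c i) = 0" for \<alpha>
  proof -
    have "(\<Sum>i<d. \<alpha> i *s c i) \<in> S" using cin by (intro subspace_sum subspace_scale S(1)) auto
    then have "(\<Sum>i<d. \<alpha> i *s c i) \<in> D" using that by (simp add: D_def perp_def)
    then show ?thesis using indep_modD[OF rel_basisD(3)[OF cS]] by blast
  qed
  obtain r0 where "\<And>i. i \<in> {..<d} \<Longrightarrow> r0 i \<in> R"
    "\<And>i j. i \<in> {..<d} \<Longrightarrow> j \<in> {..<d} \<Longrightarrow> B (r0 i) (c j) = of_bool (i = j)"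
    using left_dual[OF finite_lessThan R(1) cind] by blast
  then have r0: "r0 i \<in> R" "j < d \<Longrightarrow> B (r0 i) (c j) = of_bool (i = j)" if "i < d" for i j
    using that by simp_all
  \<comment> \<open>Every element of \<open>R\<close> is a combination of the \<open>r0 i\<close> plus an element that kills all \<open>c i\<close> and, like all of \<open>R\<close>,
    kills \<open>D\<close>; such an element lies in \<open>L\<close>.\<close>
  define L where "L = {x\<in>R. \<forall>y\<in>S. B x y = 0}"
  have L: "subspace L" "L \<subseteq> R" unfolding L_def using subspace_left_kernel[OF R(1)] by auto
  have r0c: "B (\<Sum>i<d. \<alpha> i *s r0 i) (c j) = \<alpha> j ^ q" if "j < d" for \<alpha> j
  proof -
    have "B (\<Sum>i<d. \<alpha> i *s r0 i) (c j) = (\<Sum>i<d. if i = j then \<alpha> i ^ q else 0)"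
      unfolding B_sum_left B_scale_left using r0 that by (intro sum.cong) auto
    then show ?thesis using that by simp
  qed
  have r0R: "(\<Sum>i<d. \<alpha> i *s r0 i) \<in> R" for \<alpha>
    using r0(1) by (intro subspace_sum subspace_scale R(1)) auto
  have r0L: "rel_basis L {..<d} r0 R"
    unfolding rel_basis_def
  proof (intro conjI ballI)
    show "indep_mod L {..<d} r0"
      unfolding indep_mod_def
    proof (intro allI impI ballI)
      fix \<alpha> j assume *: "(\<Sum>i<d. \<alpha> i *s r0 i) \<in> L" and j: "j \<in> {..<d}"
      then have "B (\<Sum>i<d. \<alpha> i *s r0 i) (c j) = 0" using cin by (auto simp: L_def)
      then show "\<alpha> j = 0" using r0c j by simp
    qed
    fix x assume x: "x \<in> R"
    define y where "y = x - (\<Sum>j<d. froot (B x (c j)) *s r0 j)"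
    have yR: "y \<in> R" unfolding y_def using x r0R by (intro subspace_diff R(1))
    have yc: "B y (c j) = 0" if "j < d" for j unfolding y_def B_diff_left r0c[OF that] by simp
    have "B y s = 0" if s: "s \<in> S" for s
    proof -
      obtain \<gamma> where \<gamma>: "s - (\<Sum>j<d. \<gamma> j *s c j) \<in> D" using rel_basis_expand[OF cS s] by blast
      have "B y (\<Sum>j<d. \<gamma> j *s c j) = 0" using yc by (simp add: B_simps)
      then show ?thesis using RD[OF yR \<gamma>] by (simp add: B_diff_right)
    qed
    then have "y \<in> L" using yR by (simp add: L_def)
    then show "\<exists>\<alpha>. x - (\<Sum>j<d. \<alpha> j *s r0 j) \<in> L"
      unfolding y_def by (rule exI[of _ "\<lambda>j. froot (B x (c j))"])
  qed (use r0 in auto)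
  have "fin_dim L" by (rule fin_dim_subset[OF S(2) subset_trans[OF L(2) R(2)]])
  from fam_basis_exists[OF L(1) this] obtain T where T: "T \<subseteq> L" "fam_basis T id L" by blast
  have finT: "finite T" using rel_basisD(1)[OF T(2)] .
  obtain f where f: "bij_betw f {..<card T} T"
    using finT by (metis ex_bij_betw_nat_finite atLeast0LessThan)
  define \<rho> where "\<rho> = d + card T"
  define r where "r i = (if i < d then r0 i else f (i - d))" for i
  have rR: "fam_basis {..<\<rho>} r R"
  proof -
    have base: "fam_basis ({..<d} <+> T) (case_sum r0 id) R"
      using rel_basis_trans[OF r0L T(2) L subspace_single_0] subspace_0[OF L(1)] by simp
    define h where "h i = (if i < d then Inl i else Inr (f (i - d)))" for i
    have "bij_betw (Inr \<circ> f) {..<card T} (Inr ` T :: (nat + 'b) set)"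
      by (rule bij_betw_trans[OF f inj_on_imp_bij_betw[OF inj_Inr]])
    moreover have "Inl ` {..<d} \<inter> Inr ` T = {}" by auto
    ultimately have "bij_betw (\<lambda>i. if i < d then Inl i else (Inr \<circ> f) (i - d))
        {..<d + card T} (Inl ` {..<d} \<union> Inr ` T)"
      by (intro bij_betw_append inj_on_imp_bij_betw inj_Inl)
    then have "bij_betw h {..<d + card T} (Inl ` {..<d} \<union> Inr ` T)"
      unfolding h_def[abs_def] o_def .
    then have "bij_betw h {..<\<rho>} ({..<d} <+> T)" by (simp add: \<rho>_def Plus_def)
    moreover have "case_sum r0 id \<circ> h = r" by (auto simp: h_def r_def)
    ultimately show ?thesis using rel_basis_reindex[OF base] by metis
  qed
  have rin: "r i \<in> R" if "i < \<rho>" for i using rel_basisD(2)[OF rR] that by simp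
  have rc: "B (r i) (c j) = of_bool (i = j)" if "i < \<rho>" "j < d" for i j
  proof (cases "i < d")
    case False
    then have "f (i - d) \<in> T" using that(1) f by (auto simp: \<rho>_def bij_betw_def)
    then show ?thesis using T(1) cin[OF that(2)] False that(2) by (auto simp: r_def L_def)
  qed (use r0 that in \<open>simp add: r_def\<close>)

  \<comment> \<open>Adding elements of \<open>R\<close> changes neither \<open>B z x\<close> nor \<open>B x y\<close> for \<open>y \<in> D\<close>, so only the products with the \<open>c j\<close> are affected.\<close>
  define adj where "adj x = x - (\<Sum>j<d. froot (B x (c j)) *s r j)" for x
  have radj: "(\<Sum>j<d. \<alpha> j *s r j) \<in> R" for \<alpha>
    using rin by (intro subspace_sum subspace_scale R(1)) (auto simp: \<rho>_def)
  have adjR: "x - adj x \<in> R" for x using radj by (simp add: adj_def)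
  have adjc: "B (adj x) (c j) = 0" if "j < d" for x j
  proof -
    have "B (\<Sum>i<d. froot (B x (c i)) *s r i) (c j) = (\<Sum>i<d. if i = j then B x (c i) else 0)"
      unfolding B_sum_left B_scale_left using rc that by (intro sum.cong) (auto simp: \<rho>_def)
    then show ?thesis using that by (simp add: adj_def B_diff_left)
  qed
  have adjD: "B (adj x) y = B x y" if "y \<in> D" for x y
    using RD[OF adjR that, of x] by (simp add: B_diff_left)
  have adj_right: "B z (adj x) = B z x" if "z \<in> S" for x z
    using SR[OF that adjR, of x] by (simp add: B_diff_right)
  have adjS: "adj x \<in> S" if "x \<in> S" for x
  proof -
    have "x - (x - adj x) \<in> S" using that adjR[of x] R(2) subspace_diff[OF S(1)] by blast
    then show ?thesis by simp
  qed
  have basisD: "fam_basis (I <+> {..<\<rho>}) (case_sum (adj \<circ> w) r) D"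
  proof -
    have "rel_basis R I (adj \<circ> w) D"
      by (rule rel_basis_shift[OF wR R(1) D(1) RsubD]) (use adjR in simp)
    then show ?thesis
      using rel_basis_trans[OF _ rR R(1) RsubD subspace_single_0] subspace_0[OF R(1)] by simp
  qed
  have basisS: "fam_basis ({..<d} <+> (I <+> {..<\<rho>})) (case_sum (adj \<circ> c) (case_sum (adj \<circ> w) r)) S"
  proof -
    have "rel_basis D {..<d} (adj \<circ> c) S"
      by (rule rel_basis_shift[OF cS D(1) S(1) D(2)]) (use adjR RsubD in auto)
    then show ?thesis
      using rel_basis_trans[OF _ basisD D subspace_single_0] subspace_0[OF D(1)] by simp
  qed
  \<comment> \<open>The three groups of basis vectors are relabelled: \<open>r i\<close> and \<open>c i\<close> take the positions \<open>0\<close> and \<open>1\<close> of chain \<open>i\<close>, and the old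
    chains move up by two.\<close>
  define len' where "len' i = (if i < N then len i + 2 else if i < d then 2 else 1)" for i
  define I' where "I' = chain_graph \<rho> len' m"
  define h :: "vertex \<Rightarrow> nat + vertex + nat" where
    "h s = (case s of Inl (i, a) \<Rightarrow> (if a = 0 then Inr (Inr i) else if a = 1 then Inl i
        else Inr (Inl (Inl (i, a - 2)))) | Inr j \<Rightarrow> Inr (Inl (Inr j)))" for s
  define g :: "nat + vertex + nat \<Rightarrow> vertex" where
    "g = case_sum (\<lambda>i. Inl (i, 1)) (case_sum (case_sum (\<lambda>(i, a). Inl (i, a + 2)) Inr) (\<lambda>i. Inl (i, 0)))"
  have Nd: "N \<le> d" "d \<le> \<rho>" by (auto simp: d_def \<rho>_def)
  have "bij_betw h I' ({..<d} <+> (I <+> {..<\<rho>}))"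
  proof (rule bij_betwI[where g=g])
    show "h \<in> I' \<rightarrow> {..<d} <+> (I <+> {..<\<rho>})"
    proof
      fix s assume "s \<in> I'"
      then show "h s \<in> {..<d} <+> (I <+> {..<\<rho>})"
        using Nd by (cases s) (auto simp: I'_def I_def h_def len'_def split: if_splits)
    qed
    show "g \<in> {..<d} <+> (I <+> {..<\<rho>}) \<rightarrow> I'"
    proof
      fix s assume "s \<in> {..<d} <+> (I <+> {..<\<rho>})"
      then consider i where "s = Inl i" "i < d" | i a where "s = Inr (Inl (Inl (i, a)))" "i < N" "a < len i"
        | j where "s = Inr (Inl (Inr j))" "j < m" | i where "s = Inr (Inr i)" "i < \<rho>"
        by (auto simp: I_def chain_graph_def)
      then show "g s \<in> I'" using Nd by cases (auto simp: g_def I'_def len'_def)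
    qed
    show "g (h s) = s" if "s \<in> I'" for s
      by (cases s) (auto simp: g_def h_def)
    show "h (g s) = s" for s
      by (auto simp: g_def h_def split: sum.splits)
  qed
  from rel_basis_reindex[OF basisS this]
  have basis: "fam_basis I' (case_sum (adj \<circ> c) (case_sum (adj \<circ> w) r) \<circ> h) S" .
  define v where "v = case_sum (adj \<circ> c) (case_sum (adj \<circ> w) r) \<circ> h"
  have vr: "v (Inl (i, 0)) = r i" and vc: "v (Inl (i, Suc 0)) = adj (c i)"
    and vw: "v (Inl (i, Suc (Suc a))) = adj (w (Inl (i, a)))" and vl: "v (Inr j) = adj (w (Inr j))"
    for i a j by (auto simp: v_def h_def)
  have gram: "B (v s) (v t) = of_bool (linked s t)" if s: "s \<in> I'" and t: "t \<in> I'" for s t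
  proof -
    have split: "(\<exists>i. u = Inl (i, 0) \<and> v u = r i \<and> i < \<rho>) \<or> (\<exists>i. u = Inl (i, Suc 0) \<and> v u = adj (c i) \<and> i < d)
        \<or> (\<exists>i a. u = Inl (i, Suc (Suc a)) \<and> v u = adj (w (Inl (i, a))) \<and> Inl (i, a) \<in> I)
        \<or> (\<exists>j. u = Inr j \<and> v u = adj (w (Inr j)) \<and> Inr j \<in> I)"
      if "u \<in> I'" for u
      using that unfolding I'_def
    proof (cases u rule: chain_graph_cases)
      case (2 i a)
      then show ?thesis
        using Nd by (cases a) (auto simp: vc vw I_def len'_def split: if_splits)
    qed (auto simp: vr vl I_def)
    have wS: "w u \<in> S" if "u \<in> I" for u using wD[OF that] D(2) by blast
    have rS: "r i \<in> S" if "i < \<rho>" for i using rin[OF that] R(2) by blast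
    have 1: "B (v s) (r i) = 0" if "i < \<rho>" for i
      using split[OF s] SR[OF _ rin[OF that]] adjS cin wS rS by auto
    have 2: "B (r i) (adj (w u)) = 0" if "i < \<rho>" "u \<in> I" for i u
      using that adj_right[OF rS] RD[OF rin wD] by simp
    have 3: "B (r i) (adj (c j)) = of_bool (i = j)" if "i < \<rho>" "j < d" for i j
      using that adj_right[OF rS] rc by simp
    have 4: "B (adj y) (adj (c j)) = 0" if "y \<in> S" "j < d" for y j
      using that adj_right[OF adjS] adjc by simp
    have 5: "B (adj y) (adj (w u)) = B y (w u)" if "y \<in> S" "u \<in> I" for y u
      using that adj_right[OF adjS] adjD[OF wD] by simp
    show ?thesis
      using split[OF s] split[OF t] 1 2 3
      by (elim disjE exE conjE) (simp_all add: 4 5 cin wS cw ww linked_def)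
  qed
  have "normal_basis \<rho> len' m v S"
    using basis gram unfolding normal_basis_def I'_def v_def by (auto simp: len'_def)
  then show ?thesis by blast
qed

text \<open>
  A complement of the right radical \<open>R\<close> in its orthogonal space has smaller dimension than \<open>S\<close> as soon as \<open>R \<noteq> 0\<close>.
\<close>

theorem normal_basis_exists:
  assumes "subspace S" "fin_dim S"
  shows "\<exists>N len m b. normal_basis N len m b S"
  using assms
proof (induction "dim S" arbitrary: S rule: less_induct)
  case less
  note S = less.prems
  define R where "R = right_rad S"
  define D where "D = perp S R"
  have R: "subspace R" "R \<subseteq> S"
    using subspace_perp[OF S(1), of S] by (simp_all add: R_def right_rad_eq) (simp add: perp_def)
  have D: "subspace D" "D \<subseteq> S"
    using subspace_perp[OF S(1), of R] by (simp_all add: D_def) (simp add: perp_def)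
  have RsubD: "R \<subseteq> D" using R by (auto simp: D_def perp_def R_def right_rad_def)
  show ?case
  proof (cases "R = {0}")
    case True
    then obtain m b where b: "fam_basis {..<m::nat} b S"
        "\<And>i j. i < m \<Longrightarrow> j < m \<Longrightarrow> B (b i) (b j) = of_bool (i = j)"
      using orthonormal_basis[OF S] by (auto simp: R_def)
    define h :: "vertex \<Rightarrow> nat" where "h = case_sum (\<lambda>_. 0) id"
    have "bij_betw h (chain_graph 0 (\<lambda>_. 0) m) {..<m}"
      by (rule bij_betwI[where g=Inr]) (auto simp: chain_graph_def h_def)
    from rel_basis_reindex[OF b(1) this]
    have "normal_basis 0 (\<lambda>_. 0) m (b \<circ> h) S"
      using b(2) by (auto simp: normal_basis_def chain_graph_def linked_def h_def)
    then show ?thesis by blast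
  next
    case False
    have fin: "fin_dim D" "fin_dim R"
      using fin_dim_subset[OF S(2)] D(2) R(2) by blast+
    obtain JR where JR: "fam_basis JR id R" using fam_basis_exists[OF R(1) fin(2)] by blast
    obtain M where M: "rel_basis R M id D"
      using rel_basis_exists[OF D(1) fin(1) R(1) RsubD subset_refl] span_superset[of "R \<union> D"]
      by (metis Un_subset_iff)
    obtain C where C: "rel_basis D C id S"
      using rel_basis_exists[OF S D subset_refl] span_superset[of "D \<union> S"]
      by (metis Un_subset_iff)
    have "fam_basis (M <+> JR) (case_sum id id) D"
      using rel_basis_trans[OF M JR R(1) RsubD subspace_single_0] subspace_0[OF R(1)] by simp
    then have "fam_basis (C <+> (M <+> JR)) (case_sum id (case_sum id id)) S"
      using rel_basis_trans[OF C _ D subspace_single_0] subspace_0[OF D(1)] by simp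
    then have dimS: "dim S = card (C <+> (M <+> JR))" using fam_basis_card S(1) by metis
    have "JR \<noteq> {}" using False JR subspace_0[OF R(1)] by (auto simp: rel_basis_def)
    then have "card M < dim S"
      using rel_basisD(1)[OF M] rel_basisD(1)[OF JR] rel_basisD(1)[OF C]
      by (simp add: dimS card_Plus card_gt_0_iff trans_less_add2)
    moreover have "indep_mod {0} M id"
      using rel_basisD(3)[OF M] subspace_0[OF R(1)] by (auto simp: indep_mod_def)
    then have "fam_basis M id (span M)"
      using fam_basisI[OF rel_basisD(1)[OF M]] by fastforce
    then have "dim (span M) = card M" using fam_basis_card by (metis subspace_span)
    moreover have "fin_dim (span M)" using rel_basisD(1)[OF M] by (auto simp: fin_dim_def)
    ultimately obtain N len m w where "normal_basis N len m w (span M)"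
      using less.hyps[of "span M"] by auto
    then show ?thesis
      using normal_basis_lift[OF S M[unfolded D_def R_def]] by blast
  qed
qed

end

section \<open>Partitions as isomorphism types of graphs of chains and loops\<close>

text \<open>
  A loop counts as a part \<open>1\<close>. There is no conflict with chains, which have length at least \<open>2\<close> in the non-degenerate case.
\<close>

definition chain_type :: "nat \<Rightarrow> (nat \<Rightarrow> nat) \<Rightarrow> nat \<Rightarrow> nat multiset" where
  "chain_type N len m = image_mset len (mset_set {..<N}) + replicate_mset m 1"

lemma count_chain_lengths:
  "count (image_mset len (mset_set {..<N::nat})) x = card {j. j < N \<and> len j = x}"
proof -
  have "count (image_mset len (mset_set {..<N})) x = (\<Sum>j\<in>{j. j < N \<and> len j = x}. 1)"
    unfolding count_image_mset by (intro sum.cong) auto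
  then show ?thesis by simp
qed

lemma chain_type_eqD:
  assumes "chain_type N len m = chain_type N' len' m'"
    and "\<And>i. i < N \<Longrightarrow> len i \<ge> 2" "\<And>i. i < N' \<Longrightarrow> len' i \<ge> 2"
  shows "N' = N" "m' = m" "image_mset len (mset_set {..<N}) = image_mset len' (mset_set {..<N})"
proof -
  have 1: "count (image_mset len (mset_set {..<N})) 1 = 0"
    "count (image_mset len' (mset_set {..<N'})) 1 = 0"
    using assms(2,3) by (force simp: count_chain_lengths)+
  have "count (chain_type N len m) 1 = count (chain_type N' len' m') 1" using assms(1) by simp
  then show m: "m' = m" using 1 by (simp add: chain_type_def)
  have "image_mset len (mset_set {..<N}) = image_mset len' (mset_set {..<N'})"
    using assms(1) by (simp add: chain_type_def m)
  moreover from this have "size (image_mset len (mset_set {..<N})) = size (image_mset len' (mset_set {..<N'}))"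
    by simp
  then show "N' = N" by simp
  ultimately show "image_mset len (mset_set {..<N}) = image_mset len' (mset_set {..<N})" by simp
qed

lemma chain_graph_iso:
  assumes "chain_type N len m = chain_type N' len' m'"
    and "\<And>i. i < N \<Longrightarrow> len i \<ge> 2" "\<And>i. i < N' \<Longrightarrow> len' i \<ge> 2"
  obtains h where "bij_betw h (chain_graph N len m) (chain_graph N' len' m')"
    and "\<And>s t. linked (h s) (h t) = linked s t"
proof -
  have eq: "N' = N" "m' = m" "image_mset len (mset_set {..<N}) = image_mset len' (mset_set {..<N})"
    using chain_type_eqD[OF assms(1)] assms(2,3) by blast+
  obtain p where p: "p permutes {..<N}" "\<forall>i\<in>{..<N}. len i = len' (p i)"
    using image_mset_eq_implies_permutes[OF _ eq(3)] by blast
  have pinj: "p i = p j \<longleftrightarrow> i = j" for i j using permutes_inj[OF p(1)] by (auto dest: injD)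
  define h :: "vertex \<Rightarrow> vertex" where "h = map_sum (map_prod p id) id"
  have "bij_betw h (chain_graph N len m) (chain_graph N' len' m')"
  proof (rule bij_betwI[where g="map_sum (map_prod (inv_into UNIV p) id) id"])
    show "h \<in> chain_graph N len m \<rightarrow> chain_graph N' len' m'"
      using permutes_in_image[OF p(1)] p(2) by (auto simp: h_def eq chain_graph_def)
    have "inv_into UNIV p i < N" "len (inv_into UNIV p i) = len' i" if "i < N" for i
      using that permutes_in_image[OF permutes_inv[OF p(1)]] p(2) permutes_inverses(1)[OF p(1)]
      by auto
    then show "map_sum (map_prod (inv_into UNIV p) id) id \<in> chain_graph N' len' m' \<rightarrow> chain_graph N len m"
      by (auto simp: eq chain_graph_def)
  qed (auto simp: h_def sum.map_comp map_prod.comp permutes_inv_o[OF p(1)] permutes_inverses[OF p(1)]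
      map_sum_def map_prod_def split: sum.splits prod.splits)
  moreover have "linked (h s) (h t) = linked s t" for s t
    by (cases s; cases t) (auto simp: h_def linked_def pinj)
  ultimately show ?thesis using that by blast
qed

lemma chain_type_realize:
  assumes "0 \<notin># P"
  obtains N len m where "chain_type N len m = P" "\<And>i. i < N \<Longrightarrow> len i \<ge> 2"
proof -
  obtain xs where xs: "mset xs = filter_mset (\<lambda>k. k \<ge> 2) P" using ex_mset by blast
  have ge2: "xs ! i \<ge> 2" if "i < length xs" for i
  proof -
    have "xs ! i \<in># mset xs" using that by simp
    then show ?thesis unfolding xs by simp
  qed
  have "image_mset ((!) xs) (mset_set {..<length xs}) = mset xs"
    by (metis atLeast0LessThan map_nth mset_map mset_upt)
  moreover have "filter_mset (\<lambda>k. k \<ge> 2) P + replicate_mset (count P 1) 1 = P"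
  proof (rule multiset_eqI)
    fix x
    show "count (filter_mset (\<lambda>k. k \<ge> 2) P + replicate_mset (count P 1) 1) x = count P x"
      using assms by (cases "x = 0"; cases "x = 1") (auto simp: not_in_iff)
  qed
  ultimately have "chain_type (length xs) ((!) xs) (count P 1) = P"
    by (simp add: chain_type_def xs)
  then show ?thesis using that ge2 by blast
qed

lemma sum_mset_chain_type: "sum_mset (chain_type N len m) = (\<Sum>i<N. len i) + m"
  by (simp add: chain_type_def sum_unfold_sum_mset)

lemma zero_notin_chain_type:
  assumes "\<And>i. i < N \<Longrightarrow> len i > 0"
  shows "0 \<notin># chain_type N len m"
proof
  assume "0 \<in># chain_type N len m"
  then obtain i where "i < N" "len i = 0" by (auto simp: chain_type_def split: if_splits)
  then show False using assms[of i] by simp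
qed

section \<open>Uniqueness of the chain lengths\<close>

context frobenius_pairing
begin

primrec orth_seq :: "'b set \<Rightarrow> nat \<Rightarrow> 'b set" where
  "orth_seq S 0 = S"
| "orth_seq S (Suc i) = perp S (orth_seq S i)"

text \<open>
  The vertices whose basis vectors span the \<open>i\<close>-th iterated orthogonal space. Orthogonality to a set of vertices excludes exactly their
  successors. So the membership of position \<open>a\<close> alternates during the first \<open>a\<close> steps and is constant from then on, because the
  head, which has no predecessor, is never excluded.
\<close>

definition layer :: "vertex set \<Rightarrow> nat \<Rightarrow> vertex set" where
  "layer I i = {s \<in> I. case s of Inl (j, a) \<Rightarrow> even (min a i) | Inr j \<Rightarrow> even i}"

lemma perp_span: "perp S (span X) = perp S X"
proof
  show "perp S (span X) \<subseteq> perp S X" using span_superset by (auto simp: perp_def)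
  show "perp S X \<subseteq> perp S (span X)"
  proof
    fix y assume y: "y \<in> perp S X"
    have "B x y = 0" if "x \<in> span X" for x
      using that
    proof (induction rule: span_induct_alt)
      case (step c u w)
      then show ?case using y by (simp add: B_simps perp_def)
    qed simp
    then show "y \<in> perp S (span X)" using y by (simp add: perp_def)
  qed
qed

lemma perp_span_normal_basis:
  assumes S: "subspace S" and b: "normal_basis N len m b S" and T: "T \<subseteq> chain_graph N len m"
  shows "perp S (span (b ` T)) = span (b ` {t \<in> chain_graph N len m. \<forall>s\<in>T. \<not> linked s t})"
    (is "_ = span (b ` ?T')")
proof -
  define I where "I = chain_graph N len m"
  have fb: "fam_basis I b S" using b by (simp add: normal_basis_def I_def)
  have fin: "finite I" by (simp add: I_def)
  have gram: "B (b s) (b t) = of_bool (linked s t)" if "s \<in> I" "t \<in> I" for s t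
    using b that by (simp add: normal_basis_def I_def)
  show ?thesis
    unfolding perp_span
  proof
    show "perp S (b ` T) \<subseteq> span (b ` ?T')"
    proof
      fix y assume y: "y \<in> perp S (b ` T)"
      then obtain \<alpha> where \<alpha>: "y = (\<Sum>t\<in>I. \<alpha> t *s b t)"
        using fam_basis_expand[OF fb] by (auto simp: perp_def)
      have "\<alpha> t = 0" if t: "t \<in> I - ?T'" for t
      proof -
        obtain s where s: "s \<in> T" "linked s t" using t by (auto simp: I_def)
        have u: "linked s t' \<longleftrightarrow> t' = t" for t'
          using s(2) by (auto simp: linked_def split: sum.splits)
        have "B (b s) y = (\<Sum>t'\<in>I. if t' = t then \<alpha> t' else 0)"
          unfolding \<alpha> B_sum_right B_scale_right
          using gram s(1) T u by (intro sum.cong) (auto simp: I_def subset_iff)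
        also have "\<dots> = \<alpha> t" using t fin by simp
        finally show ?thesis using y s(1) by (auto simp: perp_def)
      qed
      then have "y = (\<Sum>t\<in>?T'. \<alpha> t *s b t)"
        unfolding \<alpha> using fin by (intro sum.mono_neutral_right) (auto simp: I_def)
      then show "y \<in> span (b ` ?T')" by (simp add: sum_in_span)
    qed
    have "b ` ?T' \<subseteq> perp S (b ` T)"
      using gram T rel_basisD(2)[OF fb] by (auto simp: perp_def I_def subset_iff)
    then show "span (b ` ?T') \<subseteq> perp S (b ` T)"
      by (intro span_minimal subspace_perp S)
  qed
qed

lemma layer_Suc:
  "layer (chain_graph N len m) (Suc i)
    = {t \<in> chain_graph N len m. \<forall>s\<in>layer (chain_graph N len m) i. \<not> linked s t}"
  (is "?L = ?R")
proof (rule Set.set_eqI)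
  fix t
  show "t \<in> ?L \<longleftrightarrow> t \<in> ?R"
  proof (cases "t \<in> chain_graph N len m")
    case True
    then show ?thesis
    proof (cases t rule: chain_graph_cases)
      case (1 j)
      then show ?thesis using True by (auto simp: layer_def linked_def split: sum.splits)
    next
      case (2 j a)
      have lk: "linked s t \<longleftrightarrow> s = Inl (j, a)" for s
        using 2 by (auto simp: linked_def split: sum.splits)
      have "t \<in> ?R \<longleftrightarrow> (\<forall>s\<in>layer (chain_graph N len m) i. s \<noteq> Inl (j, a))"
        using True by (simp only: lk mem_Collect_eq simp_thms)
      also have "\<dots> \<longleftrightarrow> Inl (j, a) \<notin> layer (chain_graph N len m) i" by blast
      also have "\<dots> \<longleftrightarrow> odd (min a i)" using 2 by (simp add: layer_def)
      also have "\<dots> \<longleftrightarrow> t \<in> ?L" using True 2 by (simp add: layer_def)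
      finally show ?thesis by blast
    next
      case (3 j)
      have lk: "linked s t \<longleftrightarrow> s = Inr j" for s
        using 3 by (auto simp: linked_def split: sum.splits)
      have "t \<in> ?R \<longleftrightarrow> (\<forall>s\<in>layer (chain_graph N len m) i. s \<noteq> Inr j)"
        using True by (simp only: lk mem_Collect_eq simp_thms)
      also have "\<dots> \<longleftrightarrow> Inr j \<notin> layer (chain_graph N len m) i" by blast
      also have "\<dots> \<longleftrightarrow> odd i" using 3 by (simp add: layer_def)
      also have "\<dots> \<longleftrightarrow> t \<in> ?L" using True 3 by (simp add: layer_def)
      finally show ?thesis by blast
    qed
  qed (simp add: layer_def)
qed

lemma orth_seq_layer:
  assumes S: "subspace S" and b: "normal_basis N len m b S"
  shows "orth_seq S i = span (b ` layer (chain_graph N len m) i)"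
proof (induction i)
  case 0
  have "layer (chain_graph N len m) 0 = chain_graph N len m"
  proof (rule Set.set_eqI)
    fix s
    show "s \<in> layer (chain_graph N len m) 0 \<longleftrightarrow> s \<in> chain_graph N len m"
      by (cases s) (auto simp: layer_def)
  qed
  moreover have "fam_basis (chain_graph N len m) b S" using b by (simp add: normal_basis_def)
  from fam_basis_span[OF this S] have "span (b ` chain_graph N len m) = S" .
  ultimately show ?case by simp
next
  case (Suc i)
  have "layer (chain_graph N len m) i \<subseteq> chain_graph N len m" by (auto simp: layer_def)
  then show ?case
    using perp_span_normal_basis[OF S b] by (simp add: Suc layer_Suc)
qed

lemma dim_orth_seq:
  assumes S: "subspace S" and b: "normal_basis N len m b S"
  shows "dim (orth_seq S i) = card (layer (chain_graph N len m) i)"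
proof -
  define I where "I = chain_graph N len m"
  have fb: "fam_basis I b S" using b by (simp add: normal_basis_def I_def)
  note bI = indep_mod_set[OF rel_basisD(1,3)[OF fb]]
  have sub: "layer I i \<subseteq> I" by (auto simp: layer_def)
  have "independent (b ` layer I i)" using bI(2) sub by (meson image_mono independent_mono)
  then have "dim (orth_seq S i) = card (b ` layer I i)"
    using orth_seq_layer[OF S b, of i] by (simp add: I_def dim_eq_card_independent)
  also have "\<dots> = card (layer I i)" using bI(1) sub by (intro card_image) (rule inj_on_subset)
  finally show ?thesis by (simp add: I_def)
qed

text \<open>
  The layers \<open>i\<close> and \<open>i + 2\<close> differ exactly in the vertices at position \<open>i + 1\<close> of the chains that are long enough to have one. In even
  steps these vertices are lost, in odd steps they are gained, hence the two cases.
\<close>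

lemma number_of_long_chains:
  assumes S: "subspace S" and b: "normal_basis N len m b S"
  shows "card {j. j < N \<and> len j > Suc i} = (if even i then dim (orth_seq S i) - dim (orth_seq S (i + 2))
    else dim (orth_seq S (i + 2)) - dim (orth_seq S i))"
proof -
  define I where "I = chain_graph N len m"
  define E where "E = (\<lambda>j. Inl (j, Suc i) :: vertex) ` {j. j < N \<and> len j > Suc i}"
  have cE: "card E = card {j. j < N \<and> len j > Suc i}"
    unfolding E_def by (intro card_image) (auto simp: inj_on_def)
  have EI: "E \<subseteq> I" by (auto simp: E_def I_def)
  have ev: "even (min a i) \<longleftrightarrow> even (min a (i + 2))" if "a \<noteq> Suc i" for a
  proof (cases "a \<le> i")
    case False
    then have "min a i = i" "min a (i + 2) = i + 2" using that by auto
    then show ?thesis by simp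
  qed auto
  have same: "s \<in> layer I i \<longleftrightarrow> s \<in> layer I (i + 2)" if "s \<notin> E" "s \<in> I" for s
  proof (cases s)
    case (Inl ja)
    then obtain j a where ja: "s = Inl (j, a)" by (cases ja) auto
    then have "a \<noteq> Suc i" using that by (auto simp: E_def I_def)
    then show ?thesis using ja ev by (simp add: layer_def)
  qed (simp add: layer_def)
  have inE: "(s \<in> layer I i \<longleftrightarrow> even i) \<and> (s \<in> layer I (i + 2) \<longleftrightarrow> odd i)" if "s \<in> E" for s
    using that EI by (auto simp: E_def layer_def)
  have LI: "layer I k \<subseteq> I" "finite (layer I k)" for k
    by (auto simp: layer_def I_def)
  have "card E = (if even i then card (layer I i) - card (layer I (i + 2))
      else card (layer I (i + 2)) - card (layer I i))"
  proof (cases "even i")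
    case True
    then have "layer I (i + 2) \<subseteq> layer I i" "E = layer I i - layer I (i + 2)"
      using same inE LI(1)[of i] LI(1)[of "i + 2"] EI by blast+
    then show ?thesis using True LI card_Diff_subset by metis
  next
    case False
    then have "layer I i \<subseteq> layer I (i + 2)" "E = layer I (i + 2) - layer I i"
      using same inE LI(1)[of i] LI(1)[of "i + 2"] EI by blast+
    then show ?thesis using False LI card_Diff_subset by metis
  qed
  then show ?thesis unfolding dim_orth_seq[OF S b] cE I_def .
qed

text \<open>
  The dimensions of the iterated orthogonal spaces determine the number of chains of each length, and the dimension of \<open>S\<close>
  then determines the number of loops.
\<close>

theorem chain_type_unique:
  assumes S: "subspace S" and b: "normal_basis N len m b S" "normal_basis N' len' m' b' S"
    and ge2: "\<And>i. i < N \<Longrightarrow> len i \<ge> 2" "\<And>i. i < N' \<Longrightarrow> len' i \<ge> 2"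
  shows "chain_type N len m = chain_type N' len' m'"
proof -
  have long: "card {j. j < N \<and> len j > Suc i} = card {j. j < N' \<and> len' j > Suc i}" for i
    using number_of_long_chains[OF S b(1), of i] number_of_long_chains[OF S b(2), of i] by simp
  have split: "card {j. j < K \<and> l j = Suc (Suc i)}
      = card {j. j < K \<and> l j > Suc i} - card {j. j < K \<and> l j > Suc (Suc i)}" for K and l :: "nat \<Rightarrow> nat" and i
  proof -
    have "{j. j < K \<and> l j = Suc (Suc i)} = {j. j < K \<and> l j > Suc i} - {j. j < K \<and> l j > Suc (Suc i)}"
      by auto
    moreover have "card ({j. j < K \<and> l j > Suc i} - {j. j < K \<and> l j > Suc (Suc i)})
        = card {j. j < K \<and> l j > Suc i} - card {j. j < K \<and> l j > Suc (Suc i)}"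
      by (rule card_Diff_subset) auto
    ultimately show ?thesis by (simp only:)
  qed
  have lens: "image_mset len (mset_set {..<N}) = image_mset len' (mset_set {..<N'})"
  proof (rule multiset_eqI)
    fix x
    show "count (image_mset len (mset_set {..<N})) x = count (image_mset len' (mset_set {..<N'})) x"
    proof (cases "x \<ge> 2")
      case True
      then obtain i where "x = Suc (Suc i)" by (metis add_2_eq_Suc le_Suc_ex)
      then show ?thesis by (simp add: count_chain_lengths split long)
    next
      case False
      then have "{j. j < N \<and> len j = x} = {}" "{j. j < N' \<and> len' j = x} = {}" using ge2 by force+
      then show ?thesis by (simp only: count_chain_lengths)
    qed
  qed
  have "card (chain_graph N len m) = card (chain_graph N' len' m')"
    using fam_basis_card[OF _ S] b unfolding normal_basis_def by metis
  moreover have "(\<Sum>i<N. len i) = (\<Sum>i<N'. len' i)"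
    using lens by (simp add: sum_unfold_sum_mset)
  ultimately have "m = m'" by (simp add: card_chain_graph)
  then show ?thesis using lens by (simp add: chain_type_def)
qed

definition nondegenerate_on :: "'b set \<Rightarrow> bool" where
  "nondegenerate_on S \<longleftrightarrow> (\<forall>v\<in>S. (\<forall>x\<in>S. B x v = 0 \<and> B v x = 0) \<longrightarrow> v = 0)"

text \<open>
  A chain of length one lies in both radicals. If there is none, every vertex has a predecessor or a successor, whose
  product with a vector \<open>v\<close> in both radicals is a coordinate of \<open>v\<close> or its \<open>q\<close>-th power.
\<close>

lemma nondegenerate_on_iff:
  assumes S: "subspace S" and b: "normal_basis N len m b S"
  shows "nondegenerate_on S \<longleftrightarrow> (\<forall>i<N. len i \<ge> 2)"
proof -
  define I where "I = chain_graph N len m"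
  have fb: "fam_basis I b S" using b by (simp add: normal_basis_def I_def)
  have fin: "finite I" by (simp add: I_def)
  have gram: "B (b s) (b t) = of_bool (linked s t)" if "s \<in> I" "t \<in> I" for s t
    using b that by (simp add: normal_basis_def I_def)
  have pos: "len i > 0" if "i < N" for i using b that by (simp add: normal_basis_def)
  show ?thesis
  proof
    assume nd: "nondegenerate_on S"
    show "\<forall>i<N. len i \<ge> 2"
    proof (intro allI impI, rule ccontr)
      fix i assume i: "i < N" "\<not> len i \<ge> 2"
      then have len1: "len i = 1" using pos[of i] by simp
      have iI: "Inl (i, 0) \<in> I" using i(1) len1 by (simp add: I_def)
      have zero: "B (b s) (b (Inl (i, 0))) = 0 \<and> B (b (Inl (i, 0))) (b s) = 0" if "s \<in> I" for s
        using gram[OF that iI] gram[OF iI that] that len1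
        by (auto simp: linked_def I_def split: sum.splits)
      have "B x (b (Inl (i, 0))) = 0 \<and> B (b (Inl (i, 0))) x = 0" if x: "x \<in> S" for x
      proof -
        obtain \<alpha> where \<alpha>: "x = (\<Sum>s\<in>I. \<alpha> s *s b s)" using fam_basis_expand[OF fb x] by blast
        show ?thesis using zero by (simp add: \<alpha> B_simps)
      qed
      then have "b (Inl (i, 0)) = 0"
        using nd rel_basisD(2)[OF fb iI] by (auto simp: nondegenerate_on_def)
      moreover have "b (Inl (i, 0)) \<noteq> 0"
        using indep_mod_set(2)[OF rel_basisD(1,3)[OF fb]] iI by (metis dependent_zero image_eqI)
      ultimately show False by blast
    qed
  next
    assume ge2: "\<forall>i<N. len i \<ge> 2"
    show "nondegenerate_on S"
      unfolding nondegenerate_on_def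
    proof (intro ballI impI)
      fix v assume v: "v \<in> S" "\<forall>x\<in>S. B x v = 0 \<and> B v x = 0"
      obtain \<alpha> where \<alpha>: "v = (\<Sum>t\<in>I. \<alpha> t *s b t)" using fam_basis_expand[OF fb v(1)] by blast
      have right: "\<alpha> t = 0" if "s \<in> I" "t \<in> I" "linked s t" for s t
      proof -
        have u: "linked s t' \<longleftrightarrow> t' = t" for t'
          using that(3) by (auto simp: linked_def split: sum.splits)
        have "B (b s) v = (\<Sum>t'\<in>I. if t' = t then \<alpha> t' else 0)"
          unfolding \<alpha> B_sum_right B_scale_right
          using gram that(1) u by (intro sum.cong) auto
        then show ?thesis using v(2) rel_basisD(2)[OF fb that(1)] that(2) fin by simp
      qed
      have left: "\<alpha> s = 0" if "s \<in> I" "t \<in> I" "linked s t" for s t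
      proof -
        have u: "linked s' t \<longleftrightarrow> s' = s" for s'
          using that(3) by (auto simp: linked_def split: sum.splits)
        have "B v (b t) = (\<Sum>s'\<in>I. if s' = s then \<alpha> s' ^ q else 0)"
          unfolding \<alpha> B_sum_left B_scale_left
          using gram that(2) u by (intro sum.cong) auto
        then show ?thesis using v(2) rel_basisD(2)[OF fb that(2)] that(1) fin by simp
      qed
      have "\<alpha> t = 0" if t: "t \<in> I" for t
        using t unfolding I_def
      proof (cases t rule: chain_graph_cases)
        case (1 i)
        then have "Suc 0 < len i" using ge2 by force
        then show ?thesis using left[OF t, of "Inl (i, Suc 0)"] 1 by (simp add: I_def linked_def)
      next
        case (2 i a)
        then show ?thesis using right[OF _ t, of "Inl (i, a)"] by (simp add: I_def linked_def)
      next
        case (3 j)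
        then show ?thesis using right[OF t t] by (simp add: linked_def)
      qed
      then show "v = 0" by (simp add: \<alpha>)
    qed
  qed
qed

text \<open>
  The last member of a chain lies in the left radical.
\<close>

lemma left_nondegenerate_imp_orthonormal:
  assumes b: "normal_basis N len m b S"
    and left: "\<And>x. x \<in> S \<Longrightarrow> \<forall>y\<in>S. B x y = 0 \<Longrightarrow> x = 0"
  shows "N = 0"
proof (rule ccontr)
  define I where "I = chain_graph N len m"
  have fb: "fam_basis I b S" using b by (simp add: normal_basis_def I_def)
  assume "N \<noteq> 0"
  then have tI: "Inl (0, len 0 - 1) \<in> I" (is "?t \<in> _") using b by (simp add: normal_basis_def I_def)
  have zero: "B (b ?t) (b s) = 0" if "s \<in> I" for s
    using b tI that by (auto simp: normal_basis_def I_def linked_def)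
  have "B (b ?t) y = 0" if y: "y \<in> S" for y
  proof -
    obtain \<alpha> where \<alpha>: "y = (\<Sum>s\<in>I. \<alpha> s *s b s)" using fam_basis_expand[OF fb y] by blast
    show ?thesis using zero by (simp add: \<alpha> B_simps)
  qed
  then have "b ?t = 0" using left rel_basisD(2)[OF fb tI] by blast
  moreover have "b ?t \<noteq> 0"
    using indep_mod_set(2)[OF rel_basisD(1,3)[OF fb]] tI by (metis dependent_zero image_eqI)
  ultimately show False by blast
qed

end

section \<open>Matrices up to Frobenius congruence\<close>

definition fscale :: "'k::field \<Rightarrow> (nat \<Rightarrow> 'k) \<Rightarrow> nat \<Rightarrow> 'k" where
  "fscale c x = (\<lambda>i. c * x i)"

interpretation fs: linear_space fscale
  by unfold_locales (auto simp: fscale_def fun_eq_iff algebra_simps)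

lemma fscale_apply [simp]: "fscale c x i = c * x i"
  by (simp add: fscale_def)

lemma sum_fun_apply: "(\<Sum>i\<in>A. f i) k = (\<Sum>i\<in>A. f i k :: 'k::comm_monoid_add)"
  by (induction A rule: infinite_finite_induct) auto

text \<open>
  Finite sequences are functions that vanish from \<open>n\<close> on; these form a type with addition, on which the theory of vector spaces
  applies for all \<open>n\<close> at once.
\<close>

definition coord_space :: "nat \<Rightarrow> (nat \<Rightarrow> 'k::field) set" where
  "coord_space n = {x. \<forall>i\<ge>n. x i = 0}"

definition unit_fun :: "nat \<Rightarrow> nat \<Rightarrow> 'k::field" where
  "unit_fun j = (\<lambda>i. of_bool (i = j))"

definition sesq :: "nat \<Rightarrow> nat \<Rightarrow> 'k::field mat \<Rightarrow> (nat \<Rightarrow> 'k) \<Rightarrow> (nat \<Rightarrow> 'k) \<Rightarrow> 'k" where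
  "sesq n q M x y = (\<Sum>i<n. \<Sum>j<n. x i ^ q * M $$ (i, j) * y j)"

definition mat_apply :: "nat \<Rightarrow> 'k::field mat \<Rightarrow> (nat \<Rightarrow> 'k) \<Rightarrow> nat \<Rightarrow> 'k" where
  "mat_apply n A x = (\<lambda>k. if k < n then \<Sum>j<n. A $$ (k, j) * x j else 0)"

text \<open>
  The double sum is the entry of \<open>(A\<^sup>[\<^sup>q\<^sup>])\<^sup>T M A\<close>.
\<close>

definition frob_congruent :: "nat \<Rightarrow> nat \<Rightarrow> 'k::field mat \<Rightarrow> 'k mat \<Rightarrow> bool" where
  "frob_congruent n q M M' \<longleftrightarrow> (\<exists>A\<in>GL_mat n. \<forall>i<n. \<forall>j<n.
     M' $$ (i, j) = (\<Sum>k<n. \<Sum>l<n. A $$ (k, i) ^ q * M $$ (k, l) * A $$ (l, j)))"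

lemma subspace_coord_space: "fs.subspace (coord_space n)"
  by (rule fs.subspaceI) (auto simp: coord_space_def)

lemma coord_space_expand:
  assumes "x \<in> coord_space n"
  shows "x = (\<Sum>j<n. fscale (x j) (unit_fun j))"
proof
  fix i
  have "(\<Sum>j<n. x j * of_bool (i = j)) = (\<Sum>j<n. if j = i then x j else 0)"
    by (intro sum.cong) auto
  then show "x i = (\<Sum>j<n. fscale (x j) (unit_fun j)) i"
    using assms by (simp add: sum_fun_apply unit_fun_def coord_space_def)
qed

lemma unit_fun_in: "j < n \<Longrightarrow> unit_fun j \<in> coord_space n"
  by (auto simp: coord_space_def unit_fun_def)

lemma fam_basis_unit: "fs.fam_basis {..<n} unit_fun (coord_space n)"
  unfolding fs.rel_basis_def
proof (intro conjI ballI)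
  show "fs.indep_mod {0} {..<n} unit_fun"
    unfolding fs.indep_mod_def
  proof (intro allI impI ballI)
    fix \<alpha> :: "nat \<Rightarrow> 'k::field" and i assume *: "(\<Sum>j<n. fscale (\<alpha> j) (unit_fun j)) \<in> {0}" and i: "i \<in> {..<n}"
    have "0 = (\<Sum>j<n. fscale (\<alpha> j) (unit_fun j)) i" using * by simp
    also have "\<dots> = (\<Sum>j<n. if j = i then \<alpha> j else 0)"
      unfolding sum_fun_apply by (intro sum.cong) (auto simp: unit_fun_def)
    also have "\<dots> = \<alpha> i" using i by simp
    finally show "\<alpha> i = 0" by simp
  qed
  fix x :: "nat \<Rightarrow> 'k::field" assume "x \<in> coord_space n"
  from coord_space_expand[OF this] show "\<exists>\<alpha>. x - (\<Sum>j<n. fscale (\<alpha> j) (unit_fun j)) \<in> {0}"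
    by (intro exI[of _ x]) simp
qed (auto simp: unit_fun_in)

lemma fin_dim_coord_space: "fs.fin_dim (coord_space n :: (nat \<Rightarrow> 'k::field) set)"
proof -
  have "fs.span (unit_fun ` {..<n}) = (coord_space n :: (nat \<Rightarrow> 'k) set)"
    by (rule fs.fam_basis_span[OF fam_basis_unit subspace_coord_space])
  then show ?thesis
    unfolding fs.fin_dim_def by (intro exI[of _ "unit_fun ` {..<n}"]) simp
qed

lemma dim_coord_space: "fs.dim (coord_space n :: (nat \<Rightarrow> 'k::field) set) = n"
proof -
  have "card {..<n} = fs.dim (coord_space n :: (nat \<Rightarrow> 'k) set)"
    by (rule fs.fam_basis_card[OF fam_basis_unit subspace_coord_space])
  then show ?thesis by simp
qed

lemma mat_apply_in: "mat_apply n A x \<in> coord_space n"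
  by (simp add: mat_apply_def coord_space_def)

lemma mat_apply_mult:
  assumes "A \<in> carrier_mat n n" "C \<in> carrier_mat n n"
  shows "mat_apply n (A * C) x = mat_apply n A (mat_apply n C x)"
proof
  fix k
  show "mat_apply n (A * C) x k = mat_apply n A (mat_apply n C x) k"
  proof (cases "k < n")
    case True
    have "(\<Sum>j<n. (A * C) $$ (k, j) * x j) = (\<Sum>j<n. \<Sum>l<n. A $$ (k, l) * (C $$ (l, j) * x j))"
      using assms True
      by (intro sum.cong refl) (auto simp: scalar_prod_def sum_distrib_right mult.assoc atLeast0LessThan)
    also have "\<dots> = (\<Sum>l<n. A $$ (k, l) * (\<Sum>j<n. C $$ (l, j) * x j))"
      by (subst sum.swap) (simp add: sum_distrib_left)
    finally show ?thesis using True by (simp add: mat_apply_def)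
  qed (simp add: mat_apply_def)
qed

lemma mat_apply_one:
  assumes "x \<in> coord_space n"
  shows "mat_apply n (1\<^sub>m n) x = x"
proof
  fix k
  have "(\<Sum>j<n. 1\<^sub>m n $$ (k, j) * x j) = (\<Sum>j<n. if j = k then x j else 0)" if "k < n"
    using that by (intro sum.cong) auto
  then show "mat_apply n (1\<^sub>m n) x k = x k" using assms by (auto simp: mat_apply_def coord_space_def)
qed

lemma mat_apply_unit: "j < n \<Longrightarrow> k < n \<Longrightarrow> mat_apply n A (unit_fun j) k = A $$ (k, j)"
proof -
  assume j: "j < n" "k < n"
  have "(\<Sum>l<n. A $$ (k, l) * unit_fun j l) = (\<Sum>l<n. if l = j then A $$ (k, l) else 0)"
    by (intro sum.cong) (auto simp: unit_fun_def)
  then show ?thesis using j by (simp add: mat_apply_def)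
qed

lemma mat_apply_expand: "mat_apply n A x = (\<Sum>j<n. fscale (x j) (mat_apply n A (unit_fun j)))"
proof
  fix k
  show "mat_apply n A x k = (\<Sum>j<n. fscale (x j) (mat_apply n A (unit_fun j))) k"
  proof (cases "k < n")
    case True
    then show ?thesis
      unfolding sum_fun_apply by (simp add: mat_apply_unit) (simp add: mat_apply_def mult.commute)
  qed (simp add: sum_fun_apply mat_apply_def)
qed

lemma GL_matE:
  assumes "A \<in> GL_mat n"
  obtains A' where "A \<in> carrier_mat n n" "A' \<in> carrier_mat n n" "A * A' = 1\<^sub>m n" "A' * A = 1\<^sub>m n" "A' \<in> GL_mat n"
proof -
  have A: "A \<in> carrier_mat n n" using assms by (simp add: GL_mat_def)
  obtain A' where A': "inverts_mat A A'" "inverts_mat A' A"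
    using assms by (auto simp: GL_mat_def invertible_mat_def)
  have c: "A' \<in> carrier_mat n n"
  proof
    have "dim_col (A * A') = dim_col (1\<^sub>m n)" "dim_col (A' * A) = dim_col (1\<^sub>m (dim_row A'))"
      using A' A by (auto simp: inverts_mat_def)
    then show "dim_row A' = n" "dim_col A' = n" using A by auto
  qed
  have e: "A * A' = 1\<^sub>m n" "A' * A = 1\<^sub>m n" using A' A c by (auto simp: inverts_mat_def)
  have "A' \<in> GL_mat n"
    using e A c by (auto simp: GL_mat_def invertible_mat_def inverts_mat_def square_mat.simps)
  then show ?thesis using that A c e by blast
qed

lemma GL_matI:
  assumes "A \<in> carrier_mat n n" "A' \<in> carrier_mat n n" "A * A' = 1\<^sub>m n"
  shows "(A :: 'k::field mat) \<in> GL_mat n"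
proof -
  have "A' * A = 1\<^sub>m n" by (rule mat_mult_left_right_inverse[OF assms])
  then show ?thesis
    using assms by (auto simp: GL_mat_def invertible_mat_def inverts_mat_def square_mat.simps)
qed

lemma fam_basis_columns:
  assumes "A \<in> GL_mat n"
  shows "fs.fam_basis {..<n} (\<lambda>j. mat_apply n A (unit_fun j)) (coord_space n)"
proof -
  obtain A' where A: "A \<in> carrier_mat n n" "A' \<in> carrier_mat n n" "A * A' = 1\<^sub>m n" "A' * A = 1\<^sub>m n"
    using GL_matE[OF assms] by metis
  show ?thesis
    unfolding fs.rel_basis_def
  proof (intro conjI ballI)
    show "fs.indep_mod {0} {..<n} (\<lambda>j. mat_apply n A (unit_fun j))"
      unfolding fs.indep_mod_def
    proof (intro allI impI ballI)
      fix \<alpha> :: "nat \<Rightarrow> 'a" and i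
      assume *: "(\<Sum>j<n. fscale (\<alpha> j) (mat_apply n A (unit_fun j))) \<in> {0}" and i: "i \<in> {..<n}"
      define x where "x j = (if j < n then \<alpha> j else 0)" for j
      have xV: "x \<in> coord_space n" by (simp add: x_def coord_space_def)
      have "mat_apply n A x = (\<Sum>j<n. fscale (\<alpha> j) (mat_apply n A (unit_fun j)))"
        by (subst mat_apply_expand) (simp add: x_def)
      then have "mat_apply n A x = 0" using * by simp
      then have "x = mat_apply n A' 0"
        using mat_apply_mult[OF A(2,1), of x] mat_apply_one[OF xV] A(4) by simp
      then have "x i = 0" by (simp add: mat_apply_def)
      then show "\<alpha> i = 0" using i by (simp add: x_def)
    qed
    fix x :: "nat \<Rightarrow> 'a" assume x: "x \<in> coord_space n"
    have "mat_apply n A (mat_apply n A' x) = x"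
      using mat_apply_mult[OF A(1,2), of x] mat_apply_one[OF x] A(3) by simp
    then show "\<exists>\<alpha>. x - (\<Sum>j<n. fscale (\<alpha> j) (mat_apply n A (unit_fun j))) \<in> {0}"
      using mat_apply_expand[of n A "mat_apply n A' x"]
      by (intro exI[of _ "mat_apply n A' x"]) simp
  qed (auto simp: mat_apply_in)
qed

lemma fam_basis_columnsE:
  assumes b: "fs.fam_basis {..<n} b (coord_space n)"
  obtains A where "A \<in> GL_mat n" "\<And>j. j < n \<Longrightarrow> mat_apply n A (unit_fun j) = b j"
proof -
  define A where "A = mat n n (\<lambda>(k, j). b j k)"
  have A: "A \<in> carrier_mat n n" by (simp add: A_def)
  have col: "mat_apply n A (unit_fun j) = b j" if "j < n" for j
  proof
    fix k
    have "b j \<in> coord_space n" using fs.rel_basisD(2)[OF b] that by simp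
    then show "mat_apply n A (unit_fun j) k = b j k"
      using that by (cases "k < n") (simp_all add: mat_apply_unit A_def, simp add: mat_apply_def coord_space_def)
  qed
  have "\<forall>i\<in>{..<n}. \<exists>\<alpha>. unit_fun i = (\<Sum>j<n. fscale (\<alpha> j) (b j))"
    using fs.fam_basis_expand[OF b unit_fun_in] by (metis lessThan_iff)
  then obtain Q where Q: "\<forall>i\<in>{..<n}. unit_fun i = (\<Sum>j<n. fscale (Q i j) (b j))"
    by metis
  define A' where "A' = mat n n (\<lambda>(j, i). Q i j)"
  have A': "A' \<in> carrier_mat n n" by (simp add: A'_def)
  have "A * A' = 1\<^sub>m n"
  proof (rule eq_matI)
    fix k i assume ki: "k < dim_row (1\<^sub>m n)" "i < dim_col (1\<^sub>m n)"
    have "(A * A') $$ (k, i) = (\<Sum>j<n. b j k * Q i j)"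
      using ki by (simp add: A_def A'_def scalar_prod_def atLeast0LessThan)
    also have "\<dots> = unit_fun i k"
      using Q ki by (simp add: sum_fun_apply mult.commute)
    finally show "(A * A') $$ (k, i) = 1\<^sub>m n $$ (k, i)" using ki by (simp add: unit_fun_def)
  qed (use A A' in auto)
  then have "A \<in> GL_mat n" using GL_matI[OF A A'] by blast
  then show ?thesis using that col by blast
qed

text \<open>
  The parameter \<open>K\<close> only serves to fix the type of the field.
\<close>

locale frobenius_field =
  fixes e q :: nat and K :: "'k::alg_closed_field itself"
  assumes prime_char: "prime CHAR('k)" and e_pos: "e > 0" and q_def: "q = CHAR('k) ^ e"
begin

lemma frob_add: "(a + b :: 'k) ^ q = a ^ q + b ^ q"
  by (rule freshmans_dream'[OF prime_char q_def])

lemma q_gt_1: "q > 1"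
  unfolding q_def using prime_gt_1_nat[OF prime_char] e_pos by (rule one_less_power)

lemma of_nat_q: "of_nat q = (0 :: 'k)"
  using e_pos by (simp add: q_def)

abbreviation V :: "nat \<Rightarrow> (nat \<Rightarrow> 'k) set" where "V \<equiv> coord_space"

abbreviation Bf :: "nat \<Rightarrow> 'k mat \<Rightarrow> (nat \<Rightarrow> 'k) \<Rightarrow> (nat \<Rightarrow> 'k) \<Rightarrow> 'k" where "Bf n \<equiv> sesq n q"

lemma pairing: "frobenius_pairing fscale (Bf n M) q"
  using q_gt_1
  by unfold_locales
    (simp_all add: sesq_def frob_add algebra_simps sum.distrib sum_distrib_left power_mult_distrib)

end

sublocale frobenius_field \<subseteq> fp: frobenius_pairing fscale "sesq n q M" q for n and M :: "'k mat"
  by (rule pairing)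

context frobenius_field
begin

lemma sesq_unit:
  assumes "i < n" "j < n"
  shows "Bf n M (unit_fun i) (unit_fun j) = M $$ (i, j)"
proof -
  have q0: "q > 0" using q_gt_1 by simp
  have "Bf n M (unit_fun i) (unit_fun j) = (\<Sum>k<n. \<Sum>l<n. if l = j then (if k = i then M $$ (k, l) else 0) else 0)"
    unfolding sesq_def using q0 by (intro sum.cong) (auto simp: unit_fun_def)
  then show ?thesis using assms by simp
qed

lemma sesq_mat_apply_unit:
  assumes "i < n" "j < n"
  shows "Bf n M (mat_apply n A (unit_fun i)) (mat_apply n A (unit_fun j))
    = (\<Sum>k<n. \<Sum>l<n. A $$ (k, i) ^ q * M $$ (k, l) * A $$ (l, j))"
  unfolding sesq_def using assms by (intro sum.cong refl) (simp add: mat_apply_unit)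

text \<open>
  In this form symmetry and the transport of bases amount to applying the inverse map.
\<close>

lemma frob_congruent_iff:
  "frob_congruent n q M M' \<longleftrightarrow>
    (\<exists>A\<in>GL_mat n. \<forall>x\<in>V n. \<forall>y\<in>V n. Bf n M' x y = Bf n M (mat_apply n A x) (mat_apply n A y))"
    (is "_ \<longleftrightarrow> ?R")
proof
  assume "frob_congruent n q M M'"
  then obtain A where A: "A \<in> GL_mat n"
    and eq: "\<And>i j. i < n \<Longrightarrow> j < n \<Longrightarrow> M' $$ (i, j) = Bf n M (mat_apply n A (unit_fun i)) (mat_apply n A (unit_fun j))"
    unfolding frob_congruent_def by (auto simp: sesq_mat_apply_unit)
  have "Bf n M' x y = Bf n M (mat_apply n A x) (mat_apply n A y)" for x y
  proof -
    have "Bf n M (mat_apply n A x) (mat_apply n A y)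
      = (\<Sum>i<n. \<Sum>j<n. x i ^ q * (y j * Bf n M (mat_apply n A (unit_fun i)) (mat_apply n A (unit_fun j))))"
      unfolding mat_apply_expand[of n A x] fp.B_sum_left fp.B_scale_left
      unfolding mat_apply_expand[of n A y] fp.B_sum_right fp.B_scale_right
      by (simp only: sum_distrib_left)
    also have "\<dots> = Bf n M' x y"
      unfolding sesq_def[of n q M'] by (intro sum.cong refl) (simp add: eq)
    finally show ?thesis by simp
  qed
  then show ?R using A by blast
next
  assume ?R
  then obtain A where A: "A \<in> GL_mat n"
    and eq: "\<And>x y. x \<in> V n \<Longrightarrow> y \<in> V n \<Longrightarrow> Bf n M' x y = Bf n M (mat_apply n A x) (mat_apply n A y)"
    by blast
  have "M' $$ (i, j) = Bf n M (mat_apply n A (unit_fun i)) (mat_apply n A (unit_fun j))" if "i < n" "j < n" for i j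
    using eq[OF unit_fun_in[OF that(1)] unit_fun_in[OF that(2)]] sesq_unit[OF that, of M'] by simp
  then show "frob_congruent n q M M'"
    unfolding frob_congruent_def using A by (auto simp: sesq_mat_apply_unit)
qed

lemma frob_congruent_sym:
  fixes M M' :: "'k mat"
  assumes "frob_congruent n q M M'"
  shows "frob_congruent n q M' M"
proof -
  obtain A where A: "A \<in> GL_mat n"
    and eq: "\<And>x y. x \<in> V n \<Longrightarrow> y \<in> V n \<Longrightarrow> Bf n M' x y = Bf n M (mat_apply n A x) (mat_apply n A y)"
    using assms unfolding frob_congruent_iff by blast
  obtain A' where A': "A \<in> carrier_mat n n" "A' \<in> carrier_mat n n" "A * A' = 1\<^sub>m n" "A' \<in> GL_mat n"
    using GL_matE[OF A] by metis
  have AA': "mat_apply n A (mat_apply n A' x) = x" if "x \<in> V n" for x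
    using mat_apply_mult[OF A'(1,2), of x] mat_apply_one[OF that] A'(3) by simp
  have "\<forall>x\<in>V n. \<forall>y\<in>V n. Bf n M x y = Bf n M' (mat_apply n A' x) (mat_apply n A' y)"
    by (simp add: eq[OF mat_apply_in mat_apply_in] AA')
  then show ?thesis unfolding frob_congruent_iff using A'(4) by blast
qed

text \<open>
  Gram matrices of one pairing with respect to different bases are congruent. With the following converse, which transports
  a basis along a congruence, all congruences can be read off from bases.
\<close>

lemma frob_congruent_Gram:
  assumes b: "fs.fam_basis {..<n} b (V n)" and G: "\<And>i j. i < n \<Longrightarrow> j < n \<Longrightarrow> G $$ (i, j) = Bf n M (b i) (b j)"
  shows "frob_congruent n q M G"
proof -
  obtain A where A: "A \<in> GL_mat n" "\<And>j. j < n \<Longrightarrow> mat_apply n A (unit_fun j) = b j"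
    using fam_basis_columnsE[OF b] by blast
  have "G $$ (i, j) = (\<Sum>k<n. \<Sum>l<n. A $$ (k, i) ^ q * M $$ (k, l) * A $$ (l, j))" if "i < n" "j < n" for i j
    using sesq_mat_apply_unit[OF that, of M A] A(2) that G by simp
  then show ?thesis unfolding frob_congruent_def using A(1) by blast
qed

lemma frob_congruent_basis:
  assumes "frob_congruent n q M M'" and b: "fs.fam_basis J b (V n)"
  obtains b' where "fs.fam_basis J b' (V n)" "\<And>i j. i \<in> J \<Longrightarrow> j \<in> J \<Longrightarrow> Bf n M (b' i) (b' j) = Bf n M' (b i) (b j)"
proof -
  obtain A where A: "A \<in> GL_mat n"
    and eq: "\<And>x y. x \<in> V n \<Longrightarrow> y \<in> V n \<Longrightarrow> Bf n M' x y = Bf n M (mat_apply n A x) (mat_apply n A y)"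
    using assms unfolding frob_congruent_iff by blast
  obtain A' where A': "A \<in> carrier_mat n n" "A' \<in> carrier_mat n n" "A * A' = 1\<^sub>m n" "A' * A = 1\<^sub>m n"
    using GL_matE[OF A] by metis
  have AA': "mat_apply n A (mat_apply n A' x) = x" if "x \<in> V n" for x
    using mat_apply_mult[OF A'(1,2), of x] mat_apply_one[OF that] A'(3) by simp
  have A'A: "mat_apply n A' (mat_apply n A x) = x" if "x \<in> V n" for x
    using mat_apply_mult[OF A'(2,1), of x] mat_apply_one[OF that] A'(4) by simp
  have lin: "mat_apply n A (\<Sum>j\<in>J. fscale (\<alpha> j) (b j)) = (\<Sum>j\<in>J. fscale (\<alpha> j) (mat_apply n A (b j)))" for \<alpha>
    by (intro ext) (auto simp: mat_apply_def sum_fun_apply sum_distrib_left mult_ac intro: sum.swap)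
  have bV: "b j \<in> V n" if "j \<in> J" for j using fs.rel_basisD(2)[OF b that] .
  have sV: "(\<Sum>j\<in>J. fscale (\<alpha> j) (b j)) \<in> V n" for \<alpha>
    using bV by (intro fs.subspace_sum fs.subspace_scale subspace_coord_space)
  have "fs.fam_basis J (\<lambda>j. mat_apply n A (b j)) (V n)"
    unfolding fs.rel_basis_def
  proof (intro conjI ballI)
    show "fs.indep_mod {0} J (\<lambda>j. mat_apply n A (b j))"
      unfolding fs.indep_mod_def
    proof (intro allI impI)
      fix \<alpha> assume "(\<Sum>j\<in>J. fscale (\<alpha> j) (mat_apply n A (b j))) \<in> {0}"
      then have "mat_apply n A (\<Sum>j\<in>J. fscale (\<alpha> j) (b j)) = 0" by (simp add: lin)
      then have "(\<Sum>j\<in>J. fscale (\<alpha> j) (b j)) = mat_apply n A' 0" using A'A[OF sV, of \<alpha>] by simp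
      also have "\<dots> = 0" by (rule ext) (simp add: mat_apply_def)
      finally show "\<forall>j\<in>J. \<alpha> j = 0" using fs.indep_modD[OF fs.rel_basisD(3)[OF b], of \<alpha>] by simp
    qed
    fix x :: "nat \<Rightarrow> 'k" assume x: "x \<in> V n"
    obtain \<alpha> where "mat_apply n A' x = (\<Sum>j\<in>J. fscale (\<alpha> j) (b j))"
      using fs.fam_basis_expand[OF b mat_apply_in] by blast
    then have "x = (\<Sum>j\<in>J. fscale (\<alpha> j) (mat_apply n A (b j)))" using AA'[OF x] lin by metis
    then show "\<exists>\<alpha>. x - (\<Sum>j\<in>J. fscale (\<alpha> j) (mat_apply n A (b j))) \<in> {0}"
      by (intro exI[of _ \<alpha>]) simp
  qed (use fs.rel_basisD(1)[OF b] mat_apply_in in auto)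
  then show ?thesis using that eq bV by force
qed

text \<open>
  Only non-degenerate matrices have a type. For them the types are the congruence classes, by the lemmas that follow.
\<close>

definition has_type :: "nat \<Rightarrow> 'k mat \<Rightarrow> nat multiset \<Rightarrow> bool" where
  "has_type n M P \<longleftrightarrow> (\<exists>N len m b. fp.normal_basis n M N len m b (V n) \<and> (\<forall>i<N. len i \<ge> 2) \<and>
     chain_type N len m = P)"

lemma has_type_congruent:
  assumes "frob_congruent n q M M'" "has_type n M P"
  shows "has_type n M' P"
proof -
  obtain N len m b where b: "fp.normal_basis n M N len m b (V n)" "\<forall>i<N. len i \<ge> 2" "chain_type N len m = P"
    using assms(2) unfolding has_type_def by blast
  then have "fs.fam_basis (chain_graph N len m) b (V n)" by (simp add: fp.normal_basis_def)
  then obtain b' where b': "fs.fam_basis (chain_graph N len m) b' (V n)"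
    "\<And>s t. s \<in> chain_graph N len m \<Longrightarrow> t \<in> chain_graph N len m \<Longrightarrow> Bf n M' (b' s) (b' t) = Bf n M (b s) (b t)"
    using frob_congruent_basis[OF frob_congruent_sym[OF assms(1)]] by blast
  then have "fp.normal_basis n M' N len m b' (V n)"
    using b(1) by (simp add: fp.normal_basis_def)
  then show ?thesis using b(2,3) unfolding has_type_def by blast
qed

lemma has_type_unique:
  assumes "has_type n M P" "has_type n M P'"
  shows "P = P'"
  using assms fp.chain_type_unique[OF subspace_coord_space] unfolding has_type_def by blast

lemma has_type_exists:
  assumes "fp.nondegenerate_on n M (V n)"
  shows "\<exists>P. has_type n M P"
proof -
  obtain N len m b where b: "fp.normal_basis n M N len m b (V n)"
    using fp.normal_basis_exists[OF subspace_coord_space fin_dim_coord_space] by blast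
  then have "\<forall>i<N. len i \<ge> 2"
    using fp.nondegenerate_on_iff[OF subspace_coord_space b] assms by simp
  then show ?thesis using b unfolding has_type_def by blast
qed

lemma has_type_nondegenerate: "has_type n M P \<Longrightarrow> fp.nondegenerate_on n M (V n)"
  using fp.nondegenerate_on_iff[OF subspace_coord_space] unfolding has_type_def by blast

lemma has_type_partition:
  assumes "has_type n M P"
  shows "P \<in> integer_partitions n"
proof -
  obtain N len m b where b: "fp.normal_basis n M N len m b (V n)" "\<forall>i<N. len i \<ge> 2" "chain_type N len m = P"
    using assms(1) unfolding has_type_def by blast
  have "card (chain_graph N len m) = n"
    using fs.fam_basis_card[OF _ subspace_coord_space] b(1) dim_coord_space
    unfolding fp.normal_basis_def by metis
  moreover have "0 \<notin># P" unfolding b(3)[symmetric] using b(2) by (intro zero_notin_chain_type) auto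
  ultimately show ?thesis
    using b(3) by (auto simp: integer_partitions_def sum_mset_chain_type card_chain_graph)
qed

text \<open>
  Normal bases of the same type have isomorphic graphs. Enumerated compatibly with an isomorphism, they have the same Gram matrix \<open>G\<close>,
  to which both matrices are congruent.
\<close>

lemma has_type_imp_congruent:
  assumes "has_type n M P" "has_type n M' P"
  shows "frob_congruent n q M M'"
proof -
  obtain N len m b where b: "fp.normal_basis n M N len m b (V n)" "\<forall>i<N. len i \<ge> 2" "chain_type N len m = P"
    using assms(1) unfolding has_type_def by blast
  obtain N' len' m' b' where b': "fp.normal_basis n M' N' len' m' b' (V n)" "\<forall>i<N'. len' i \<ge> 2"
    "chain_type N' len' m' = P"
    using assms(2) unfolding has_type_def by blast
  define I I' where "I = chain_graph N len m" and "I' = chain_graph N' len' m'"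
  have fb: "fs.fam_basis I b (V n)" "fs.fam_basis I' b' (V n)"
    using b(1) b'(1) by (simp_all add: fp.normal_basis_def I_def I'_def)
  have "card I = n" using fs.fam_basis_card[OF fb(1) subspace_coord_space] dim_coord_space by metis
  then obtain g where g: "bij_betw g {..<n} I"
    using ex_bij_betw_nat_finite[of I] by (auto simp: I_def atLeast0LessThan)
  obtain h where h: "bij_betw h I I'" "\<And>s t. linked (h s) (h t) = linked s t"
    using chain_graph_iso[of N len m N' len' m'] b(2,3) b'(2,3) unfolding I_def I'_def by metis
  define G where "G = mat n n (\<lambda>(i, j). of_bool (linked (g i) (g j)) :: 'k)"
  have gI: "g i \<in> I" "h (g i) \<in> I'" if "i < n" for i
    using g h(1) that by (auto simp: bij_betw_def)
  have "frob_congruent n q M G"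
    by (rule frob_congruent_Gram[OF fs.rel_basis_reindex[OF fb(1) g]])
      (use b(1) gI in \<open>simp add: G_def fp.normal_basis_def I_def\<close>)
  moreover have "frob_congruent n q M' G"
    by (rule frob_congruent_Gram[OF fs.rel_basis_reindex[OF fb(2) bij_betw_trans[OF g h(1)]]])
      (use b'(1) gI h(2) in \<open>simp add: G_def fp.normal_basis_def I'_def\<close>)
  then have "frob_congruent n q G M'" by (rule frob_congruent_sym)
  then obtain b'' where b'': "fs.fam_basis {..<n} b'' (V n)"
    "\<And>i j. i < n \<Longrightarrow> j < n \<Longrightarrow> Bf n G (b'' i) (b'' j) = Bf n M' (unit_fun i) (unit_fun j)"
    using frob_congruent_basis[OF _ fam_basis_unit] by (metis lessThan_iff)
  obtain b3 where b3: "fs.fam_basis {..<n} b3 (V n)"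
    "\<And>i j. i < n \<Longrightarrow> j < n \<Longrightarrow> Bf n M (b3 i) (b3 j) = Bf n G (b'' i) (b'' j)"
    using frob_congruent_basis[OF \<open>frob_congruent n q M G\<close> b''(1)] by (metis lessThan_iff)
  show ?thesis
    by (rule frob_congruent_Gram[OF b3(1)]) (simp add: b3(2) b''(2) sesq_unit)
qed

text \<open>
  The adjacency matrix of a graph with the prescribed chains and loops, for which the unit vectors are a normal basis.
\<close>

lemma has_type_realize:
  assumes "P \<in> integer_partitions n"
  obtains M where "M \<in> carrier_mat n n" "has_type n M P"
proof -
  obtain N len m where P: "chain_type N len m = P" "\<And>i. i < N \<Longrightarrow> len i \<ge> 2"
    using chain_type_realize[of P] assms unfolding integer_partitions_def by blast
  define I where "I = chain_graph N len m"
  have "card I = n"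
    using assms P(1) by (auto simp: integer_partitions_def I_def card_chain_graph sum_mset_chain_type)
  then obtain g where g: "bij_betw g I {..<n}"
    using ex_bij_betw_finite_nat[of I] by (auto simp: I_def atLeast0LessThan)
  define M where "M = mat n n (\<lambda>(i, j). of_bool (linked (the_inv_into I g i) (the_inv_into I g j)) :: 'k)"
  have "fs.fam_basis I (unit_fun \<circ> g) (V n)"
    by (rule fs.rel_basis_reindex[OF fam_basis_unit g])
  moreover have "Bf n M (unit_fun (g s)) (unit_fun (g t)) = of_bool (linked s t)" if "s \<in> I" "t \<in> I" for s t
  proof -
    have "g s < n" "g t < n" using g that by (auto simp: bij_betw_def)
    then show ?thesis
      using g that by (simp add: sesq_unit M_def bij_betw_def the_inv_into_f_f)
  qed
  ultimately have "fp.normal_basis n M N len m (unit_fun \<circ> g) (V n)"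
    using P(2) by (force simp: fp.normal_basis_def I_def)
  then have "has_type n M P" using P unfolding has_type_def by blast
  moreover have "M \<in> carrier_mat n n" by (simp add: M_def)
  ultimately show ?thesis using that by blast
qed

text \<open>
  Without left radical a normal basis consists of loops, so it is orthonormal.
\<close>

lemma left_nondegenerate_iff:
  "(\<forall>x\<in>V n. (\<forall>y\<in>V n. Bf n M x y = 0) \<longrightarrow> x = 0) \<longleftrightarrow> frob_congruent n q M (1\<^sub>m n)"
proof
  assume left: "\<forall>x\<in>V n. (\<forall>y\<in>V n. Bf n M x y = 0) \<longrightarrow> x = 0"
  obtain N len m b where b: "fp.normal_basis n M N len m b (V n)"
    using fp.normal_basis_exists[OF subspace_coord_space fin_dim_coord_space] by blast
  have N: "N = 0" using fp.left_nondegenerate_imp_orthonormal[OF b] left by blast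
  then have fb: "fs.fam_basis (chain_graph 0 len m) b (V n)" using b by (simp add: fp.normal_basis_def)
  have "card (chain_graph 0 len m) = n"
    using fs.fam_basis_card[OF fb subspace_coord_space] dim_coord_space by metis
  then have m: "m = n" by (simp add: card_chain_graph)
  have "bij_betw Inr {..<n} (chain_graph 0 len n)"
    by (auto simp: bij_betw_def chain_graph_def)
  from fs.rel_basis_reindex[OF fb[unfolded m] this]
  show "frob_congruent n q M (1\<^sub>m n)"
    by (rule frob_congruent_Gram) (use b in \<open>auto simp: fp.normal_basis_def N m linked_def\<close>)
next
  assume "frob_congruent n q M (1\<^sub>m n)"
  then obtain b where b: "fs.fam_basis {..<n} b (V n)"
    "\<And>i j. i < n \<Longrightarrow> j < n \<Longrightarrow> Bf n M (b i) (b j) = Bf n (1\<^sub>m n) (unit_fun i) (unit_fun j)"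
    using frob_congruent_basis[OF _ fam_basis_unit] by (metis lessThan_iff)
  show "\<forall>x\<in>V n. (\<forall>y\<in>V n. Bf n M x y = 0) \<longrightarrow> x = 0"
  proof (intro ballI impI)
    fix x assume x: "x \<in> V n" "\<forall>y\<in>V n. Bf n M x y = 0"
    obtain \<alpha> where \<alpha>: "x = (\<Sum>i<n. fscale (\<alpha> i) (b i))" using fs.fam_basis_expand[OF b(1) x(1)] by blast
    have "\<alpha> j = 0" if j: "j < n" for j
    proof -
      have "Bf n M x (b j) = (\<Sum>i<n. if i = j then \<alpha> i ^ q else 0)"
        unfolding \<alpha> fp.B_sum_left fp.B_scale_left
        using j by (intro sum.cong) (auto simp: b(2) sesq_unit)
      then show ?thesis using x(2) fs.rel_basisD(2)[OF b(1), of j] j by simp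
    qed
    then show "x = 0" by (simp add: \<alpha>)
  qed
qed

end

section \<open>Frobenius forms and their matrices\<close>

definition frob_mono :: "nat \<Rightarrow> nat \<Rightarrow> nat \<Rightarrow> nat \<Rightarrow>\<^sub>0 nat" where
  "frob_mono q i j = Poly_Mapping.single i q + Poly_Mapping.single j 1"

definition frob_form :: "nat \<Rightarrow> nat \<Rightarrow> 'k::field mat \<Rightarrow> 'k mpoly" where
  "frob_form n q M = (\<Sum>i<n. \<Sum>j<n. Poly_Mapping.single (frob_mono q i j) (M $$ (i, j)))"

lemma lookup_frob_mono:
  "Poly_Mapping.lookup (frob_mono q i j) k = (if k = i then q else 0) + (if k = j then 1 else 0)"
  by (auto simp: frob_mono_def lookup_add lookup_single)

text \<open>
  For \<open>q = 1\<close> this fails, as the monomial does not tell which factor comes from the \<open>q\<close>-th power; uniqueness of the matrix of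
  a Frobenius form depends on it.
\<close>

lemma frob_mono_eq_iff:
  assumes "q > 1"
  shows "frob_mono q i j = frob_mono q i' j' \<longleftrightarrow> i = i' \<and> j = j'"
proof
  assume eq: "frob_mono q i j = frob_mono q i' j'"
  have l: "(if k = i then q else 0) + (if k = j then 1 else 0 :: nat)
      = (if k = i' then q else 0) + (if k = j' then 1 else 0)" for k
    using lookup_frob_mono[of q i j k] lookup_frob_mono[of q i' j' k] eq by simp
  have "i = i'" using l[of i] assms by (auto split: if_splits)
  moreover have "j = j'" using l[of j] \<open>i = i'\<close> by (auto split: if_splits)
  ultimately show "i = i' \<and> j = j'" by simp
qed simp

lemma mdegree_superset:
  assumes "finite A" "Poly_Mapping.keys m \<subseteq> A"
  shows "mdegree m = (\<Sum>i\<in>A. Poly_Mapping.lookup m i)"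
  unfolding mdegree_def using assms by (intro sum.mono_neutral_left) (auto simp: in_keys_iff)

lemma mdegree_add: "mdegree (a + b) = mdegree a + mdegree b"
proof -
  define A where "A = Poly_Mapping.keys a \<union> Poly_Mapping.keys b"
  have "Poly_Mapping.keys (a + b) \<subseteq> A" using keys_add[of a b] by (simp add: A_def)
  then show ?thesis
    using mdegree_superset[of A "a + b"] mdegree_superset[of A a] mdegree_superset[of A b]
    by (simp add: A_def lookup_add sum.distrib)
qed

lemma mdegree_single: "mdegree (Poly_Mapping.single i k) = k"
  by (simp add: mdegree_def)

lemma mdegree_frob_mono: "mdegree (frob_mono q i j) = q + 1"
  by (simp add: frob_mono_def mdegree_add mdegree_single)

lemma mdegree_eq_1D:
  assumes "mdegree m = 1"
  obtains j where "m = Poly_Mapping.single j 1"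
proof -
  have "Poly_Mapping.keys m \<noteq> {}" using assms by (auto simp: mdegree_def)
  then have "\<exists>j. j \<in> Poly_Mapping.keys m" by blast
  then obtain j where j: "j \<in> Poly_Mapping.keys m" ..
  have "(\<Sum>i\<in>Poly_Mapping.keys m. Poly_Mapping.lookup m i)
      = Poly_Mapping.lookup m j + (\<Sum>i\<in>Poly_Mapping.keys m - {j}. Poly_Mapping.lookup m i)"
    using j by (simp add: sum.remove)
  moreover have "Poly_Mapping.lookup m j \<ge> 1" using j by (simp add: in_keys_iff)
  ultimately have 1: "Poly_Mapping.lookup m j = 1"
      and 0: "(\<Sum>i\<in>Poly_Mapping.keys m - {j}. Poly_Mapping.lookup m i) = 0"
    using assms unfolding mdegree_def by linarith+
  have zero: "Poly_Mapping.lookup m i = 0" if "i \<in> Poly_Mapping.keys m" "i \<noteq> j" for i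
    using 0 that by simp
  have "m = Poly_Mapping.single j 1"
  proof (rule poly_mapping_eqI)
    fix k
    show "Poly_Mapping.lookup m k = Poly_Mapping.lookup (Poly_Mapping.single j 1) k"
    proof (cases "k = j")
      case False
      then have "Poly_Mapping.lookup m k = 0"
        using zero[of k] by (cases "k \<in> Poly_Mapping.keys m") (simp_all add: in_keys_iff)
      then show ?thesis using False by (simp add: lookup_single)
    qed (simp add: 1)
  qed
  then show ?thesis using that by blast
qed

lemma lookup_frob_form:
  assumes "q > 1" "i < n" "j < n"
  shows "Poly_Mapping.lookup (frob_form n q M) (frob_mono q i j) = M $$ (i, j)"
proof -
  have "Poly_Mapping.lookup (frob_form n q M) (frob_mono q i j)
      = (\<Sum>a<n. \<Sum>b<n. if b = j then (if a = i then M $$ (a, b) else 0) else 0)"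
    unfolding frob_form_def lookup_sum
    by (intro sum.cong refl) (auto simp: lookup_single frob_mono_eq_iff[OF assms(1)])
  then show ?thesis using assms by simp
qed

lemma keys_frob_form:
  "Poly_Mapping.keys (frob_form n q M) \<subseteq> (\<lambda>(i, j). frob_mono q i j) ` ({..<n} \<times> {..<n})"
proof
  fix m assume "m \<in> Poly_Mapping.keys (frob_form n q M)"
  then have "(\<Sum>i<n. \<Sum>j<n. Poly_Mapping.lookup (Poly_Mapping.single (frob_mono q i j) (M $$ (i, j))) m) \<noteq> 0"
    by (simp add: in_keys_iff frob_form_def lookup_sum)
  then obtain i where "i \<in> {..<n}"
      "(\<Sum>j<n. Poly_Mapping.lookup (Poly_Mapping.single (frob_mono q i j) (M $$ (i, j))) m) \<noteq> 0"
    by (rule sum.not_neutral_contains_not_neutral)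
  moreover from this(2) obtain j where "j \<in> {..<n}"
      "Poly_Mapping.lookup (Poly_Mapping.single (frob_mono q i j) (M $$ (i, j))) m \<noteq> 0"
    by (rule sum.not_neutral_contains_not_neutral)
  ultimately show "m \<in> (\<lambda>(i, j). frob_mono q i j) ` ({..<n} \<times> {..<n})"
    by (auto simp: lookup_single split: if_splits)
qed

lemma keys_frob_formE:
  assumes "q > 1" "m \<in> Poly_Mapping.keys (frob_form n q M)"
  obtains i j where "i < n" "j < n" "m = frob_mono q i j" "M $$ (i, j) \<noteq> 0"
proof -
  have "m \<in> (\<lambda>(i, j). frob_mono q i j) ` ({..<n} \<times> {..<n})"
    using assms(2) keys_frob_form by (rule rev_subsetD)
  then obtain i j where ij: "i < n" "j < n" "m = frob_mono q i j" by auto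
  moreover have "M $$ (i, j) \<noteq> 0"
    using assms(2) lookup_frob_form[OF assms(1) ij(1,2), of M] by (simp add: in_keys_iff ij(3))
  ultimately show ?thesis using that by blast
qed

text \<open>
  Evaluation, substitution and differentiation are all sums over the support of this shape. The condition on \<open>G\<close> allows zero
  coefficients, which do not occur in the support.
\<close>

lemma sum_keys_frob_form:
  assumes q: "q > 1" and G: "\<And>m. G m 0 = 0"
  shows "(\<Sum>m\<in>Poly_Mapping.keys (frob_form n q M). G m (Poly_Mapping.lookup (frob_form n q M) m))
    = (\<Sum>i<n. \<Sum>j<n. G (frob_mono q i j) (M $$ (i, j)))"
proof -
  have inj: "inj_on (\<lambda>(i, j). frob_mono q i j) ({..<n} \<times> {..<n})"
    by (auto simp: inj_on_def frob_mono_eq_iff[OF q])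
  have "(\<Sum>m\<in>Poly_Mapping.keys (frob_form n q M). G m (Poly_Mapping.lookup (frob_form n q M) m))
      = (\<Sum>m\<in>(\<lambda>(i, j). frob_mono q i j) ` ({..<n} \<times> {..<n}). G m (Poly_Mapping.lookup (frob_form n q M) m))"
    using keys_frob_form[of n q M] by (intro sum.mono_neutral_left) (auto simp: in_keys_iff G)
  also have "\<dots> = (\<Sum>(i, j)\<in>{..<n} \<times> {..<n}. G (frob_mono q i j) (M $$ (i, j)))"
    by (subst sum.reindex[OF inj]) (auto intro!: sum.cong simp: lookup_frob_form[OF q])
  also have "\<dots> = (\<Sum>i<n. \<Sum>j<n. G (frob_mono q i j) (M $$ (i, j)))"
    by (simp add: sum.cartesian_product)
  finally show ?thesis .
qed

lemma frob_form_inj: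
  assumes "q > 1" "M \<in> carrier_mat n n" "M' \<in> carrier_mat n n" "frob_form n q M = frob_form n q M'"
  shows "M = M'"
proof (rule eq_matI)
  fix i j assume "i < dim_row M'" "j < dim_col M'"
  then show "M $$ (i, j) = M' $$ (i, j)"
    using lookup_frob_form[OF assms(1), of i n j M] lookup_frob_form[OF assms(1), of i n j M'] assms by simp
qed (use assms in auto)

lemma prod_frob_mono:
  "(\<Prod>k\<in>Poly_Mapping.keys (frob_mono q i j). s k ^ Poly_Mapping.lookup (frob_mono q i j) k)
    = s i ^ q * (s j :: 'b::comm_semiring_1)"
proof -
  have "(\<Prod>k\<in>Poly_Mapping.keys (frob_mono q i j). s k ^ Poly_Mapping.lookup (frob_mono q i j) k)
      = (\<Prod>k\<in>{i, j}. s k ^ Poly_Mapping.lookup (frob_mono q i j) k)"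
    by (intro prod.mono_neutral_left) (auto simp: in_keys_iff lookup_frob_mono split: if_splits)
  also have "\<dots> = s i ^ q * s j"
    by (cases "i = j") (simp_all add: lookup_frob_mono mult.commute)
  finally show ?thesis .
qed

lemma power_single_var:
  "(Poly_Mapping.single (Poly_Mapping.single i 1) c :: 'k::comm_ring_1 mpoly) ^ k
    = Poly_Mapping.single (Poly_Mapping.single i k) (c ^ k)"
proof (induction k)
  case (Suc k)
  have "Poly_Mapping.single i 1 + Poly_Mapping.single i k = Poly_Mapping.single i (Suc k)"
    by (simp add: single_add[symmetric])
  then show ?case by (simp add: Suc mult_single del: One_nat_def)
qed simp

lemma mvar_power: "(mvar i :: 'k::comm_ring_1 mpoly) ^ k = Poly_Mapping.single (Poly_Mapping.single i k) 1"
  unfolding mvar_def power_single_var by simp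

lemma single_sum: "Poly_Mapping.single m (\<Sum>i\<in>A. f i) = (\<Sum>i\<in>A. Poly_Mapping.single m (f i))"
  by (induction A rule: infinite_finite_induct) (auto simp: single_add)

lemma frob_form_in_frobenius_forms:
  assumes q: "q > 1"
  shows "frob_form n q M \<in> frobenius_forms n q"
proof -
  have key: "\<exists>i<n. \<exists>j<n. m = frob_mono q i j" if "m \<in> Poly_Mapping.keys (frob_form n q M)" for m
    using keys_frob_formE[OF q that] by metis
  have "mvars (frob_form n q M) \<subseteq> {..<n}"
    unfolding mvars_def using key
    by (force simp: in_keys_iff lookup_frob_mono split: if_splits)
  then have "frob_form n q M \<in> forms n (q + 1)"
    using key mdegree_frob_mono by (fastforce simp: forms_def mpolys_def)
  moreover have "frob_form n q M \<in> frobenius_ideal n q"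
  proof -
    define h :: "nat \<Rightarrow> 'a mpoly" where
      "h i = (\<Sum>j<n. Poly_Mapping.single (Poly_Mapping.single j 1) (M $$ (i, j)))" for i
    have "mvars (h i) \<subseteq> {..<n}" for i
    proof
      fix v assume "v \<in> mvars (h i)"
      then obtain m where m: "m \<in> Poly_Mapping.keys (h i)" "v \<in> Poly_Mapping.keys m"
        by (auto simp: mvars_def)
      then have "(\<Sum>j<n. Poly_Mapping.lookup (Poly_Mapping.single (Poly_Mapping.single j 1) (M $$ (i, j))) m) \<noteq> 0"
        by (simp add: in_keys_iff h_def lookup_sum)
      then obtain j where "j \<in> {..<n}"
          "Poly_Mapping.lookup (Poly_Mapping.single (Poly_Mapping.single j 1) (M $$ (i, j))) m \<noteq> 0"
        by (rule sum.not_neutral_contains_not_neutral)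
      then show "v \<in> {..<n}" using m(2) by (auto simp: lookup_single split: if_splits)
    qed
    moreover have "frob_form n q M = (\<Sum>i<n. h i * mvar i ^ q)"
      unfolding frob_form_def h_def sum_distrib_right
      by (intro sum.cong refl) (simp add: mvar_power mult_single frob_mono_def add.commute)
    ultimately show ?thesis by (auto simp: frobenius_ideal_def mpolys_def)
  qed
  ultimately show ?thesis by (simp add: frobenius_forms_def)
qed

text \<open>
  A monomial of degree \<open>q + 1\<close> in the ideal is divisible by some \<open>x\<^sub>i\<^sup>q\<close>, and the cofactor has degree one.
\<close>

lemma frobenius_forms_eq:
  assumes q: "q > 1"
  shows "frobenius_forms n q = frob_form n q ` (carrier_mat n n :: 'k::field mat set)"
proof
  show "frob_form n q ` (carrier_mat n n :: 'k mat set) \<subseteq> frobenius_forms n q"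
    using frob_form_in_frobenius_forms[OF q] by blast
  show "frobenius_forms n q \<subseteq> frob_form n q ` (carrier_mat n n :: 'k mat set)"
  proof
    fix f :: "'k mpoly" assume f: "f \<in> frobenius_forms n q"
    obtain h where h: "f = (\<Sum>i<n. h i * mvar i ^ q)"
      using f by (auto simp: frobenius_forms_def frobenius_ideal_def)
    have key: "\<exists>i<n. \<exists>j<n. m = frob_mono q i j" if m: "m \<in> Poly_Mapping.keys f" for m
    proof -
      have "(\<Sum>i<n. Poly_Mapping.lookup (h i * mvar i ^ q) m) \<noteq> 0"
        using m by (simp add: h in_keys_iff lookup_sum)
      then obtain i where i: "i \<in> {..<n}" "Poly_Mapping.lookup (h i * mvar i ^ q) m \<noteq> 0"
        by (rule sum.not_neutral_contains_not_neutral)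
      then have "m \<in> Poly_Mapping.keys (h i * mvar i ^ q)" by (simp add: in_keys_iff)
      then obtain a b where ab: "m = a + b" "b \<in> Poly_Mapping.keys (mvar i ^ q :: 'k mpoly)"
        using keys_mult[of "h i" "mvar i ^ q"] by blast
      then have b: "b = Poly_Mapping.single i q" by (simp add: mvar_power)
      have "mdegree m = q + 1" using f m by (auto simp: frobenius_forms_def forms_def)
      then have "mdegree a = 1" by (simp add: ab(1) b mdegree_add mdegree_single)
      then obtain j where j: "a = Poly_Mapping.single j 1" by (rule mdegree_eq_1D)
      have mij: "m = frob_mono q i j" by (simp add: ab(1) b j frob_mono_def add.commute)
      have "j \<in> Poly_Mapping.keys m" by (simp add: in_keys_iff mij lookup_frob_mono)
      then have "j < n" using f m by (auto simp: frobenius_forms_def forms_def mpolys_def mvars_def)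
      then show ?thesis using i mij by blast
    qed
    define M where "M = mat n n (\<lambda>(i, j). Poly_Mapping.lookup f (frob_mono q i j))"
    have "f = frob_form n q M"
    proof (rule poly_mapping_eqI)
      fix m
      show "Poly_Mapping.lookup f m = Poly_Mapping.lookup (frob_form n q M) m"
      proof (cases "\<exists>i<n. \<exists>j<n. m = frob_mono q i j")
        case True
        then show ?thesis by (auto simp: lookup_frob_form[OF q] M_def)
      next
        case False
        then have "m \<notin> Poly_Mapping.keys f" "m \<notin> Poly_Mapping.keys (frob_form n q M)"
          using key keys_frob_formE[OF q, of m n M] by metis+
        then show ?thesis by (simp add: in_keys_iff)
      qed
    qed
    moreover have "M \<in> carrier_mat n n" by (simp add: M_def)
    ultimately show "f \<in> frob_form n q ` carrier_mat n n" by blast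
  qed
qed

lemma mvars_frob_form:
  assumes q: "q > 1"
  shows "mvars (frob_form n q M) = {k. k < n \<and> (\<exists>j<n. M $$ (k, j) \<noteq> 0 \<or> M $$ (j, k) \<noteq> 0)}"
    (is "_ = ?R")
proof
  show "mvars (frob_form n q M) \<subseteq> ?R"
  proof
    fix k assume "k \<in> mvars (frob_form n q M)"
    then obtain m where m: "m \<in> Poly_Mapping.keys (frob_form n q M)" "k \<in> Poly_Mapping.keys m"
      by (auto simp: mvars_def)
    then obtain i j where "i < n" "j < n" "m = frob_mono q i j" "M $$ (i, j) \<noteq> 0"
      using keys_frob_formE[OF q] by metis
    then show "k \<in> ?R" using m(2) by (auto simp: in_keys_iff lookup_frob_mono split: if_splits)
  qed
  have keysI: "frob_mono q i j \<in> Poly_Mapping.keys (frob_form n q M)"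
    if "i < n" "j < n" "M $$ (i, j) \<noteq> 0" for i j
    using that lookup_frob_form[OF q, of i n j M] by (simp add: in_keys_iff)
  have 1: "i \<in> Poly_Mapping.keys (frob_mono q i j)" "j \<in> Poly_Mapping.keys (frob_mono q i j)" for i j
    using q by (auto simp: in_keys_iff lookup_frob_mono)
  show "?R \<subseteq> mvars (frob_form n q M)"
  proof
    fix k assume "k \<in> ?R"
    then obtain j where "k < n" "j < n" "M $$ (k, j) \<noteq> 0 \<or> M $$ (j, k) \<noteq> 0" by blast
    then show "k \<in> mvars (frob_form n q M)"
      using keysI[of k j] keysI[of j k] 1(1)[of k j] 1(2)[of k j] unfolding mvars_def by blast
  qed
qed

definition frob_transform :: "nat \<Rightarrow> nat \<Rightarrow> 'k::field mat \<Rightarrow> 'k mat \<Rightarrow> 'k mat" where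
  "frob_transform n q A M = mat n n (\<lambda>(k, l). \<Sum>i<n. \<Sum>j<n. A $$ (i, k) ^ q * M $$ (i, j) * A $$ (j, l))"

lemma frob_congruent_transform:
  assumes "M' \<in> carrier_mat n n"
  shows "frob_congruent n q M M' \<longleftrightarrow> (\<exists>A\<in>GL_mat n. M' = frob_transform n q A M)"
proof -
  have "M' = frob_transform n q A M \<longleftrightarrow> (\<forall>i<n. \<forall>j<n.
     M' $$ (i, j) = (\<Sum>k<n. \<Sum>l<n. A $$ (k, i) ^ q * M $$ (k, l) * A $$ (l, j)))" for A
    using assms by (auto simp: frob_transform_def mat_eq_iff)
  then show ?thesis unfolding frob_congruent_def by simp
qed

text \<open>
  The freshman's dream is needed for linear forms, that is, in the polynomial ring.
\<close>

lemma CHAR_mpoly: "CHAR('k::comm_ring_1 mpoly) = CHAR('k)"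
proof (rule CHAR_eqI)
  show "of_nat CHAR('k) = (0 :: 'k mpoly)" by (simp only: single_of_nat[symmetric] of_nat_CHAR single_zero)
  fix k assume "of_nat k = (0 :: 'k mpoly)"
  then have "Poly_Mapping.lookup (of_nat k :: 'k mpoly) 0 = 0" by simp
  then have "of_nat k = (0 :: 'k)" by (simp add: lookup_of_nat)
  then show "CHAR('k) dvd k" by (simp add: of_nat_eq_0_iff_char_dvd)
qed

lemma diagonal_form_eq: "diagonal_form n (q + 1) = frob_form n q (1\<^sub>m n :: 'k::field mat)"
proof -
  have "(\<Sum>j<n. Poly_Mapping.single (frob_mono q i j) (1\<^sub>m n $$ (i, j))) = (mvar i ^ (q + 1) :: 'k mpoly)"
    if "i < n" for i
  proof -
    have "(\<Sum>j<n. Poly_Mapping.single (frob_mono q i j) (1\<^sub>m n $$ (i, j)))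
        = (\<Sum>j<n. if j = i then Poly_Mapping.single (frob_mono q i i) (1 :: 'k) else 0)"
      using that by (intro sum.cong) auto
    also have "\<dots> = Poly_Mapping.single (frob_mono q i i) 1" using that by simp
    also have "frob_mono q i i = Poly_Mapping.single i (q + 1)"
      by (simp only: frob_mono_def single_add)
    also have "Poly_Mapping.single (Poly_Mapping.single i (q + 1)) (1 :: 'k) = mvar i ^ (q + 1)"
      by (rule mvar_power[symmetric])
    finally show ?thesis .
  qed
  then show ?thesis unfolding diagonal_form_def frob_form_def by simp
qed

lemma sum_swap_pairs:
  fixes F :: "nat \<Rightarrow> nat \<Rightarrow> nat \<Rightarrow> nat \<Rightarrow> 'a::comm_monoid_add"
  shows "(\<Sum>i<n. \<Sum>j<n. \<Sum>k<n. \<Sum>l<n. F i j k l) = (\<Sum>k<n. \<Sum>l<n. \<Sum>i<n. \<Sum>j<n. F i j k l)"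
proof -
  have "(\<Sum>i<n. \<Sum>j<n. \<Sum>k<n. \<Sum>l<n. F i j k l) = (\<Sum>i<n. \<Sum>k<n. \<Sum>j<n. \<Sum>l<n. F i j k l)"
    by (intro sum.cong refl sum.swap)
  also have "\<dots> = (\<Sum>k<n. \<Sum>i<n. \<Sum>j<n. \<Sum>l<n. F i j k l)" by (rule sum.swap)
  also have "\<dots> = (\<Sum>k<n. \<Sum>i<n. \<Sum>l<n. \<Sum>j<n. F i j k l)" by (intro sum.cong refl sum.swap)
  also have "\<dots> = (\<Sum>k<n. \<Sum>l<n. \<Sum>i<n. \<Sum>j<n. F i j k l)" by (intro sum.cong refl sum.swap)
  finally show ?thesis .
qed

context frobenius_field
begin

lemma lin_change_frob_form:
  fixes M A :: "'k mat"
  shows "lin_change n A (frob_form n q M) = frob_form n q (frob_transform n q A M)"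
proof -
  define \<sigma> :: "nat \<Rightarrow> 'k mpoly" where "\<sigma> i = (\<Sum>j<n. mconst (A $$ (i, j)) * mvar j)" for i
  have lin: "mconst c * mvar j = (Poly_Mapping.single (Poly_Mapping.single j 1) c :: 'k mpoly)" for c j
    by (simp add: mconst_def mvar_def mult_single)
  have pw: "\<sigma> i ^ q = (\<Sum>k<n. Poly_Mapping.single (Poly_Mapping.single k q) (A $$ (i, k) ^ q))" for i
  proof -
    have "\<sigma> i ^ q = (\<Sum>k<n. (mconst (A $$ (i, k)) * mvar k) ^ q)"
      unfolding \<sigma>_def
      by (rule freshmans_dream_sum'[where n=e]) (simp_all add: CHAR_mpoly prime_char q_def)
    then show ?thesis by (simp only: lin power_single_var)
  qed
  have "lin_change n A (frob_form n q M) = (\<Sum>i<n. \<Sum>j<n. mconst (M $$ (i, j)) * (\<sigma> i ^ q * \<sigma> j))"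
    unfolding lin_change_def msubst_def \<sigma>_def[symmetric]
    by (subst sum_keys_frob_form[OF q_gt_1, where
          G="\<lambda>m c. mconst c * (\<Prod>i\<in>Poly_Mapping.keys m. \<sigma> i ^ Poly_Mapping.lookup m i)"])
      (simp_all add: mconst_def prod_frob_mono)
  also have "\<dots> = (\<Sum>i<n. \<Sum>j<n. \<Sum>k<n. \<Sum>l<n.
      Poly_Mapping.single (frob_mono q k l) (A $$ (i, k) ^ q * M $$ (i, j) * A $$ (j, l)))"
  proof (intro sum.cong refl)
    fix i j
    have "\<sigma> i ^ q * \<sigma> j = (\<Sum>k<n. \<Sum>l<n.
        Poly_Mapping.single (frob_mono q k l) (A $$ (i, k) ^ q * A $$ (j, l)))"
      unfolding pw unfolding \<sigma>_def lin sum_product by (simp add: mult_single frob_mono_def)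
    then show "mconst (M $$ (i, j)) * (\<sigma> i ^ q * \<sigma> j) = (\<Sum>k<n. \<Sum>l<n.
        Poly_Mapping.single (frob_mono q k l) (A $$ (i, k) ^ q * M $$ (i, j) * A $$ (j, l)))"
      by (simp add: mconst_def sum_distrib_left mult_single mult_ac)
  qed
  also have "\<dots> = (\<Sum>k<n. \<Sum>l<n. \<Sum>i<n. \<Sum>j<n.
      Poly_Mapping.single (frob_mono q k l) (A $$ (i, k) ^ q * M $$ (i, j) * A $$ (j, l)))"
    by (rule sum_swap_pairs)
  also have "\<dots> = frob_form n q (frob_transform n q A M)"
    unfolding frob_form_def by (intro sum.cong refl) (simp add: frob_transform_def single_sum)
  finally show ?thesis .
qed

text \<open>
  A variable is absent from the transformed form iff the corresponding column of the coordinate change lies in both radicals. Conversely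
  a nonzero vector in both radicals can be made a column of an invertible matrix.
\<close>

lemma nondegenerate_frob_form:
  "nondegenerate n (frob_form n q M) \<longleftrightarrow> fp.nondegenerate_on n M (V n)"
proof -
  have card_less: "card (mvars (frob_form n q M')) < n
      \<longleftrightarrow> (\<exists>i<n. \<forall>j<n. M' $$ (i, j) = 0 \<and> M' $$ (j, i) = 0)" (is "?l \<longleftrightarrow> ?r") for M' :: "'k mat"
  proof -
    have sub: "mvars (frob_form n q M') \<subseteq> {..<n}" by (auto simp: mvars_frob_form[OF q_gt_1])
    have "?l \<longleftrightarrow> mvars (frob_form n q M') \<noteq> {..<n}"
      using sub psubset_card_mono[of "{..<n}" "mvars (frob_form n q M')"]
      by (metis card_lessThan finite_lessThan less_irrefl psubsetI)
    also have "\<dots> \<longleftrightarrow> ?r" using sub by (auto simp: mvars_frob_form[OF q_gt_1])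
    finally show ?thesis .
  qed
  have "(\<exists>A\<in>GL_mat n. card (mvars (lin_change n A (frob_form n q M))) < n) \<longleftrightarrow> \<not> fp.nondegenerate_on n M (V n)"
  proof
    assume "\<exists>A\<in>GL_mat n. card (mvars (lin_change n A (frob_form n q M))) < n"
    then obtain A i where A: "A \<in> GL_mat n" and i: "i < n"
      and z: "\<And>j. j < n \<Longrightarrow> frob_transform n q A M $$ (i, j) = 0 \<and> frob_transform n q A M $$ (j, i) = 0"
      unfolding lin_change_frob_form card_less by blast
    define b where "b j = mat_apply n A (unit_fun j)" for j
    have b: "fs.fam_basis {..<n} b (V n)" unfolding b_def by (rule fam_basis_columns[OF A])
    have Bb: "Bf n M (b i) (b j) = 0" "Bf n M (b j) (b i) = 0" if "j < n" for j
      using z[OF that] that i by (simp_all add: b_def sesq_mat_apply_unit frob_transform_def)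
    have "Bf n M x (b i) = 0 \<and> Bf n M (b i) x = 0" if x: "x \<in> V n" for x
    proof -
      obtain \<alpha> where "x = (\<Sum>j<n. fscale (\<alpha> j) (b j))" using fs.fam_basis_expand[OF b x] by blast
      then show ?thesis using Bb by (simp add: fp.B_simps)
    qed
    moreover have "b i \<noteq> 0"
      using fs.indep_mod_set(2)[OF fs.rel_basisD(1,3)[OF b]] i
      by (metis fs.dependent_zero image_eqI lessThan_iff)
    moreover have "b i \<in> V n" using fs.rel_basisD(2)[OF b] i by simp
    ultimately show "\<not> fp.nondegenerate_on n M (V n)" unfolding fp.nondegenerate_on_def by blast
  next
    assume "\<not> fp.nondegenerate_on n M (V n)"
    then obtain v where v: "v \<in> V n" "v \<noteq> 0" "\<And>x. x \<in> V n \<Longrightarrow> Bf n M x v = 0 \<and> Bf n M v x = 0"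
      unfolding fp.nondegenerate_on_def by blast
    have ind: "fs.indep_mod {0} {()} (\<lambda>_. v)" using v(2) by (simp add: fs.indep_mod_def)
    have sp: "V n \<subseteq> fs.span ({0} \<union> (\<lambda>_. v) ` {()} \<union> V n)" using fs.span_superset by blast
    have sub: "{0} \<subseteq> V n" using fs.subspace_0[OF subspace_coord_space] by simp
    have im: "(\<lambda>_. v) ` {()} \<subseteq> V n" using v(1) by simp
    have fin1: "finite {()}" by simp
    obtain J where J: "fs.fam_basis (J <+> {()}) (case_sum id (\<lambda>_. v)) (V n)"
      by (rule fs.rel_basis_extend[OF subspace_coord_space fin_dim_coord_space fs.subspace_single_0 sub
            fin1 ind im subset_refl sp])
    have fin: "finite (J <+> {()})" using fs.rel_basisD(1)[OF J] .
    have "card (J <+> {()}) = n" using fs.fam_basis_card[OF J subspace_coord_space] dim_coord_space by metis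
    then obtain g where g: "bij_betw g {..<n} (J <+> {()})"
      using ex_bij_betw_nat_finite[OF fin] by (auto simp: atLeast0LessThan)
    from fs.rel_basis_reindex[OF J g]
    have b: "fs.fam_basis {..<n} (case_sum id (\<lambda>_. v) \<circ> g) (V n)" (is "fs.fam_basis _ ?b _") .
    have "Inr () \<in> g ` {..<n}" using g by (auto simp: bij_betw_def)
    then obtain i where i: "i < n" "g i = Inr ()" by auto
    obtain A where A: "A \<in> GL_mat n" "\<And>j. j < n \<Longrightarrow> mat_apply n A (unit_fun j) = ?b j"
      using fam_basis_columnsE[OF b] by blast
    have "frob_transform n q A M $$ (i, j) = 0 \<and> frob_transform n q A M $$ (j, i) = 0" if j: "j < n" for j
    proof -
      have "?b i = v" using i by simp
      moreover have "?b j \<in> V n" using fs.rel_basisD(2)[OF b] j by blast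
      ultimately have "Bf n M (?b i) (?b j) = 0 \<and> Bf n M (?b j) (?b i) = 0" using v(3) by metis
      then show ?thesis
        using sesq_mat_apply_unit[OF i(1) j, of M A] sesq_mat_apply_unit[OF j i(1), of M A]
          A(2)[OF j] A(2)[OF i(1)] i(1) j
        by (simp add: frob_transform_def)
    qed
    then show "\<exists>A\<in>GL_mat n. card (mvars (lin_change n A (frob_form n q M))) < n"
      unfolding lin_change_frob_form card_less using A(1) i(1) by blast
  qed
  then show ?thesis unfolding nondegenerate_def by simp
qed

text \<open>
  The partial derivative with respect to \<open>x\<^sub>k\<close> is \<open>\<Sum>\<^sub>i M\<^sub>i\<^sub>k x\<^sub>i\<^sup>q\<close>, because the derivative of the \<open>q\<close>-th powers vanishes. So a common zero of
  the partial derivatives is a vector in the left radical, and there the form itself vanishes too.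
\<close>

lemma isolated_singularity_frob_form:
  fixes M :: "'k mat"
  shows "isolated_singularity n (frob_form n q M) \<longleftrightarrow> (\<forall>x\<in>V n. (\<forall>y\<in>V n. Bf n M x y = 0) \<longrightarrow> x = 0)"
proof -
  have q0: "q > 0" using q_gt_1 by simp
  have ev: "meval v (frob_form n q M) = (\<Sum>i<n. \<Sum>j<n. M $$ (i, j) * ((v $ i) ^ q * v $ j))" for v :: "'k vec"
    unfolding meval_def
    by (subst sum_keys_frob_form[OF q_gt_1, where
          G="\<lambda>m c. c * (\<Prod>i\<in>Poly_Mapping.keys m. (v $ i) ^ Poly_Mapping.lookup m i)"])
      (simp_all add: prod_frob_mono)
  have der: "mderiv k (frob_form n q M) = (\<Sum>i<n. Poly_Mapping.single (Poly_Mapping.single i q) (M $$ (i, k)))"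
    if k: "k < n" for k
  proof -
    have "mderiv k (frob_form n q M) = (\<Sum>i<n. \<Sum>j<n. Poly_Mapping.single (frob_mono q i j - Poly_Mapping.single k 1)
        (of_nat (Poly_Mapping.lookup (frob_mono q i j) k) * M $$ (i, j)))"
      unfolding mderiv_def
      by (subst sum_keys_frob_form[OF q_gt_1, where
          G="\<lambda>m c. Poly_Mapping.single (m - Poly_Mapping.single k 1) (of_nat (Poly_Mapping.lookup m k) * c)"]) simp_all
    also have "\<dots> = (\<Sum>i<n. \<Sum>j<n. if j = k then Poly_Mapping.single (Poly_Mapping.single i q) (M $$ (i, j)) else 0)"
    proof (intro sum.cong refl)
      fix i j
      have "(of_nat (Poly_Mapping.lookup (frob_mono q i j) k) :: 'k) = of_bool (j = k)"
        by (simp add: lookup_frob_mono of_nat_q)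
      moreover have "frob_mono q i k - Poly_Mapping.single k 1 = Poly_Mapping.single i q"
        by (simp add: frob_mono_def)
      ultimately show "Poly_Mapping.single (frob_mono q i j - Poly_Mapping.single k 1)
          (of_nat (Poly_Mapping.lookup (frob_mono q i j) k) * M $$ (i, j))
        = (if j = k then Poly_Mapping.single (Poly_Mapping.single i q) (M $$ (i, j)) else 0)"
        by (cases "j = k") simp_all
    qed
    finally show ?thesis using k by simp
  qed
  have evder: "meval v (mderiv k (frob_form n q M)) = (\<Sum>i<n. (v $ i) ^ q * M $$ (i, k))"
    if k: "k < n" for v :: "'k vec" and k
  proof -
    define g where "g = mderiv k (frob_form n q M)"
    have inj: "inj_on (\<lambda>i. Poly_Mapping.single i q) {..<n}"
    proof (rule inj_onI)
      fix i j assume "Poly_Mapping.single i q = Poly_Mapping.single j q"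
      then have "Poly_Mapping.lookup (Poly_Mapping.single i q) i = Poly_Mapping.lookup (Poly_Mapping.single j q) i" by simp
      then show "i = j" using q0 by (auto simp: lookup_single when_def split: if_splits)
    qed
    have lk: "Poly_Mapping.lookup g (Poly_Mapping.single i q) = M $$ (i, k)" if "i < n" for i
    proof -
      have "Poly_Mapping.lookup g (Poly_Mapping.single i q) = (\<Sum>a<n. if a = i then M $$ (a, k) else 0)"
        unfolding g_def der[OF k] lookup_sum
        using inj that by (intro sum.cong refl) (auto simp: lookup_single when_def inj_on_def)
      then show ?thesis using that by simp
    qed
    have keys: "Poly_Mapping.keys g \<subseteq> (\<lambda>i. Poly_Mapping.single i q) ` {..<n}"
    proof
      fix m assume "m \<in> Poly_Mapping.keys g"
      then have "(\<Sum>i<n. Poly_Mapping.lookup (Poly_Mapping.single (Poly_Mapping.single i q) (M $$ (i, k))) m) \<noteq> 0"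
        by (simp add: in_keys_iff g_def der[OF k] lookup_sum)
      then obtain i where "i \<in> {..<n}"
          "Poly_Mapping.lookup (Poly_Mapping.single (Poly_Mapping.single i q) (M $$ (i, k))) m \<noteq> 0"
        by (rule sum.not_neutral_contains_not_neutral)
      then show "m \<in> (\<lambda>i. Poly_Mapping.single i q) ` {..<n}" by (auto simp: lookup_single split: if_splits)
    qed
    have "meval v g = (\<Sum>m\<in>(\<lambda>i. Poly_Mapping.single i q) ` {..<n}. Poly_Mapping.lookup g m *
        (\<Prod>i\<in>Poly_Mapping.keys m. (v $ i) ^ Poly_Mapping.lookup m i))"
      unfolding meval_def using keys by (intro sum.mono_neutral_left) (auto simp: in_keys_iff)
    also have "\<dots> = (\<Sum>i<n. (v $ i) ^ q * M $$ (i, k))"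
      using q0 by (subst sum.reindex[OF inj]) (auto intro!: sum.cong simp: lk mult.commute)
    finally show ?thesis by (simp add: g_def)
  qed
  have sing: "singular_locus n (frob_form n q M)
      = {v \<in> carrier_vec n. \<forall>k<n. (\<Sum>i<n. (v $ i) ^ q * M $$ (i, k)) = 0}"
  proof -
    have "meval v (frob_form n q M) = 0" if "\<forall>k<n. (\<Sum>i<n. (v $ i) ^ q * M $$ (i, k)) = 0" for v :: "'k vec"
    proof -
      have "meval v (frob_form n q M) = (\<Sum>j<n. v $ j * (\<Sum>i<n. (v $ i) ^ q * M $$ (i, j)))"
        unfolding ev by (subst sum.swap) (simp add: sum_distrib_left mult_ac)
      then show ?thesis using that by simp
    qed
    then show ?thesis unfolding singular_locus_def by (auto simp: evder)
  qed
  have left: "(\<forall>y\<in>V n. Bf n M x y = 0) \<longleftrightarrow> (\<forall>k<n. (\<Sum>i<n. x i ^ q * M $$ (i, k)) = 0)" for x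
  proof -
    have e: "Bf n M x y = (\<Sum>k<n. (\<Sum>i<n. x i ^ q * M $$ (i, k)) * y k)" for y
      unfolding sesq_def by (subst sum.swap) (simp add: sum_distrib_right)
    show ?thesis
    proof (intro iffI allI impI ballI)
      fix k assume *: "\<forall>y\<in>V n. Bf n M x y = 0" and k: "k < n"
      have "Bf n M x (unit_fun k) = (\<Sum>l<n. if l = k then (\<Sum>i<n. x i ^ q * M $$ (i, l)) else 0)"
        unfolding e by (intro sum.cong) (auto simp: unit_fun_def)
      moreover have "Bf n M x (unit_fun k) = 0" using * unit_fun_in[OF k] by blast
      ultimately show "(\<Sum>i<n. x i ^ q * M $$ (i, k)) = 0" using k by simp
    qed (simp add: e)
  qed
  have z: "0\<^sub>v n \<in> singular_locus n (frob_form n q M)"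
    using q0 by (simp add: sing zero_power)
  show ?thesis
    unfolding isolated_singularity_def left
  proof
    assume L: "singular_locus n (frob_form n q M) = {0\<^sub>v n}"
    show "\<forall>x\<in>V n. (\<forall>k<n. (\<Sum>i<n. x i ^ q * M $$ (i, k)) = 0) \<longrightarrow> x = 0"
    proof (intro ballI impI)
      fix x assume x: "x \<in> V n" "\<forall>k<n. (\<Sum>i<n. x i ^ q * M $$ (i, k)) = 0"
      then have "vec n x \<in> singular_locus n (frob_form n q M)" by (simp add: sing)
      then have eq: "vec n x = 0\<^sub>v n" using L by simp
      show "x = 0"
      proof
        fix i
        have "x i = vec n x $ i" if "i < n" using that by simp
        then show "x i = 0 i" using x(1) eq by (cases "i < n") (auto simp: coord_space_def)
      qed
    qed
  next
    assume R: "\<forall>x\<in>V n. (\<forall>k<n. (\<Sum>i<n. x i ^ q * M $$ (i, k)) = 0) \<longrightarrow> x = 0"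
    have "v = 0\<^sub>v n" if v: "v \<in> singular_locus n (frob_form n q M)" for v
    proof -
      define x where "x i = (if i < n then v $ i else 0)" for i
      have "x \<in> V n" "\<forall>k<n. (\<Sum>i<n. x i ^ q * M $$ (i, k)) = 0"
        using v by (auto simp: x_def coord_space_def sing)
      then have "x = 0" using R by blast
      have "v $ i = 0" if "i < n" for i
      proof -
        have "v $ i = x i" using that by (simp add: x_def)
        then show ?thesis using \<open>x = 0\<close> by simp
      qed
      then show ?thesis using v by (intro eq_vecI) (auto simp: sing)
    qed
    then show "singular_locus n (frob_form n q M) = {0\<^sub>v n}" using z by blast
  qed
qed

lemma proj_equiv_frob_form:
  fixes M :: "'k mat"
  shows "proj_equiv n (q + 1) `` {frob_form n q M}
    = frob_form n q ` {M' \<in> carrier_mat n n. frob_congruent n q M M'}"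
proof -
  have "frob_form n q M' \<in> forms n (q + 1)" for M' :: "'k mat"
    using frob_form_in_frobenius_forms[OF q_gt_1, of n M'] by (simp add: frobenius_forms_def)
  then have "proj_equiv n (q + 1) `` {frob_form n q M} = (\<lambda>A. frob_form n q (frob_transform n q A M)) ` GL_mat n"
    unfolding proj_equiv_def by (auto simp: lin_change_frob_form)
  also have "\<dots> = frob_form n q ` {M' \<in> carrier_mat n n. frob_congruent n q M M'}"
    using frob_congruent_transform[of _ n q M] by (force simp: frob_transform_def)
  finally show ?thesis .
qed

text \<open>
  These sets turn out to be the equivalence classes, and \<open>P \<mapsto> forms_of_type n P\<close> is the inverse of the required bijection.
\<close>

definition forms_of_type :: "nat \<Rightarrow> nat multiset \<Rightarrow> 'k mpoly set" where
  "forms_of_type n P = frob_form n q ` {M \<in> carrier_mat n n. has_type n M P}"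

lemma proj_equiv_eq_forms_of_type:
  assumes "has_type n M P"
  shows "proj_equiv n (q + 1) `` {frob_form n q M} = forms_of_type n P"
proof -
  have "frob_congruent n q M M' \<longleftrightarrow> has_type n M' P" for M'
    using assms has_type_congruent has_type_imp_congruent by blast
  then show ?thesis unfolding proj_equiv_frob_form forms_of_type_def by simp
qed

lemma nondeg_frobenius_forms_eq:
  "nondeg_frobenius_forms n q = frob_form n q ` {M \<in> carrier_mat n n. fp.nondegenerate_on n M (V n)}"
  unfolding nondeg_frobenius_forms_def frobenius_forms_eq[OF q_gt_1]
  by (auto simp: nondegenerate_frob_form)

lemma frobenius_classes_eq: "frobenius_classes n q = forms_of_type n ` integer_partitions n"
proof
  show "frobenius_classes n q \<subseteq> forms_of_type n ` integer_partitions n"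
  proof
    fix C :: "'k mpoly set" assume "C \<in> frobenius_classes n q"
    then obtain M where "fp.nondegenerate_on n M (V n)" and C: "C = proj_equiv n (q + 1) `` {frob_form n q M}"
      unfolding frobenius_classes_def nondeg_frobenius_forms_eq quotient_def by blast
    then obtain P where "has_type n M P" using has_type_exists by blast
    then show "C \<in> forms_of_type n ` integer_partitions n"
      using C proj_equiv_eq_forms_of_type has_type_partition by blast
  qed
  show "forms_of_type n ` integer_partitions n \<subseteq> frobenius_classes n q"
  proof
    fix C :: "'k mpoly set" assume "C \<in> forms_of_type n ` integer_partitions n"
    then obtain P where P: "P \<in> integer_partitions n" "C = forms_of_type n P" by blast
    obtain M where M: "M \<in> carrier_mat n n" "has_type n M P" using has_type_realize[OF P(1)] .
    then show "C \<in> frobenius_classes n q"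
      unfolding frobenius_classes_def nondeg_frobenius_forms_eq P(2) proj_equiv_eq_forms_of_type[OF M(2), symmetric]
      using has_type_nondegenerate by (intro quotientI) blast
  qed
qed

lemma forms_of_type_bij: "bij_betw (forms_of_type n) (integer_partitions n) (frobenius_classes n q)"
  unfolding bij_betw_def
proof
  show "inj_on (forms_of_type n) (integer_partitions n)"
  proof (rule inj_onI)
    fix P P' assume P: "P \<in> integer_partitions n" "P' \<in> integer_partitions n" "forms_of_type n P = forms_of_type n P'"
    obtain M where M: "M \<in> carrier_mat n n" "has_type n M P" using has_type_realize[OF P(1)] .
    then have "frob_form n q M \<in> forms_of_type n P'" using P(3) by (auto simp: forms_of_type_def)
    then obtain M' where "M' \<in> carrier_mat n n" "has_type n M' P'" "frob_form n q M = frob_form n q M'"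
      by (auto simp: forms_of_type_def)
    then have "has_type n M P'" using frob_form_inj[OF q_gt_1 M(1)] by metis
    then show "P = P'" using M(2) has_type_unique by blast
  qed
qed (simp add: frobenius_classes_eq)

lemma frob_congruent_refl: "frob_congruent n q M (M :: 'k mat)"
  by (rule frob_congruent_Gram[OF fam_basis_unit]) (simp add: sesq_unit)

lemma diagonal_form_nondegenerate: "(diagonal_form n (q + 1) :: 'k mpoly) \<in> nondeg_frobenius_forms n q"
proof -
  have "\<forall>x\<in>V n. (\<forall>y\<in>V n. Bf n (1\<^sub>m n) x y = 0) \<longrightarrow> x = 0"
    unfolding left_nondegenerate_iff by (rule frob_congruent_refl)
  then have "fp.nondegenerate_on n (1\<^sub>m n) (V n)" by (simp add: fp.nondegenerate_on_def)
  then show ?thesis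
    unfolding diagonal_form_eq nondeg_frobenius_forms_eq by (intro imageI CollectI conjI) simp_all
qed

lemma isolated_iff_diagonal_class:
  assumes C: "C \<in> frobenius_classes n q" and f: "(f :: 'k mpoly) \<in> C"
  shows "isolated_singularity n f \<longleftrightarrow> C = proj_equiv n (q + 1) `` {diagonal_form n (q + 1)}"
proof -
  obtain P where P: "C = forms_of_type n P" using C unfolding frobenius_classes_eq by blast
  then obtain M where M: "M \<in> carrier_mat n n" "has_type n M P" "f = frob_form n q M"
    using f by (auto simp: forms_of_type_def)
  have CM: "C = proj_equiv n (q + 1) `` {frob_form n q M}" using P proj_equiv_eq_forms_of_type[OF M(2)] by simp
  have iso: "isolated_singularity n f \<longleftrightarrow> frob_congruent n q M (1\<^sub>m n)"
    unfolding M(3) isolated_singularity_frob_form left_nondegenerate_iff ..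
  show ?thesis
  proof
    assume "isolated_singularity n f"
    then have "has_type n (1\<^sub>m n) P" using iso has_type_congruent M(2) by blast
    then show "C = proj_equiv n (q + 1) `` {diagonal_form n (q + 1)}"
      by (simp only: P proj_equiv_eq_forms_of_type diagonal_form_eq)
  next
    assume D: "C = proj_equiv n (q + 1) `` {diagonal_form n (q + 1)}"
    then have "frob_form n q M \<in> frob_form n q ` {M' \<in> carrier_mat n n. frob_congruent n q (1\<^sub>m n) M'}"
      using f M(3) by (simp only: proj_equiv_frob_form diagonal_form_eq)
    then obtain M' where "M' \<in> carrier_mat n n" "frob_congruent n q (1\<^sub>m n) M'" "frob_form n q M = frob_form n q M'"
      by blast
    then have "frob_congruent n q (1\<^sub>m n) M" using frob_form_inj[OF q_gt_1 M(1)] by metis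
    then show "isolated_singularity n f" using iso frob_congruent_sym by blast
  qed
qed

end

section \<open>Classification of Frobenius forms\<close>

theorem theorem1p2:
  fixes p e q n :: nat
  assumes "CHAR('k::alg_closed_field) = p" and "p > 0"
    and "e > 0" and "q = p ^ e" and "n \<ge> 1"
  shows "(\<exists>\<phi>. bij_betw \<phi> (frobenius_classes n q :: 'k mpoly set set) (integer_partitions n)) \<and>
    (\<exists>!C. C \<in> (frobenius_classes n q :: 'k mpoly set set) \<and> (\<forall>f\<in>C. isolated_singularity n f)) \<and>
    (diagonal_form n (q + 1) :: 'k mpoly) \<in> nondeg_frobenius_forms n q \<and>
    (\<forall>C\<in>(frobenius_classes n q :: 'k mpoly set set). \<forall>f\<in>C.
       isolated_singularity n f \<longleftrightarrow> C = proj_equiv n (q + 1) `` {diagonal_form n (q + 1)})"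
proof -
  have "prime CHAR('k)" using assms(1,2) prime_CHAR_semidom by blast
  then interpret frobenius_field e q "TYPE('k)"
    using assms by unfold_locales auto
  define D :: "'k mpoly set" where "D = proj_equiv n (q + 1) `` {diagonal_form n (q + 1)}"
  have D: "D \<in> frobenius_classes n q"
    unfolding D_def frobenius_classes_def by (rule quotientI[OF diagonal_form_nondegenerate])
  have ne: "C \<noteq> {}" if "C \<in> frobenius_classes n q" for C :: "'k mpoly set"
  proof -
    obtain P where "P \<in> integer_partitions n" "C = forms_of_type n P" using \<open>C \<in> _\<close> unfolding frobenius_classes_eq by blast
    then show ?thesis using has_type_realize[of P n] unfolding forms_of_type_def by blast
  qed
  have iso: "isolated_singularity n f \<longleftrightarrow> C = D" if "C \<in> frobenius_classes n q" "f \<in> C" for C f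
    using isolated_iff_diagonal_class[OF that] by (simp add: D_def)
  have "\<exists>!C. C \<in> (frobenius_classes n q :: 'k mpoly set set) \<and> (\<forall>f\<in>C. isolated_singularity n f)"
  proof (rule ex1I[of _ D])
    show "D \<in> frobenius_classes n q \<and> (\<forall>f\<in>D. isolated_singularity n f)" using D iso by blast
    fix C :: "'k mpoly set" assume C: "C \<in> frobenius_classes n q \<and> (\<forall>f\<in>C. isolated_singularity n f)"
    then obtain f where "f \<in> C" using ne by blast
    then show "C = D" using C iso by blast
  qed
  moreover have "\<exists>\<phi>. bij_betw \<phi> (frobenius_classes n q :: 'k mpoly set set) (integer_partitions n)"
    using bij_betw_inv_into[OF forms_of_type_bij] by blast
  ultimately show ?thesis
    using diagonal_form_nondegenerate isolated_iff_diagonal_class by blast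
qed

end
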